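(* There exists a constant $C > 0$ such that, for every positive integer $n$ that is a perfect square, the size-Ramsey number of the $\sqrt{n} \times \sqrt{n}$ grid graph is at most $C n^{5/4}$.
   Context: For graphs $G$ and $H$, write $G \rightarrow H$ if every $2$-colouring of the edges of $G$ contains a monochromatic copy of $H$ (as a not necessarily induced subgraph). The size-Ramsey number $\hat r(H)$ of a graph $H$ is the smallest integer $m$ for which there exists a graph $G$ with $m$ edges such that $G \rightarrow H$. For a positive integer $s$, the $s \times s$ grid graph is the graph with vertex set $[s] \times [s]$, where $[s] = \{1, \dotsc, s\}$, in which two pairs are adjacent if and only if they differ by one in exactly one coordinate and agree in the other coordinate. *)

theory Defs
  imports Complex_Main
begin

type_synonym 'a ugraph = "'a set \<times> 'a set set"

abbreviation verts_of :: "'a ugraph \<Rightarrow> 'a set" where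
  "verts_of G \<equiv> fst G"

abbreviation edges_of :: "'a ugraph \<Rightarrow> 'a set set" where
  "edges_of G \<equiv> snd G"

definition finite_simple_graph :: "'a ugraph \<Rightarrow> bool" where
  "finite_simple_graph G \<longleftrightarrow>
     finite (verts_of G) \<and> (\<forall>e \<in> edges_of G. e \<subseteq> verts_of G \<and> card e = 2)"

text \<open>A copy is a subgraph isomorphic to \<open>H\<close>, not necessarily induced: non-edges of \<open>H\<close>
  may be mapped to edges of \<open>G\<close>.\<close>

definition contains_copy :: "'a ugraph \<Rightarrow> 'b ugraph \<Rightarrow> bool" where
  "contains_copy G H \<longleftrightarrow>
     (\<exists>f. inj_on f (verts_of H) \<and> f ` verts_of H \<subseteq> verts_of G \<and>
          (\<forall>e \<in> edges_of H. f ` e \<in> edges_of G))"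

text \<open>Colourings are total functions on vertex sets; only their values on the edges of \<open>G\<close> matter.\<close>

definition arrows :: "'a ugraph \<Rightarrow> 'b ugraph \<Rightarrow> bool" where
  "arrows G H \<longleftrightarrow>
     (\<forall>c :: 'a set \<Rightarrow> bool. \<exists>b. contains_copy (verts_of G, {e \<in> edges_of G. c e = b}) H)"

text \<open>Every finite graph is isomorphic to one with vertices in \<^typ>\<open>nat\<close>, so restricting the
  host graphs to that vertex type loses nothing. For finite \<open>H\<close> the least element exists by
  Ramsey's theorem; otherwise the value is unspecified.\<close>

definition size_ramsey :: "'b ugraph \<Rightarrow> nat" where
  "size_ramsey H =
     (LEAST m. \<exists>G :: nat ugraph. finite_simple_graph G \<and> card (edges_of G) = m \<and> arrows G H)"

definition grid_adj :: "nat \<times> nat \<Rightarrow> nat \<times> nat \<Rightarrow> bool" where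
  "grid_adj u v \<longleftrightarrow>
     (\<bar>int (fst u) - int (fst v)\<bar> = 1 \<and> snd u = snd v) \<or>
     (fst u = fst v \<and> \<bar>int (snd u) - int (snd v)\<bar> = 1)"

definition grid_graph :: "nat \<Rightarrow> (nat \<times> nat) ugraph" where
  "grid_graph s =
     ({1..s} \<times> {1..s},
      {{u, v} | u v. u \<in> {1..s} \<times> {1..s} \<and> v \<in> {1..s} \<times> {1..s} \<and> grid_adj u v})"

lemma finite_simple_graph_grid_graph: "finite_simple_graph (grid_graph s)"
proof -
  have "u \<noteq> v" if "grid_adj u v" for u v
    using that by (auto simp: grid_adj_def)
  then have "card {u, v} = 2" if "grid_adj u v" for u v
    using that by (simp add: card_insert_if)
  then show ?thesis
    unfolding finite_simple_graph_def grid_graph_def by fastforce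
qed

end

theory Submission
  imports Defs "HOL-Library.FuncSet" "HOL-Library.Nat_Bijection"
begin

text \<open>
Put \<open>r = sqrt s\<close>. The host is a blow-up of a bounded-degree graph \<open>F\<close> on \<open>O(s)\<close> vertices whose
two-colourings contain monochromatic paths on \<open>2 s + 1\<close> vertices, even after deleting a few vertices.
Blobs are classes of one random graph \<open>G\<close> on \<open>C q\<^sup>2\<close> vertices with edge probability \<open>1 / q\<close>, where
\<open>q\<close> is of order \<open>r\<close>; this gives \<open>O(s q\<^sup>3) = O(s powr (5 / 2))\<close> edges.

Given a colouring, all blobs are shrunk to a common size such that along almost every edge of \<open>F\<close> one
colour is dense on all pairs of large subsets: a pair whose minimal red density is stable under passing
to smaller subsets is either dense in red, or contains a pair that is dense in blue. A path of \<open>F\<close>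
along which the same colour is dense then hosts the grid: the vertex \<open>(i, j)\<close> goes into blob
\<open>i + j\<close>, into the half given by the parity of \<open>i\<close>.

The rows are embedded one after the other. Each usable vertex has a list of candidates in its
neighbourhood, and the lists of consecutive vertices span an edge between any two large subsets, so
that the next row is found inside the lists of the current one. At most \<open>s\<close> vertices per blob are
occupied, and few lists contain many occupied ones. All this is inherited by an arbitrary
dense one-coloured subgraph \<open>J\<close> of \<open>G\<close>: the sets that are bad for \<open>J\<close> are so rare that the
expected number of \<open>J\<close>, together with linearly many vertices that see a bad set, is small.
\<close>

subsection \<open>Monochromatic paths in graphs of bounded degree\<close>

text \<open>The exponent comes from two constraints on blobs of \<open>N\<close> vertices. A blob
  receives up to \<open>s\<close> grid vertices, so \<open>N\<close> has to be of order
  \<open>s\<close>. Candidate lists have size about \<open>p * N\<close>, and the event that a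
  list's worth of vertices all see many occupied ones involves about \<open>(p * N)\<^sup>2\<close>
  edges, which must outweigh the \<open>exp (O(N))\<close> choices of vertex sets; hence
  \<open>p\<close> is of order \<open>1 / sqrt N\<close>. The obstacle is that the colouring is
  chosen after the host: a union bound over all subgraphs between two blobs would cost
  \<open>2 ^ (N\<^sup>2)\<close>. But the edges of \<open>J\<close> must themselves lie in
  \<open>G\<close>, so summing over \<open>J\<close> costs only
  \<open>(1 + p) ^ (N\<^sup>2) \<le> exp (p * N\<^sup>2)\<close>. Against this stand linearly many
  vertices, each with about \<open>p * N\<close> edges into a bad set: again of order
  \<open>p * N\<^sup>2\<close> edges, and each contributes a factor as small as wished, because bad
  sets are a tiny fraction of all sets of their size.\<close>

text \<open>Depth-first search: \<open>T\<close> holds the unvisited vertices, \<open>xs\<close> is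
  the current path with its head as the active end, and \<open>S\<close> holds the abandoned
  vertices. A vertex is abandoned only when it has no neighbour in \<open>T\<close>, and
  \<open>T\<close> only shrinks, so no edge ever joins \<open>S\<close> to \<open>T\<close>. Each
  step moves one vertex from \<open>T\<close> to the path or from the path to \<open>S\<close>,
  which raises \<open>card S - card T\<close> by one.\<close>

lemma dfs_bipartite_hole:
  fixes E :: "'a \<Rightarrow> 'a \<Rightarrow> bool"
  assumes fin: "finite V" and sym: "\<And>x y. E x y \<Longrightarrow> E y x"
    and nopath: "\<And>xs. distinct xs \<Longrightarrow> set xs \<subseteq> V \<Longrightarrow> successively E xs \<Longrightarrow> length xs < m"
  shows "\<exists>S T. S \<subseteq> V \<and> T \<subseteq> V \<and> S \<inter> T = {} \<and> card S = card T \<and> card V < 2 * card S + m \<and>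
    (\<forall>x\<in>S. \<forall>y\<in>T. \<not> E x y)"
proof -
  have "\<exists>S T xs. S \<union> T \<union> set xs = V \<and> S \<inter> T = {} \<and> S \<inter> set xs = {} \<and> T \<inter> set xs = {} \<and>
      distinct xs \<and> successively E xs \<and> (\<forall>x\<in>S. \<forall>y\<in>T. \<not> E x y) \<and> card V + card S = card T + n"
    if "n \<le> card V" for n
    using that
  proof (induction n)
    case 0
    then show ?case by (intro exI[of _ "{}"] exI[of _ V] exI[of _ "[]"]) auto
  next
    case (Suc n)
    then obtain S T xs where st: "S \<union> T \<union> set xs = V" "S \<inter> T = {}" "S \<inter> set xs = {}" "T \<inter> set xs = {}"
      "distinct xs" "successively E xs" "\<forall>x\<in>S. \<forall>y\<in>T. \<not> E x y" "card V + card S = card T + n"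
      by auto
    have finS: "finite S" "finite T" using st(1) fin by (auto intro: finite_subset)
    have "T \<noteq> {}" using st(8) Suc.prems by auto
    show ?case
    proof (cases "\<exists>y\<in>T. xs = [] \<or> E y (hd xs)")
      case True
      then obtain y where y: "y \<in> T" "xs = [] \<or> E y (hd xs)" by blast
      have "card T = Suc (card (T - {y}))" using y(1) finS by (metis card.remove)
      moreover have "successively E (y # xs)" using y(2) st(6) by (cases xs) auto
      moreover have "S \<union> (T - {y}) \<union> set (y # xs) = V" using st(1) y(1) by auto
      moreover have "S \<inter> (T - {y}) = {}" "S \<inter> set (y # xs) = {}" "(T - {y}) \<inter> set (y # xs) = {}" "distinct (y # xs)"
        using st(2-5) y(1) by auto
      moreover have "\<forall>x\<in>S. \<forall>z\<in>T - {y}. \<not> E x z" using st(7) by blast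
      moreover have "card V + card S = card (T - {y}) + Suc n" using st(8) calculation(1) by simp
      ultimately show ?thesis by blast
    next
      case False
      then obtain z zs where z: "xs = z # zs" using \<open>T \<noteq> {}\<close> by (cases xs) auto
      have "\<forall>y\<in>T. \<not> E z y" using False z sym by auto
      moreover have "card (insert z S) = Suc (card S)" using st z finS by auto
      moreover have "successively E zs" using st(6) z by (cases zs) auto
      moreover have "insert z S \<union> T \<union> set zs = V" using st(1) z by auto
      moreover have "insert z S \<inter> T = {}" "insert z S \<inter> set zs = {}" "T \<inter> set zs = {}" "distinct zs"
        using st(2-5) z by auto
      moreover have "\<forall>x\<in>insert z S. \<forall>y\<in>T. \<not> E x y" using st(7) calculation(1) by blast
      moreover have "card V + card (insert z S) = card T + Suc n" using st(8) calculation(2) by simp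
      ultimately show ?thesis by blast
    qed
  qed
  \<comment> \<open>After \<open>card V\<close> steps the invariant reads
    \<open>card S = card T\<close>, and everything outside the two sets lies on a path, hence
    numbers fewer than \<open>m\<close>.\<close>
  from this[of "card V"] obtain S T xs where st: "S \<union> T \<union> set xs = V" "S \<inter> T = {}" "S \<inter> set xs = {}" "T \<inter> set xs = {}"
      "distinct xs" "successively E xs" "\<forall>x\<in>S. \<forall>y\<in>T. \<not> E x y" "card S = card T"
    by auto
  have finS: "finite S" "finite T" using st(1) fin by (auto intro: finite_subset)
  have "card V = card (S \<union> T) + card (set xs)"
    using st finS by (metis card_Un_disjoint finite_Un List.finite_set Int_Un_distrib2 Un_empty)
  also have "card (S \<union> T) = card S + card T" using st finS by (simp add: card_Un_disjoint)
  also have "card (set xs) = length xs" using st(5) by (simp add: distinct_card)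
  finally have "card V < 2 * card S + m" using st(8) nopath[OF st(5) _ st(6)] st(1) by auto
  then show ?thesis using st by blast
qed

text \<open>If red has no long path, there is a large bipartite hole in red; running the same argument on
  the blue edges across that hole produces two large sets with neither red nor blue edges.\<close>

lemma two_colour_path:
  fixes E :: "'a \<Rightarrow> 'a \<Rightarrow> bool" and col :: "'a \<Rightarrow> 'a \<Rightarrow> bool"
  assumes fin: "finite V" and symE: "\<And>x y. E x y \<Longrightarrow> E y x" and symc: "\<And>x y. col x y = col y x"
    and large: "80 * m \<le> card V" and m: "0 < m"
    and exp: "\<And>A B. A \<subseteq> V \<Longrightarrow> B \<subseteq> V \<Longrightarrow> A \<inter> B = {} \<Longrightarrow> 10 * m \<le> card A \<Longrightarrow> 10 * m \<le> card B \<Longrightarrow>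
               \<exists>a\<in>A. \<exists>b\<in>B. E a b"
  shows "\<exists>b xs. distinct xs \<and> set xs \<subseteq> V \<and> length xs = m \<and> successively (\<lambda>x y. E x y \<and> col x y = b) xs"
proof (rule ccontr)
  assume neg: "\<not> ?thesis"
  have short: "length xs < m" if "distinct xs" "set xs \<subseteq> V" "successively (\<lambda>x y. E x y \<and> col x y = b) xs" for xs b
  proof (rule ccontr)
    assume "\<not> length xs < m"
    then have len: "length (take m xs) = m" by simp
    have "successively (\<lambda>x y. E x y \<and> col x y = b) (take m xs)"
    proof -
      have "successively (\<lambda>x y. E x y \<and> col x y = b) (take m xs @ drop m xs)" using that(3) by simp
      then show ?thesis unfolding successively_append_iff by blast
    qed
    moreover have "distinct (take m xs)" "set (take m xs) \<subseteq> V" using that by (auto dest: in_set_takeD)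
    ultimately show False using neg len by blast
  qed
  have "\<exists>S T. S \<subseteq> V \<and> T \<subseteq> V \<and> S \<inter> T = {} \<and> card S = card T \<and> card V < 2 * card S + m \<and>
      (\<forall>x\<in>S. \<forall>y\<in>T. \<not> (E x y \<and> col x y = True))"
  proof (rule dfs_bipartite_hole)
    show "E y x \<and> col y x = True" if "E x y \<and> col x y = True" for x y using that symE symc by blast
  qed (use fin short in blast)+
  then obtain S T where st: "S \<subseteq> V" "T \<subseteq> V" "S \<inter> T = {}" "card S = card T" "card V < 2 * card S + m"
    "\<forall>x\<in>S. \<forall>y\<in>T. \<not> (E x y \<and> col x y = True)"
    by blast
  define B where "B x y \<longleftrightarrow> (E x y \<and> col x y = False) \<and> ((x \<in> S \<and> y \<in> T) \<or> (x \<in> T \<and> y \<in> S))" for x y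
  have finST: "finite S" "finite T" using st fin finite_subset by auto
  have shortB: "length xs < m" if "distinct xs" "set xs \<subseteq> S \<union> T" "successively B xs" for xs
  proof -
    have "successively (\<lambda>x y. E x y \<and> col x y = False) xs"
      using that(3) by (rule successively_mono) (auto simp: B_def)
    then show ?thesis using short that st by blast
  qed
  have symB: "B x y \<Longrightarrow> B y x" for x y using symE symc by (auto simp: B_def)
  have "\<exists>S' T'. S' \<subseteq> S \<union> T \<and> T' \<subseteq> S \<union> T \<and> S' \<inter> T' = {} \<and> card S' = card T' \<and>
      card (S \<union> T) < 2 * card S' + m \<and> (\<forall>x\<in>S'. \<forall>y\<in>T'. \<not> B x y)"
    using finST symB shortB by (intro dfs_bipartite_hole) blast+
  then obtain S' T' where st': "S' \<subseteq> S \<union> T" "T' \<subseteq> S \<union> T" "S' \<inter> T' = {}" "card S' = card T'"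
    "card (S \<union> T) < 2 * card S' + m" "\<forall>x\<in>S'. \<forall>y\<in>T'. \<not> B x y"
    by blast
  have finST': "finite S'" "finite T'" using st'(1,2) finST by (auto intro: finite_subset)
  have cST: "card (S \<union> T) = card S + card T" using st finST by (simp add: card_Un_disjoint)
  have split: "card X = card (X \<inter> S) + card (X \<inter> T)" if "X \<subseteq> S \<union> T" "finite X" for X
  proof -
    have "X = (X \<inter> S) \<union> (X \<inter> T)" using that by auto
    moreover have "card ((X \<inter> S) \<union> (X \<inter> T)) = card (X \<inter> S) + card (X \<inter> T)"
      using that st by (intro card_Un_disjoint) auto
    ultimately show ?thesis by simp
  qed
  have sub: "card (S' \<inter> X) + card (T' \<inter> X) \<le> card X" if "finite X" for X
  proof -
    have "card (S' \<inter> X) + card (T' \<inter> X) = card ((S' \<inter> X) \<union> (T' \<inter> X))"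
      using that st' by (intro card_Un_disjoint[symmetric]) auto
    also have "\<dots> \<le> card X" using that by (intro card_mono) auto
    finally show ?thesis .
  qed
  \<comment> \<open>\<open>S'\<close> and \<open>T'\<close> are disjoint, equally large and miss
    fewer than \<open>m\<close> vertices of \<open>S \<union> T\<close>, whose two sides have more
    than \<open>39 * m\<close> vertices each. If both had a part below \<open>10 * m\<close> in the
    same side, that side would mostly be missed; if one of them had both its parts below
    \<open>10 * m\<close>, it would be too small. So two crosswise parts are large, and such a pair
    spans no edge of either colour.\<close>
  have "(10 * m \<le> card (S' \<inter> S) \<and> 10 * m \<le> card (T' \<inter> T)) \<or> (10 * m \<le> card (S' \<inter> T) \<and> 10 * m \<le> card (T' \<inter> S))"
    using split[OF st'(1) finST'(1)] split[OF st'(2) finST'(2)] sub[OF finST(1)] sub[OF finST(2)] st(4,5) st'(4,5) cST large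
    by linarith
  then show False
  proof
    assume "10 * m \<le> card (S' \<inter> S) \<and> 10 * m \<le> card (T' \<inter> T)"
    then obtain a b where ab: "a \<in> S' \<inter> S" "b \<in> T' \<inter> T" "E a b"
      using exp[of "S' \<inter> S" "T' \<inter> T"] st st' by blast
    then show False using st(6) st'(6) by (auto simp: B_def)
  next
    assume "10 * m \<le> card (S' \<inter> T) \<and> 10 * m \<le> card (T' \<inter> S)"
    then obtain a b where ab: "a \<in> S' \<inter> T" "b \<in> T' \<inter> S" "E a b"
      using exp[of "S' \<inter> T" "T' \<inter> S"] st st' by blast
    have "E b a" "col a b = col b a" using ab symE symc by auto
    then have "B a b" using ab st(6) by (auto simp: B_def)
    then show False using ab st'(6) by blast
  qed
qed

lemma greedy_colouring:
  fixes conf :: "'a \<Rightarrow> 'a \<Rightarrow> bool"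
  assumes "finite V" and "\<And>x. x \<in> V \<Longrightarrow> card {y \<in> V. conf x y} < k" and sym: "\<And>x y. conf x y \<Longrightarrow> conf y x"
    and irr: "\<And>x. \<not> conf x x"
  shows "\<exists>c :: 'a \<Rightarrow> nat. (\<forall>x\<in>V. c x < k) \<and> (\<forall>x\<in>V. \<forall>y\<in>V. conf x y \<longrightarrow> c x \<noteq> c y)"
  using assms(1,2)
proof (induction V rule: finite_induct)
  case empty
  then show ?case by auto
next
  case (insert a V)
  have "card {y \<in> V. conf x y} < k" if "x \<in> V" for x
  proof -
    have "card {y \<in> V. conf x y} \<le> card {y \<in> insert a V. conf x y}"
      using insert by (intro card_mono) auto
    then show ?thesis using insert.prems[of x] that by simp
  qed
  then obtain c where c: "\<forall>x\<in>V. c x < k" "\<forall>x\<in>V. \<forall>y\<in>V. conf x y \<longrightarrow> c x \<noteq> c y"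
    using insert.IH by auto
  have "card (c ` {y \<in> insert a V. conf a y}) < k"
    using insert.prems[of a] insert.hyps by (intro le_less_trans[OF card_image_le]) auto
  then have "\<not> {..<k} \<subseteq> c ` {y \<in> insert a V. conf a y}"
    using insert.hyps card_mono[of "c ` {y \<in> insert a V. conf a y}" "{..<k}"] by auto
  then obtain i where i: "i < k" "i \<notin> c ` {y \<in> insert a V. conf a y}" by auto
  show ?case
  proof (intro exI[of _ "c(a := i)"] conjI ballI impI)
    show "(c(a := i)) x < k" if "x \<in> insert a V" for x using that i c by auto
    show "(c(a := i)) x \<noteq> (c(a := i)) y" if "x \<in> insert a V" "y \<in> insert a V" "conf x y" for x y
    proof (cases "x = a")
      case True
      then have "y \<noteq> a" using irr that by auto
      moreover have "c y \<in> c ` {y \<in> insert a V. conf a y}" using that True by blast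
      ultimately show ?thesis using True i by auto
    next
      case False
      show ?thesis
      proof (cases "y = a")
        case True
        then have "c x \<in> c ` {y \<in> insert a V. conf a y}" using that sym by blast
        then show ?thesis using True False i by auto
      next
        case False
        then show ?thesis using \<open>x \<noteq> a\<close> that c by auto
      qed
    qed
  qed
qed

text \<open>A first-moment argument by counting: a rectangle with sides at least
  \<open>10 * m\<close> occupies at least one hundredth of the square, so a proportion of at most
  \<open>(99 / 100) ^ (200 * M)\<close> of all sequences avoids it, and there are at most
  \<open>4 ^ M\<close> rectangles. Sequences instead of edge sets keep the choices independent;
  loops and repetitions do no harm.\<close>

lemma linear_edges_meeting_rectangles:
  fixes m :: nat
  assumes m: "0 < m"
  defines "M \<equiv> 100 * m"
  shows "\<exists>f :: nat \<Rightarrow> nat \<times> nat. (\<forall>j<200 * M. f j \<in> {..<M} \<times> {..<M}) \<and>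
    (\<forall>A B. A \<subseteq> {..<M} \<longrightarrow> B \<subseteq> {..<M} \<longrightarrow> 10 * m \<le> card A \<longrightarrow> 10 * m \<le> card B \<longrightarrow>
       (\<exists>j<200 * M. f j \<in> A \<times> B))"
proof (rule ccontr)
  assume neg: "\<not> ?thesis"
  define k where "k = 200 * M"
  define U where "U = {..<M} \<times> {..<M}"
  define R where "R = {(A, B). A \<subseteq> {..<M} \<and> B \<subseteq> {..<M} \<and> 10 * m \<le> card A \<and> 10 * m \<le> card B}"
  define hits where "hits f \<longleftrightarrow> (\<forall>A B. A \<subseteq> {..<M} \<longrightarrow> B \<subseteq> {..<M} \<longrightarrow>
    10 * m \<le> card A \<longrightarrow> 10 * m \<le> card B \<longrightarrow> (\<exists>j<200 * M. f j \<in> A \<times> B))" for f :: "nat \<Rightarrow> nat \<times> nat"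
  have nohits: "\<not> hits f" if "\<forall>j<200 * M. f j \<in> {..<M} \<times> {..<M}" for f
    using neg that unfolding hits_def by (rule_tac notI) (erule notE, rule exI[of _ f], rule conjI)
  have finU: "finite U" and cardU: "card U = M * M" by (auto simp: U_def)
  have Rsub: "R \<subseteq> Pow {..<M} \<times> Pow {..<M}" by (auto simp: R_def)
  then have finR: "finite R" by (rule finite_subset) auto
  have cardR: "card R \<le> 4 ^ M"
  proof -
    have "card R \<le> card (Pow {..<M} \<times> Pow {..<M})" using Rsub by (intro card_mono) auto
    also have "\<dots> = 4 ^ M" by (simp add: card_cartesian_product card_Pow power_mult_distrib[symmetric])
    finally show ?thesis .
  qed
  have "PiE {..<k} (\<lambda>_. U) \<subseteq> (\<Union>(A, B)\<in>R. PiE {..<k} (\<lambda>_. U - A \<times> B))"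
  proof
    fix f assume f: "f \<in> PiE {..<k} (\<lambda>_. U)"
    then have "\<forall>j<200 * M. f j \<in> {..<M} \<times> {..<M}" by (auto simp: k_def U_def dest!: PiE_mem)
    then have "\<not> hits f" by (rule nohits)
    then obtain A B where AB: "A \<subseteq> {..<M}" "B \<subseteq> {..<M}" "10 * m \<le> card A" "10 * m \<le> card B"
      "\<forall>j<200 * M. f j \<notin> A \<times> B" unfolding hits_def not_all not_imp by auto
    then have "f \<in> PiE {..<k} (\<lambda>_. U - A \<times> B)" using f by (auto simp: PiE_iff k_def)
    then show "f \<in> (\<Union>(A, B)\<in>R. PiE {..<k} (\<lambda>_. U - A \<times> B))" using AB by (auto simp: R_def)
  qed
  then have "card (PiE {..<k} (\<lambda>_. U)) \<le> card (\<Union>(A, B)\<in>R. PiE {..<k} (\<lambda>_. U - A \<times> B))"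
    using finR finU by (intro card_mono finite_UN_I) (auto intro!: finite_PiE)
  also have "\<dots> \<le> (\<Sum>(A, B)\<in>R. card (PiE {..<k} (\<lambda>_. U - A \<times> B)))"
    using card_UN_le[OF finR, of "\<lambda>(A, B). PiE {..<k} (\<lambda>_. U - A \<times> B)"] by (simp add: case_prod_unfold)
  finally have 1: "(M * M) ^ k \<le> (\<Sum>(A, B)\<in>R. card (U - A \<times> B) ^ k)"
    by (simp add: card_PiE cardU)
  have 2: "real (card (U - A \<times> B)) \<le> (99 / 100) * (real M * real M)" if "(A, B) \<in> R" for A B
  proof -
    have AB: "A \<times> B \<subseteq> U" "10 * m \<le> card A" "10 * m \<le> card B" using that by (auto simp: R_def U_def)
    have "(10 * m) * (10 * m) \<le> card A * card B" using AB by (intro mult_mono) auto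
    moreover have "card (U - A \<times> B) = M * M - card A * card B"
      using AB finU by (subst card_Diff_subset) (auto intro: finite_subset simp: cardU card_cartesian_product)
    ultimately have "card (U - A \<times> B) + (10 * m) * (10 * m) \<le> M * M"
      using card_mono[OF finU AB(1)] by (simp add: card_cartesian_product cardU)
    then have "real (card (U - A \<times> B) + (10 * m) * (10 * m)) \<le> real (M * M)"
      by (rule of_nat_mono)
    then show ?thesis by (simp add: M_def)
  qed
  have "(real M * real M) ^ k \<le> (\<Sum>(A, B)\<in>R. real (card (U - A \<times> B)) ^ k)"
  proof -
    have "real ((M * M) ^ k) \<le> real (\<Sum>(A, B)\<in>R. card (U - A \<times> B) ^ k)" using 1 of_nat_le_iff by blast
    then show ?thesis by (simp add: case_prod_unfold)
  qed
  also have "\<dots> \<le> (\<Sum>(A, B)\<in>R. ((99 / 100) * (real M * real M)) ^ k)"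
    using 2 by (intro sum_mono) (auto intro!: power_mono)
  also have "\<dots> = real (card R) * ((99 / 100) * (real M * real M)) ^ k" by (simp add: case_prod_unfold)
  also have "\<dots> \<le> 4 ^ M * ((99 / 100) * (real M * real M)) ^ k"
    using cardR by (intro mult_right_mono) (auto simp flip: of_nat_le_iff)
  also have "\<dots> = (4 * (99 / 100) ^ 200) ^ M * (real M * real M) ^ k"
    by (simp only: power_mult_distrib k_def power_mult)
  finally have "1 * (real M * real M) ^ k \<le> (4 * (99 / 100) ^ 200) ^ M * (real M * real M) ^ k" by simp
  moreover have "0 < (real M * real M) ^ k" using m by (simp add: M_def)
  ultimately have "(1::real) \<le> (4 * (99 / 100) ^ 200) ^ M" by (rule mult_right_le_imp_le)
  moreover have "(4 * (99 / 100) ^ 200 :: real) ^ M < 1 ^ M"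
  proof (rule power_strict_mono)
    \<comment> \<open>The exponent is split so that \<open>(99 / 100) ^ 10\<close> can be rounded up
      to \<open>91 / 100\<close>, whose twentieth power is still below \<open>1 / 4\<close>.\<close>
    have "((99 / 100) ^ 10) ^ 20 \<le> (91 / 100 :: real) ^ 20" by (rule power_mono) (simp_all add: power_divide)
    also have "\<dots> < 1 / 4" by (simp add: power_divide)
    finally show "(4 * (99 / 100) ^ 200 :: real) < 1" unfolding power_mult[symmetric] by simp
    show "0 < M" using m by (simp add: M_def)
  qed simp
  ultimately show False unfolding power_one by linarith
qed

text \<open>The colouring is proper for the square of the graph. Such colours allow far-apart
  vertices to share a blob, bound the degrees, and split the edges into matchings, one for each
  ordered pair of colours. The number \<open>16004001 = 4000 + 4000 * 4000 + 1\<close> is what a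
  greedy choice needs at maximum degree \<open>4000\<close>.\<close>

lemma reduced_graph:
  fixes m :: nat
  assumes m: "0 < m" and \<kappa>: "16004001 \<le> \<kappa>"
  obtains V :: "nat set" and E :: "nat \<Rightarrow> nat \<Rightarrow> bool" and c :: "nat \<Rightarrow> nat"
  where "finite V" "card V \<le> 100 * m" "90 * m \<le> card V"
    "\<And>x y. E x y \<Longrightarrow> E y x" "\<And>x y. E x y \<Longrightarrow> x \<in> V"
    "\<And>x. x \<in> V \<Longrightarrow> c x < \<kappa>"
    "\<And>x y. E x y \<Longrightarrow> c x \<noteq> c y" "\<And>x y z. E x y \<Longrightarrow> E x z \<Longrightarrow> y \<noteq> z \<Longrightarrow> c y \<noteq> c z"
    "\<And>A B. A \<subseteq> V \<Longrightarrow> B \<subseteq> V \<Longrightarrow> A \<inter> B = {} \<Longrightarrow> 10 * m \<le> card A \<Longrightarrow> 10 * m \<le> card B \<Longrightarrow>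
      \<exists>a\<in>A. \<exists>b\<in>B. E a b"
proof -
  define M where "M = 100 * m"
  obtain f :: "nat \<Rightarrow> nat \<times> nat" where f: "\<forall>j<200 * M. f j \<in> {..<M} \<times> {..<M}"
    "\<And>A B. A \<subseteq> {..<M} \<Longrightarrow> B \<subseteq> {..<M} \<Longrightarrow> 10 * m \<le> card A \<Longrightarrow> 10 * m \<le> card B \<Longrightarrow>
       (\<exists>j<200 * M. f j \<in> A \<times> B)"
    using linear_edges_meeting_rectangles[OF m] unfolding M_def by blast
  define D where "D x = {j \<in> {..<200 * M}. fst (f j) = x} \<union> {j \<in> {..<200 * M}. snd (f j) = x}" for x
  \<comment> \<open>The average of \<open>card (D x)\<close> is at most \<open>400\<close>, so at
    most a tenth of the vertices exceed \<open>4000\<close>.\<close>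
  define V where "V = {x \<in> {..<M}. card (D x) \<le> 4000}"
  define E where "E x y \<longleftrightarrow> x \<in> V \<and> y \<in> V \<and> x \<noteq> y \<and> (\<exists>j<200 * M. f j = (x, y) \<or> f j = (y, x))" for x y
  have finV: "finite V" and VM: "V \<subseteq> {..<M}" by (auto simp: V_def)
  have sumfib: "(\<Sum>x<M. card {j \<in> {..<200 * M}. g j = x}) \<le> 200 * M" for g :: "nat \<Rightarrow> nat"
  proof -
    have "(\<Sum>x<M. card {j \<in> {..<200 * M}. g j = x}) = card (\<Union>x<M. {j \<in> {..<200 * M}. g j = x})"
      by (subst card_UN_disjoint) auto
    also have "\<dots> \<le> card {..<200 * M}" by (intro card_mono) auto
    finally show ?thesis by simp
  qed
  have "(\<Sum>x<M. card (D x)) \<le> (\<Sum>x<M. card {j \<in> {..<200 * M}. fst (f j) = x} + card {j \<in> {..<200 * M}. snd (f j) = x})"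
    unfolding D_def by (intro sum_mono card_Un_le)
  also have "\<dots> \<le> 400 * M"
    using sumfib[of "\<lambda>j. fst (f j)"] sumfib[of "\<lambda>j. snd (f j)"] by (simp add: sum.distrib)
  finally have sumD: "(\<Sum>x<M. card (D x)) \<le> 400 * M" .
  have "4000 * card ({..<M} - V) \<le> (\<Sum>x\<in>{..<M} - V. card (D x))"
  proof -
    have "(\<Sum>x\<in>{..<M} - V. 4000) \<le> (\<Sum>x\<in>{..<M} - V. card (D x))" by (intro sum_mono) (auto simp: V_def)
    then show ?thesis by simp
  qed
  also have "\<dots> \<le> (\<Sum>x<M. card (D x))" by (intro sum_mono2) auto
  finally have "10 * card ({..<M} - V) \<le> M" using sumD by simp
  moreover have "card ({..<M} - V) = M - card V" using VM finV by (simp add: card_Diff_subset)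
  moreover have "card V \<le> M" using card_mono[OF _ VM] by simp
  ultimately have cV: "90 * m \<le> card V" "card V \<le> 100 * m" by (auto simp: M_def)
  have deg: "card {y. E x y} \<le> 4000" if "x \<in> V" for x
  proof -
    have "{y. E x y} \<subseteq> (\<lambda>j. if fst (f j) = x then snd (f j) else fst (f j)) ` D x"
    proof
      fix y assume "y \<in> {y. E x y}"
      then obtain j where j: "j < 200 * M" "f j = (x, y) \<or> f j = (y, x)" "x \<noteq> y" by (auto simp: E_def)
      then have "j \<in> D x" "y = (if fst (f j) = x then snd (f j) else fst (f j))" by (cases "f j"; auto simp: D_def)+
      then show "y \<in> (\<lambda>j. if fst (f j) = x then snd (f j) else fst (f j)) ` D x" by blast
    qed
    moreover have "finite (D x)" by (auto simp: D_def)
    ultimately have "card {y. E x y} \<le> card (D x)" by (meson card_image_le card_mono finite_imageI le_trans)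
    then show ?thesis using that by (simp add: V_def)
  qed
  have finN: "finite {y. E x y}" for x by (rule finite_subset[OF _ finV]) (auto simp: E_def)
  have symE: "E x y \<Longrightarrow> E y x" for x y by (auto simp: E_def)
  define conf where "conf x y \<longleftrightarrow> x \<noteq> y \<and> (E x y \<or> (\<exists>z. E x z \<and> E z y))" for x y
  have "\<exists>c :: nat \<Rightarrow> nat. (\<forall>x\<in>V. c x < \<kappa>) \<and> (\<forall>x\<in>V. \<forall>y\<in>V. conf x y \<longrightarrow> c x \<noteq> c y)"
  proof (rule greedy_colouring[OF finV])
    show "card {y \<in> V. conf x y} < \<kappa>" if x: "x \<in> V" for x
    proof -
      have "{y \<in> V. conf x y} \<subseteq> {y. E x y} \<union> (\<Union>z\<in>{z. E x z}. {y. E z y})" by (auto simp: conf_def)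
      then have "card {y \<in> V. conf x y} \<le> card ({y. E x y} \<union> (\<Union>z\<in>{z. E x z}. {y. E z y}))"
        using finN by (intro card_mono) auto
      also have "\<dots> \<le> card {y. E x y} + card (\<Union>z\<in>{z. E x z}. {y. E z y})" by (rule card_Un_le)
      also have "card (\<Union>z\<in>{z. E x z}. {y. E z y}) \<le> (\<Sum>z\<in>{z. E x z}. card {y. E z y})"
        using finN by (intro card_UN_le)
      also have "\<dots> \<le> (\<Sum>z\<in>{z. E x z}. 4000)" using deg by (intro sum_mono) (auto simp: E_def)
      also have "\<dots> \<le> 4000 * 4000" using deg[OF x] by simp
      finally show ?thesis using deg[OF x] \<kappa> by linarith
    qed
    show "conf y x" if "conf x y" for x y using that symE unfolding conf_def by blast
  qed (simp add: conf_def)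
  then obtain c :: "nat \<Rightarrow> nat" where c: "\<forall>x\<in>V. c x < \<kappa>" "\<forall>x\<in>V. \<forall>y\<in>V. conf x y \<longrightarrow> c x \<noteq> c y" by blast
  show thesis
  proof (rule that[of V E c])
    show "\<exists>a\<in>A. \<exists>b\<in>B. E a b" if AB: "A \<subseteq> V" "B \<subseteq> V" "A \<inter> B = {}" "10 * m \<le> card A" "10 * m \<le> card B" for A B
    proof -
      have "\<exists>j<200 * M. f j \<in> A \<times> B" using AB VM by (intro f(2)) auto
      then obtain j where "j < 200 * M" "f j \<in> A \<times> B" by auto
      then have "E (fst (f j)) (snd (f j))" using AB by (auto simp: E_def mem_Times_iff)
      then show ?thesis using \<open>f j \<in> A \<times> B\<close> by (auto simp: mem_Times_iff)
    qed
    show "c x \<noteq> c y" if "E x y" for x y using that c(2) by (auto simp: E_def conf_def)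
    show "c y \<noteq> c z" if "E x y" "E x z" "y \<noteq> z" for x y z
    proof -
      have "conf y z" using that symE unfolding conf_def by blast
      then show ?thesis using c(2) that by (auto simp: E_def)
    qed
  qed (use finV cV symE c(1) in \<open>auto simp: E_def\<close>)
qed

subsection \<open>Random subsets\<close>

text \<open>The law of a binomial random subset, in which every element of \<open>E\<close> appears
  independently with probability \<open>p\<close>. A finite weighted sum is all that the
  first-moment arguments need, so no measure space is built.\<close>

definition rprob :: "'e set \<Rightarrow> real \<Rightarrow> ('e set \<Rightarrow> bool) \<Rightarrow> real" where
  "rprob E p Q = (\<Sum>G\<in>{G \<in> Pow E. Q G}. p ^ card G * (1 - p) ^ card (E - G))"

lemma sum_Pow_prod:
  fixes f g :: "'e \<Rightarrow> real"
  assumes "finite E"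
  shows "(\<Sum>G\<in>Pow E. prod f G * prod g (E - G)) = (\<Prod>e\<in>E. f e + g e)"
  using assms by (simp add: prod_add)

context
  fixes E :: "'e set" and p :: real
  assumes fin: "finite E" and p: "0 \<le> p" "p \<le> 1"
begin

lemma rprob_restrict:
  "rprob E p Q = (\<Sum>G\<in>Pow E. if Q G then p ^ card G * (1 - p) ^ card (E - G) else 0)"
  unfolding rprob_def using fin by (intro sum.inter_filter) auto

lemma rprob_True: "rprob E p (\<lambda>_. True) = 1"
  using sum_Pow_prod[OF fin, of "\<lambda>_. p" "\<lambda>_. 1 - p"] by (simp add: rprob_restrict)

lemma rprob_mono: "(\<And>G. G \<subseteq> E \<Longrightarrow> Q G \<Longrightarrow> Q' G) \<Longrightarrow> rprob E p Q \<le> rprob E p Q'"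
  unfolding rprob_def using p fin by (intro sum_mono2) auto

lemma rprob_UN:
  assumes I: "finite I"
  shows "rprob E p (\<lambda>G. \<exists>i\<in>I. Q i G) \<le> (\<Sum>i\<in>I. rprob E p (Q i))"
proof -
  have "rprob E p (\<lambda>G. \<exists>i\<in>I. Q i G) \<le>
      (\<Sum>G\<in>Pow E. \<Sum>i\<in>I. if Q i G then p ^ card G * (1 - p) ^ card (E - G) else 0)"
    unfolding rprob_restrict
  proof (rule sum_mono)
    fix G
    show "(if \<exists>i\<in>I. Q i G then p ^ card G * (1 - p) ^ card (E - G) else 0) \<le>
        (\<Sum>i\<in>I. if Q i G then p ^ card G * (1 - p) ^ card (E - G) else 0)"
    proof (cases "\<exists>i\<in>I. Q i G")
      case True
      then obtain i where "i \<in> I" "Q i G" by blast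
      then show ?thesis
        using member_le_sum[of i I "\<lambda>i. if Q i G then p ^ card G * (1 - p) ^ card (E - G) else 0"] p I
        by auto
    qed (use p in \<open>auto intro!: sum_nonneg\<close>)
  qed
  also have "\<dots> = (\<Sum>i\<in>I. rprob E p (Q i))"
    unfolding rprob_restrict by (rule sum.swap)
  finally show ?thesis .
qed

lemma rprob_disj: "rprob E p (\<lambda>G. Q G \<or> Q' G) \<le> rprob E p Q + rprob E p Q'"
proof -
  have "rprob E p (\<lambda>G. Q G \<or> Q' G) = rprob E p (\<lambda>G. \<exists>b\<in>UNIV. (if b then Q else Q') G)"
    by (rule arg_cong[of _ _ "rprob E p"]) (auto split: if_splits)
  also have "\<dots> \<le> (\<Sum>b\<in>UNIV. rprob E p (if b then Q else Q'))" by (intro rprob_UN) auto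
  also have "\<dots> = rprob E p Q + rprob E p Q'" by (simp add: UNIV_bool)
  finally show ?thesis .
qed

lemma rprob_less_one_ex:
  assumes "rprob E p Q < 1"
  shows "\<exists>G\<subseteq>E. \<not> Q G"
proof (rule ccontr)
  assume "\<not> ?thesis"
  then have "rprob E p (\<lambda>_. True) \<le> rprob E p Q" by (intro rprob_mono) auto
  then show False using assms rprob_True by simp
qed

lemma rprob_superset:
  assumes S: "S \<subseteq> E"
  shows "rprob E p (\<lambda>G. S \<subseteq> G) = p ^ card S"
proof -
  \<comment> \<open>Giving the omission of an element of \<open>S\<close> weight zero turns the sum
    over supersets of \<open>S\<close> into an unrestricted one, which factorises.\<close>
  have "(\<Prod>e\<in>E - G. if e \<in> S then 0 else 1 - p) = (if S \<subseteq> G then (1 - p) ^ card (E - G) else 0)"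
    if "G \<subseteq> E" for G
  proof (cases "S \<subseteq> G")
    case True
    then have "(\<Prod>e\<in>E - G. if e \<in> S then 0 else 1 - p) = (\<Prod>e\<in>E - G. 1 - p)" by (intro prod.cong) auto
    then show ?thesis using True by simp
  next
    case False
    then obtain e where "e \<in> S" "e \<in> E - G" using S by auto
    then show ?thesis using False fin by (auto intro!: prod_zero)
  qed
  then have "rprob E p (\<lambda>G. S \<subseteq> G) = (\<Sum>G\<in>Pow E. prod (\<lambda>_. p) G * (\<Prod>e\<in>E - G. if e \<in> S then 0 else 1 - p))"
    unfolding rprob_restrict by (intro sum.cong) auto
  also have "\<dots> = (\<Prod>e\<in>E. p + (if e \<in> S then 0 else 1 - p))"
    by (rule sum_Pow_prod[OF fin])
  also have "\<dots> = (\<Prod>e\<in>E. if e \<in> S then p else 1)" by (intro prod.cong) auto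
  also have "\<dots> = (\<Prod>e\<in>E \<inter> S. p) * (\<Prod>e\<in>E \<inter> - S. 1)" using fin by (subst prod.If_cases) auto
  also have "\<dots> = p ^ card S" using S by (simp add: Int_absorb1)
  finally show ?thesis .
qed

text \<open>Markov's inequality; the expected size is the sum of the inclusion probabilities of
  single elements.\<close>

lemma rprob_card_ge:
  assumes pos: "0 < p * real (card E)"
  shows "rprob E p (\<lambda>G. 4 * p * real (card E) \<le> real (card G)) \<le> 1 / 4"
proof -
  let ?w = "\<lambda>G. p ^ card G * (1 - p) ^ card (E - G)"
  have "4 * p * real (card E) * rprob E p (\<lambda>G. 4 * p * real (card E) \<le> real (card G)) \<le> (\<Sum>G\<in>Pow E. ?w G * real (card G))"
  proof -
    have "4 * p * real (card E) * rprob E p (\<lambda>G. 4 * p * real (card E) \<le> real (card G)) =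
       (\<Sum>G\<in>{G \<in> Pow E. 4 * p * real (card E) \<le> real (card G)}. ?w G * (4 * p * real (card E)))"
      unfolding rprob_def by (simp add: sum_distrib_left mult_ac)
    also have "\<dots> \<le> (\<Sum>G\<in>{G \<in> Pow E. 4 * p * real (card E) \<le> real (card G)}. ?w G * real (card G))"
      using p by (intro sum_mono mult_left_mono) auto
    also have "\<dots> \<le> (\<Sum>G\<in>Pow E. ?w G * real (card G))" using p fin by (intro sum_mono2) auto
    finally show ?thesis .
  qed
  also have "\<dots> = (\<Sum>G\<in>Pow E. \<Sum>e\<in>E. if {e} \<subseteq> G then ?w G else 0)"
  proof (rule sum.cong[OF refl])
    fix G assume "G \<in> Pow E"
    then have "(\<Sum>e\<in>E. if {e} \<subseteq> G then ?w G else 0) = (\<Sum>e\<in>G. ?w G)"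
      using fin by (intro sum.mono_neutral_cong_right) auto
    then show "?w G * real (card G) = (\<Sum>e\<in>E. if {e} \<subseteq> G then ?w G else 0)" by simp
  qed
  also have "\<dots> = (\<Sum>e\<in>E. rprob E p (\<lambda>G. {e} \<subseteq> G))"
    unfolding rprob_restrict by (rule sum.swap)
  also have "\<dots> = (\<Sum>e\<in>E. p)" by (intro sum.cong refl, subst rprob_superset) auto
  finally have "(p * real (card E)) * (4 * rprob E p (\<lambda>G. 4 * p * real (card E) \<le> real (card G))) \<le> (p * real (card E)) * 1"
    by (simp add: mult_ac)
  then show ?thesis using pos mult_le_cancel_left_pos by force
qed

text \<open>Chernoff's method with base \<open>1 / 2\<close>: on the event,
  \<open>2 powr (p * card A / 2) * (1 / 2) ^ card (G \<inter> A)\<close> is at least one, and its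
  expectation factorises over the elements.\<close>

lemma rprob_lower_tail:
  assumes A: "A \<subseteq> E"
  shows "rprob E p (\<lambda>G. real (card (G \<inter> A)) < p * real (card A) / 2) \<le> exp (- (p * real (card A) / 8))"
proof -
  let ?n = "real (card A)"
  let ?w = "\<lambda>G. p ^ card G * (1 - p) ^ card (E - G)"
  have "rprob E p (\<lambda>G. real (card (G \<inter> A)) < p * ?n / 2) \<le> (\<Sum>G\<in>Pow E. ?w G * (2 powr (p * ?n / 2) * (1 / 2) ^ card (G \<inter> A)))"
    unfolding rprob_restrict
  proof (rule sum_mono)
    fix G assume "G \<in> Pow E"
    show "(if real (card (G \<inter> A)) < p * ?n / 2 then ?w G else 0) \<le> ?w G * (2 powr (p * ?n / 2) * (1 / 2) ^ card (G \<inter> A))"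
    proof (cases "real (card (G \<inter> A)) < p * ?n / 2")
      case True
      have "1 = 2 powr real (card (G \<inter> A)) * (1 / 2) ^ card (G \<inter> A)"
        by (simp add: powr_realpow power_divide)
      also have "\<dots> \<le> 2 powr (p * ?n / 2) * (1 / 2) ^ card (G \<inter> A)"
        using True by (intro mult_right_mono powr_mono) auto
      finally have "?w G * 1 \<le> ?w G * (2 powr (p * ?n / 2) * (1 / 2) ^ card (G \<inter> A))"
        using p by (intro mult_left_mono) auto
      then show ?thesis using True by simp
    qed (use p in simp)
  qed
  also have "\<dots> = 2 powr (p * ?n / 2) * (\<Sum>G\<in>Pow E. (\<Prod>e\<in>G. if e \<in> A then p / 2 else p) * (\<Prod>e\<in>E - G. 1 - p))"
    unfolding sum_distrib_left
  proof (rule sum.cong[OF refl])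
    fix G assume "G \<in> Pow E"
    then have fG: "finite G" using fin finite_subset by auto
    have "(\<Prod>e\<in>G. if e \<in> A then p / 2 else p) = (\<Prod>e\<in>G. p * (if e \<in> A then 1 / 2 else 1))"
      by (intro prod.cong) auto
    also have "\<dots> = p ^ card G * (\<Prod>e\<in>G. if e \<in> A then 1 / 2 else 1)" by (simp add: prod.distrib)
    also have "(\<Prod>e\<in>G. if e \<in> A then 1 / 2 else (1::real)) = (1 / 2) ^ card (G \<inter> A)"
      using fG by (simp add: prod.If_cases)
    finally show "?w G * (2 powr (p * ?n / 2) * (1 / 2) ^ card (G \<inter> A)) =
      2 powr (p * ?n / 2) * ((\<Prod>e\<in>G. if e \<in> A then p / 2 else p) * (\<Prod>e\<in>E - G. 1 - p))" by simp
  qed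
  also have "(\<Sum>G\<in>Pow E. (\<Prod>e\<in>G. if e \<in> A then p / 2 else p) * (\<Prod>e\<in>E - G. 1 - p)) = (\<Prod>e\<in>E. (if e \<in> A then p / 2 else p) + (1 - p))"
    by (rule sum_Pow_prod[OF fin])
  also have "\<dots> = (\<Prod>e\<in>E. if e \<in> A then 1 - p / 2 else 1)" by (intro prod.cong) auto
  also have "\<dots> = (1 - p / 2) ^ card A" using fin A by (simp add: prod.If_cases Int_absorb1)
  also have "\<dots> \<le> exp (- (p / 2)) ^ card A"
    using p exp_ge_add_one_self[of "- (p / 2)"] by (intro power_mono) auto
  also have "\<dots> = exp (- (p * ?n / 2))" by (simp add: exp_of_nat_mult[symmetric] mult_ac)
  also have "2 powr (p * ?n / 2) * exp (- (p * ?n / 2)) = exp ((ln 2 - 1) * (p * ?n / 2))"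
    by (simp add: powr_def exp_add[symmetric] algebra_simps)
  also have "\<dots> \<le> exp (- (p * ?n / 8))"
  proof -
    \<comment> \<open>\<open>1 + 3 / 4 + 9 / 32 > 2\<close>, so \<open>ln 2 \<le> 3 / 4\<close>,
      which leaves a quarter of the exponent \<open>p * card A / 2\<close>.\<close>
    have "2 \<le> exp (3 / 4 :: real)" using exp_lower_Taylor_quadratic[of "3 / 4 :: real"] by (simp add: power2_eq_square)
    then have "ln 2 \<le> ln (exp (3 / 4 :: real))" by (subst ln_le_cancel_iff) auto
    then have "ln 2 \<le> (3 / 4 :: real)" by simp
    then have "(ln 2 - 1) * (p * ?n / 2) \<le> (- 1 / 4) * (p * ?n / 2)"
      using p by (intro mult_right_mono) auto
    then show ?thesis by simp
  qed
  finally show ?thesis by (simp add: mult_left_mono)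
qed

text \<open>The first-moment bound behind all host properties: \<open>J\<close> ranges over subgraphs inside \<open>Z\<close>, and
  every vertex of \<open>P\<close> has some member of the family \<open>F J\<close> inside its neighbourhood. The edges
  involved are distinct, so each configuration has probability exactly \<open>p\<close> to the number of edges.\<close>

lemma rprob_first_moment:
  fixes F :: "'e set \<Rightarrow> 'a set set" and edge :: "'a \<Rightarrow> 'a \<Rightarrow> 'e"
  assumes W: "finite W" and Z: "Z \<subseteq> W" and JJ: "JJ \<subseteq> E"
    and star: "\<And>v a. v \<in> W - Z \<Longrightarrow> a \<in> Z \<Longrightarrow> edge v a \<in> E - JJ"
    and inj: "\<And>v a v' a'. v \<in> W - Z \<Longrightarrow> a \<in> Z \<Longrightarrow> v' \<in> W - Z \<Longrightarrow> a' \<in> Z \<Longrightarrow> edge v a = edge v' a' \<Longrightarrow> v = v' \<and> a = a'"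
    and F: "\<And>J. J \<subseteq> JJ \<Longrightarrow> F J \<subseteq> {A. A \<subseteq> Z \<and> card A = m}"
    and b: "\<And>J. J \<subseteq> JJ \<Longrightarrow> real (card (F J)) \<le> b"
  shows "rprob E p (\<lambda>G. \<exists>J\<subseteq>JJ. J \<subseteq> G \<and> (\<exists>P\<subseteq>W - Z. card P = g \<and> (\<forall>v\<in>P. \<exists>A\<in>F J. \<forall>a\<in>A. edge v a \<in> G)))
     \<le> (1 + p) ^ card JJ * 2 ^ card W * (b * p ^ m) ^ g"
proof -
  define Ps where "Ps = {P. P \<subseteq> W - Z \<and> card P = g}"
  \<comment> \<open>A configuration fixes, besides \<open>J\<close> and \<open>P\<close>, one
    witness \<open>\<alpha> v\<close> for every \<open>v\<close> in \<open>P\<close>;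
    \<open>S\<close> collects the edges that it forces into \<open>G\<close>, namely
    \<open>J\<close> and the stars from each \<open>v\<close> to \<open>\<alpha> v\<close>.\<close>
  define I where "I = (SIGMA J:Pow JJ. SIGMA P:Ps. PiE P (\<lambda>_. F J))"
  define S where "S = (\<lambda>(J, P, \<alpha>). J \<union> (\<lambda>(v, a). edge v a) ` (SIGMA v:P. \<alpha> v))"
  have finZ: "finite Z" using Z W finite_subset by auto
  have finF: "finite (F J)" if "J \<subseteq> JJ" for J
    using F[OF that] finZ by (rule_tac finite_subset[of _ "Pow Z"]) auto
  have Psub: "Ps \<subseteq> Pow W" by (auto simp: Ps_def)
  have finPs: "finite Ps" using Psub W by (rule_tac finite_subset) auto
  have finP: "finite P" if "P \<in> Ps" for P using that W by (auto simp: Ps_def intro: finite_subset)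
  have finJJ: "finite JJ" using JJ fin finite_subset by auto
  have finI: "finite I" unfolding I_def using finJJ finPs finF finP by (intro finite_SigmaI finite_PiE) auto
  have "rprob E p (\<lambda>G. \<exists>J\<subseteq>JJ. J \<subseteq> G \<and> (\<exists>P\<subseteq>W - Z. card P = g \<and> (\<forall>v\<in>P. \<exists>A\<in>F J. \<forall>a\<in>A. edge v a \<in> G)))
    \<le> rprob E p (\<lambda>G. \<exists>i\<in>I. S i \<subseteq> G)"
  proof (rule rprob_mono)
    fix G assume "\<exists>J\<subseteq>JJ. J \<subseteq> G \<and> (\<exists>P\<subseteq>W - Z. card P = g \<and> (\<forall>v\<in>P. \<exists>A\<in>F J. \<forall>a\<in>A. edge v a \<in> G))"
    then obtain J P where JP: "J \<subseteq> JJ" "J \<subseteq> G" "P \<subseteq> W - Z" "card P = g"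
      "\<forall>v\<in>P. \<exists>A\<in>F J. \<forall>a\<in>A. edge v a \<in> G" by blast
    then have "\<forall>v\<in>P. \<exists>A. A \<in> F J \<and> (\<forall>a\<in>A. edge v a \<in> G)" by blast
    from bchoice[OF this] obtain \<alpha> where al: "\<forall>v\<in>P. \<alpha> v \<in> F J \<and> (\<forall>a\<in>\<alpha> v. edge v a \<in> G)" by auto
    have "(J, P, restrict \<alpha> P) \<in> I" using JP al by (auto simp: I_def Ps_def)
    moreover have "S (J, P, restrict \<alpha> P) \<subseteq> G" using JP al by (auto simp: S_def)
    ultimately show "\<exists>i\<in>I. S i \<subseteq> G" by blast
  qed
  also have "\<dots> \<le> (\<Sum>i\<in>I. rprob E p (\<lambda>G. S i \<subseteq> G))" by (rule rprob_UN[OF finI])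
  also have "\<dots> = (\<Sum>i\<in>I. p ^ card (fst i) * p ^ (g * m))"
  proof (rule sum.cong[OF refl])
    fix i assume iI: "i \<in> I"
    obtain J P \<alpha> where i0: "i = (J, P, \<alpha>)" by (cases i)
    have mem: "J \<in> Pow JJ" "P \<in> Ps" "\<alpha> \<in> PiE P (\<lambda>_. F J)" using iI unfolding i0 I_def by simp_all
    have i: "i = (J, P, \<alpha>)" "J \<subseteq> JJ" "P \<subseteq> W - Z" "card P = g" "finite P" "\<alpha> \<in> PiE P (\<lambda>_. F J)"
      using i0 mem finP[OF mem(2)] by (simp_all add: Ps_def)
    have al: "\<alpha> v \<subseteq> Z" "card (\<alpha> v) = m" if "v \<in> P" for v
      using F[OF i(2)] PiE_mem[OF i(6) that] by auto
    have fal: "finite (\<alpha> v)" if "v \<in> P" for v using al(1)[OF that] finZ by (rule finite_subset)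
    let ?T = "(\<lambda>(v, a). edge v a) ` (SIGMA v:P. \<alpha> v)"
    have "inj_on (\<lambda>(v, a). edge v a) (SIGMA v:P. \<alpha> v)"
    proof (rule inj_onI, clarify)
      fix v a v' a' assume h: "v \<in> P" "a \<in> \<alpha> v" "v' \<in> P" "a' \<in> \<alpha> v'" "edge v a = edge v' a'"
      show "v = v' \<and> a = a'" by (rule inj) (use h i(3) al(1) in blast)+
    qed
    then have cT: "card ?T = g * m"
      using fal al i(4,5) by (simp add: card_image)
    have Tsub: "?T \<subseteq> E - JJ"
    proof (rule image_subsetI, clarify)
      fix v a assume "v \<in> P" "a \<in> \<alpha> v"
      then show "edge v a \<in> E - JJ" using i(3) al(1) by (intro star) auto
    qed
    have "card (S i) = card J + card ?T"
    proof -
      have "finite J" using i(2) finJJ by (rule finite_subset)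
      moreover have "finite ?T" using Tsub fin by (rule finite_subset[OF _ finite_Diff])
      moreover have "J \<inter> ?T = {}" using Tsub i(2) by blast
      ultimately show ?thesis unfolding i(1) S_def by (simp add: card_Un_disjoint)
    qed
    moreover have "S i \<subseteq> E" using Tsub i(2) JJ unfolding i(1) S_def by blast
    ultimately show "rprob E p (\<lambda>G. S i \<subseteq> G) = p ^ card (fst i) * p ^ (g * m)"
      using cT i(1) by (simp add: rprob_superset power_add)
  qed
  also have "\<dots> = (\<Sum>J\<in>Pow JJ. \<Sum>P\<in>Ps. \<Sum>\<alpha>\<in>PiE P (\<lambda>_. F J). p ^ card J * p ^ (g * m))"
  proof -
    have "finite (SIGMA P:Ps. PiE P (\<lambda>_. F J))" if "J \<subseteq> JJ" for J
      using that finPs finF finP by (intro finite_SigmaI finite_PiE) auto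
    then have "(\<Sum>i\<in>I. p ^ card (fst i) * p ^ (g * m)) =
        (\<Sum>J\<in>Pow JJ. \<Sum>x\<in>(SIGMA P:Ps. PiE P (\<lambda>_. F J)). p ^ card J * p ^ (g * m))"
      unfolding I_def using finJJ by (subst sum.Sigma) (auto simp: case_prod_unfold)
    also have "\<dots> = (\<Sum>J\<in>Pow JJ. \<Sum>P\<in>Ps. \<Sum>\<alpha>\<in>PiE P (\<lambda>_. F J). p ^ card J * p ^ (g * m))"
    proof (rule sum.cong[OF refl])
      fix J assume "J \<in> Pow JJ"
      then have "finite (PiE P (\<lambda>_. F J))" if "P \<in> Ps" for P using that finF finP by (intro finite_PiE) auto
      then show "(\<Sum>x\<in>(SIGMA P:Ps. PiE P (\<lambda>_. F J)). p ^ card J * p ^ (g * m)) =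
          (\<Sum>P\<in>Ps. \<Sum>\<alpha>\<in>PiE P (\<lambda>_. F J). p ^ card J * p ^ (g * m))"
        using finPs by (subst sum.Sigma) (auto simp: case_prod_unfold)
    qed
    finally show ?thesis .
  qed
  also have "\<dots> = (\<Sum>J\<in>Pow JJ. \<Sum>P\<in>Ps. p ^ card J * (real (card (F J)) * p ^ m) ^ g)"
    using finP by (intro sum.cong refl)
      (auto simp: card_PiE Ps_def power_mult_distrib power_mult[symmetric] mult_ac)
  also have "\<dots> \<le> (\<Sum>J\<in>Pow JJ. \<Sum>P\<in>Ps. p ^ card J * (b * p ^ m) ^ g)"
    using p b by (intro sum_mono mult_left_mono power_mono mult_right_mono) auto
  also have "\<dots> = (\<Sum>J\<in>Pow JJ. p ^ card J) * real (card Ps) * (b * p ^ m) ^ g"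
    by (simp add: sum_distrib_left sum_distrib_right mult_ac)
  \<comment> \<open>Each \<open>J\<close> carries its own probability \<open>p ^ card J\<close>, so
    choosing it costs \<open>(1 + p) ^ card JJ\<close> and not \<open>2 ^ card JJ\<close>.\<close>
  also have "(\<Sum>J\<in>Pow JJ. p ^ card J) = (1 + p) ^ card JJ"
    using sum_Pow_prod[OF finJJ, of "\<lambda>_. p" "\<lambda>_. 1"] by (simp add: add.commute)
  also have "(1 + p) ^ card JJ * real (card Ps) * (b * p ^ m) ^ g \<le> (1 + p) ^ card JJ * 2 ^ card W * (b * p ^ m) ^ g"
  proof -
    have "card Ps \<le> 2 ^ card W" using card_mono[OF _ Psub] W by (simp add: card_Pow)
    then have "real (card Ps) \<le> 2 ^ card W" by (simp flip: of_nat_le_iff)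
    moreover have "0 \<le> b" using b[of "{}"] of_nat_0_le_iff[of "card (F {})"] by (meson empty_subsetI order_trans)
    ultimately show ?thesis using p by (intro mult_right_mono mult_left_mono) auto
  qed
  finally show ?thesis .
qed

end

text \<open>A pick is typical if it covers at least \<open>\<xi>\<close> of the uncovered part of \<open>Z\<close>. Few picks can be typical,
  and few elements are atypical; the weight \<open>(h / u) powr (card Z / \<xi>)\<close> makes the two cases
  contribute equally.\<close>

lemma card_lists_leaving_uncovered:
  fixes N :: "'a \<Rightarrow> 'b set"
  assumes X: "finite X" "real (card X) \<le> h" and Z: "finite Z" and u: "0 < u" "u \<le> h" and xi: "0 < \<xi>"
    and atyp: "\<And>Z'. Z' \<subseteq> Z \<Longrightarrow> z \<le> real (card Z') \<Longrightarrow> real (card {a \<in> X. real (card (N a \<inter> Z')) < \<xi>}) \<le> u"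
  shows "real (card {l. set l \<subseteq> X \<and> length l = m \<and> z \<le> real (card (Z - (\<Union>a\<in>set l. N a)))})
    \<le> (2 * u) ^ m * (h / u) powr (real (card Z) / \<xi>)"
  using Z atyp
proof (induction m arbitrary: Z)
  case 0
  have "real (card {l. set l \<subseteq> X \<and> length l = 0 \<and> z \<le> real (card (Z - (\<Union>a\<in>set l. N a)))}) \<le> real (card {[] :: 'a list})"
    unfolding of_nat_le_iff by (intro card_mono) auto
  also have "\<dots> \<le> (h / u) powr (real (card Z) / \<xi>)" using u xi by (simp add: ge_one_powr_ge_zero)
  finally show ?case by simp
next
  case (Suc m)
  let ?r = "h / u"
  define L where "L m Z = {l. set l \<subseteq> X \<and> length l = m \<and> z \<le> real (card (Z - (\<Union>a\<in>set l. N a)))}" for m and Z :: "'b set"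
  have finL: "finite (L m Z)" for m Z
    by (rule finite_subset[OF _ finite_lists_length_eq[OF X(1), of m]]) (auto simp: L_def)
  have "real (card (L (Suc m) Z)) \<le> (2 * u) ^ Suc m * ?r powr (real (card Z) / \<xi>)"
  proof (cases "z \<le> real (card Z)")
    case False
    have "L (Suc m) Z = {}"
    proof -
      have "card (Z - (\<Union>a\<in>set l. N a)) \<le> card Z" for l using Suc.prems(1) by (intro card_mono) auto
      then have "\<not> z \<le> real (card (Z - (\<Union>a\<in>set l. N a)))" for l
        using False by (metis of_nat_mono order_trans)
      then show ?thesis unfolding L_def by blast
    qed
    then show ?thesis using u by simp
  next
    case True
    define At where "At = {a \<in> X. real (card (N a \<inter> Z)) < \<xi>}"
    have cAt: "real (card At) \<le> u" unfolding At_def using True by (intro Suc.prems(2)) auto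
    have IH: "real (card (L m (Z - N a))) \<le> (2 * u) ^ m * ?r powr (real (card (Z - N a)) / \<xi>)" for a
      unfolding L_def
    proof (rule Suc.IH)
      show "real (card {a \<in> X. real (card (N a \<inter> Z')) < \<xi>}) \<le> u"
        if "Z' \<subseteq> Z - N a" "z \<le> real (card Z')" for Z'
        using that by (intro Suc.prems(2)) auto
    qed (use Suc.prems(1) in simp)
    have mono: "?r powr x \<le> ?r powr y" if "x \<le> y" for x y
      using that u by (intro powr_mono) auto
    \<comment> \<open>The first pick \<open>a\<close> leaves the same problem for
      \<open>Z - N a\<close>; the bound on atypical elements is assumed for all large subsets of
      \<open>Z\<close> in order to survive this.\<close>
    have sub: "L (Suc m) Z \<subseteq> (\<Union>a\<in>X. (#) a ` L m (Z - N a))"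
    proof
      fix l assume "l \<in> L (Suc m) Z"
      then obtain a l' where l: "l = a # l'" "set l' \<subseteq> X" "a \<in> X" "length l' = m"
        "z \<le> real (card (Z - (\<Union>a\<in>set l. N a)))" by (cases l) (auto simp: L_def)
      have "Z - (\<Union>a\<in>set l. N a) = Z - N a - (\<Union>a\<in>set l'. N a)" using l by auto
      then have "l' \<in> L m (Z - N a)" using l by (simp add: L_def)
      then show "l \<in> (\<Union>a\<in>X. (#) a ` L m (Z - N a))" using l by blast
    qed
    have "card (L (Suc m) Z) \<le> card (\<Union>a\<in>X. (#) a ` L m (Z - N a))"
      using X finL sub by (intro card_mono) auto
    also have "\<dots> \<le> (\<Sum>a\<in>X. card ((#) a ` L m (Z - N a)))" using X by (intro card_UN_le)
    also have "\<dots> = (\<Sum>a\<in>X. card (L m (Z - N a)))" by (intro sum.cong refl card_image) auto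
    finally have "real (card (L (Suc m) Z)) \<le> (\<Sum>a\<in>X. real (card (L m (Z - N a))))"
      by (simp flip: of_nat_sum)
    also have "\<dots> = (\<Sum>a\<in>At. real (card (L m (Z - N a)))) + (\<Sum>a\<in>X - At. real (card (L m (Z - N a))))"
      using sum.subset_diff[of At X "\<lambda>a. real (card (L m (Z - N a)))"] X(1) by (simp add: At_def)
    also have "(\<Sum>a\<in>At. real (card (L m (Z - N a)))) \<le> (\<Sum>a\<in>At. (2 * u) ^ m * ?r powr (real (card Z) / \<xi>))"
    proof (rule sum_mono)
      fix a
      have "card (Z - N a) \<le> card Z" using Suc.prems(1) by (intro card_mono) auto
      then have "?r powr (real (card (Z - N a)) / \<xi>) \<le> ?r powr (real (card Z) / \<xi>)"
        using xi by (intro mono divide_right_mono) auto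
      then show "real (card (L m (Z - N a))) \<le> (2 * u) ^ m * ?r powr (real (card Z) / \<xi>)"
        using u by (intro order_trans[OF IH] mult_left_mono) auto
    qed
    also have "\<dots> \<le> u * ((2 * u) ^ m * ?r powr (real (card Z) / \<xi>))"
      using cAt u by (simp add: mult_right_mono)
    also have "(\<Sum>a\<in>X - At. real (card (L m (Z - N a)))) \<le> (\<Sum>a\<in>X - At. (2 * u) ^ m * (?r powr (real (card Z) / \<xi>) / ?r))"
    proof (rule sum_mono)
      fix a assume a: "a \<in> X - At"
      then have "\<xi> \<le> real (card (N a \<inter> Z))" by (auto simp: At_def)
      moreover have "card Z = card (Z - N a) + card (N a \<inter> Z)"
        using Suc.prems(1) by (subst card_Un_disjoint[symmetric]) (auto intro: arg_cong[of _ _ card])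
      ultimately have "real (card (Z - N a)) \<le> real (card Z) - \<xi>" by simp
      then have "real (card (Z - N a)) / \<xi> \<le> (real (card Z) - \<xi>) / \<xi>" using xi by (intro divide_right_mono) auto
      also have "\<dots> = real (card Z) / \<xi> - 1" using xi by (simp add: diff_divide_distrib)
      finally have "?r powr (real (card (Z - N a)) / \<xi>) \<le> ?r powr (real (card Z) / \<xi> - 1)" by (rule mono)
      also have "\<dots> = ?r powr (real (card Z) / \<xi>) / ?r" using u by (simp add: powr_diff)
      finally show "real (card (L m (Z - N a))) \<le> (2 * u) ^ m * (?r powr (real (card Z) / \<xi>) / ?r)"
        using u by (intro order_trans[OF IH] mult_left_mono) auto
    qed
    also have "\<dots> = real (card (X - At)) * ((2 * u) ^ m * (?r powr (real (card Z) / \<xi>) / ?r))" by simp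
    also have "\<dots> \<le> h * ((2 * u) ^ m * (?r powr (real (card Z) / \<xi>) / ?r))"
    proof (rule mult_right_mono)
      have "card (X - At) \<le> card X" using X by (intro card_mono) auto
      then show "real (card (X - At)) \<le> h" using X(2) by linarith
    qed (use u in auto)
    also have "\<dots> = u * ((2 * u) ^ m * ?r powr (real (card Z) / \<xi>))" using u by (simp add: field_simps)
    finally show ?thesis by (simp add: algebra_simps)
  qed
  then show ?case by (simp only: L_def)
qed

text \<open>A set of size \<open>m\<close> is the range of \<open>fact m\<close> repetition-free
  lists, and different sets have different lists. The pick-by-pick argument counts lists; dividing
  by \<open>fact m\<close> brings it back to sets.\<close>

lemma card_subsets_le_lists:
  assumes X: "finite X" and P: "\<And>A. A \<subseteq> X \<Longrightarrow> card A = m \<Longrightarrow> P A \<Longrightarrow> Q A"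
  shows "card {A. A \<subseteq> X \<and> card A = m \<and> P A} * fact m \<le> card {l. set l \<subseteq> X \<and> length l = m \<and> Q (set l)}"
proof -
  let ?S = "{A. A \<subseteq> X \<and> card A = m \<and> P A}"
  define D where "D A = {l. length l = m \<and> distinct l \<and> set l \<subseteq> A}" for A :: "'a set"
  have finS: "finite ?S" using X by auto
  have setl: "set l = A" if "l \<in> D A" "A \<in> ?S" for l A
    using that X finite_subset[of A X] by (intro card_subset_eq) (auto simp: D_def distinct_card)
  have "card ?S * fact m = (\<Sum>A\<in>?S. card (D A))"
  proof -
    have "card (D A) = fact m" if "A \<in> ?S" for A
      using that X finite_subset[of A X] card_lists_distinct_length_eq[of A m]
      by (auto simp: D_def fact_prod)
    then show ?thesis by simp
  qed
  also have "\<dots> = card (\<Union>A\<in>?S. D A)"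
  proof (rule card_UN_disjoint[symmetric])
    show "\<forall>A\<in>?S. finite (D A)"
    proof
      fix A assume "A \<in> ?S"
      then have "finite A" using X finite_subset by auto
      then show "finite (D A)"
        by (rule_tac finite_subset[OF _ finite_lists_length_eq[of A m]]) (auto simp: D_def)
    qed
    show "\<forall>A\<in>?S. \<forall>B\<in>?S. A \<noteq> B \<longrightarrow> D A \<inter> D B = {}" using setl by blast
  qed (rule finS)
  also have "\<dots> \<le> card {l. set l \<subseteq> X \<and> length l = m \<and> Q (set l)}"
  proof (rule card_mono)
    show "finite {l. set l \<subseteq> X \<and> length l = m \<and> Q (set l)}"
      by (rule finite_subset[OF _ finite_lists_length_eq[OF X, of m]]) auto
    show "(\<Union>A\<in>?S. D A) \<subseteq> {l. set l \<subseteq> X \<and> length l = m \<and> Q (set l)}"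
    proof
      fix l assume "l \<in> (\<Union>A\<in>?S. D A)"
      then obtain A where A: "A \<in> ?S" "l \<in> D A" by blast
      then have "set l = A" using setl by blast
      then show "l \<in> {l. set l \<subseteq> X \<and> length l = m \<and> Q (set l)}" using A P by (auto simp: D_def)
    qed
  qed
  finally show ?thesis .
qed

text \<open>A weak Stirling bound: one term of the exponential series is at most its sum.\<close>

lemma power_self_le_exp_fact: "real m ^ m \<le> exp (real m) * fact m"
proof -
  have "(\<Sum>n\<in>{m}. real m ^ n / fact n) \<le> (\<Sum>n. real m ^ n / fact n)"
    using summable_exp[of "real m"] by (intro sum_le_suminf) (auto simp: field_simps)
  also have "\<dots> = exp (real m)" by (simp add: exp_def field_simps)
  finally show ?thesis by (simp add: field_simps)
qed

lemma le_power_div_fact: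
  assumes "x * fact m \<le> y ^ m" "0 < m" "0 \<le> y"
  shows "x \<le> (exp 1 * y / real m) ^ m"
proof -
  have "x * real m ^ m \<le> (exp 1 * y) ^ m"
  proof (cases "0 \<le> x")
    case True
    then have "x * real m ^ m \<le> x * (exp (real m) * fact m)"
      by (intro mult_left_mono power_self_le_exp_fact)
    also have "\<dots> \<le> exp (real m) * y ^ m" using assms(1) by (simp add: mult_ac)
    also have "\<dots> = (exp 1 * y) ^ m" by (simp add: power_mult_distrib exp_of_nat_mult[symmetric])
    finally show ?thesis .
  next
    case False
    then have "x * real m ^ m \<le> 0" by (simp add: mult_nonpos_nonneg)
    then show ?thesis using assms(3) by (smt (verit) exp_gt_zero mult_nonneg_nonneg zero_le_power)
  qed
  then show ?thesis using assms(2) by (simp add: power_divide field_simps)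
qed

text \<open>At most half of the \<open>m\<close> picks can be typical, so the list bound
  \<open>(2 * u) ^ m * (h / u) powr (m / 2)\<close> is the power of a geometric mean,
  \<open>(2 * sqrt (u * h)) ^ m\<close>. Compared with the trivial order \<open>h ^ m\<close> this
  saves \<open>sqrt (u / h)\<close> per pick, as much as wished once atypical elements are a small
  enough fraction.\<close>

lemma card_subsets_leaving_uncovered:
  fixes N :: "'a \<Rightarrow> 'b set"
  assumes X: "finite X" "real (card X) \<le> h" and Z: "finite Z" and u: "0 < u" "u \<le> h" and xi: "0 < \<xi>"
    and atyp: "\<And>Z'. Z' \<subseteq> Z \<Longrightarrow> z \<le> real (card Z') \<Longrightarrow> real (card {a \<in> X. real (card (N a \<inter> Z')) < \<xi>}) \<le> u"
    and m: "0 < m" "real (card Z) / \<xi> \<le> real m / 2"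
  shows "real (card {A. A \<subseteq> X \<and> card A = m \<and> z \<le> real (card (Z - (\<Union>a\<in>A. N a)))})
    \<le> (exp 1 * (2 * sqrt (u * h)) / real m) ^ m"
proof -
  have "real (card {A. A \<subseteq> X \<and> card A = m \<and> z \<le> real (card (Z - (\<Union>a\<in>A. N a)))}) * fact m
     \<le> real (card {l. set l \<subseteq> X \<and> length l = m \<and> z \<le> real (card (Z - (\<Union>a\<in>set l. N a)))})"
    using card_subsets_le_lists[OF X(1), of m "\<lambda>A. z \<le> real (card (Z - (\<Union>a\<in>A. N a)))" "\<lambda>A. z \<le> real (card (Z - (\<Union>a\<in>A. N a)))"]
    by (metis (no_types, lifting) of_nat_fact of_nat_le_iff of_nat_mult)
  also have "\<dots> \<le> (2 * u) ^ m * (h / u) powr (real (card Z) / \<xi>)"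
    by (rule card_lists_leaving_uncovered) (use assms in auto)
  also have "\<dots> \<le> (2 * u) ^ m * (h / u) powr (real m / 2)"
    using u m(2) by (intro mult_left_mono powr_mono) auto
  also have "(h / u) powr (real m / 2) = sqrt (h / u) ^ m"
    using u by (simp add: powr_half_sqrt[symmetric] powr_powr powr_realpow[symmetric])
  also have "(2 * u) ^ m * sqrt (h / u) ^ m = (2 * sqrt (u * h)) ^ m"
  proof -
    have "u * sqrt (h / u) = sqrt (u * h)"
      using u by (simp add: real_sqrt_divide real_sqrt_mult field_simps)
    then have "2 * u * sqrt (h / u) = 2 * sqrt (u * h)" by simp
    then show ?thesis by (metis power_mult_distrib)
  qed
  finally show ?thesis using m(1) u by (intro le_power_div_fact) auto
qed

subsection \<open>Properties of random graphs inherited by dense subgraphs\<close>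

definition pairs :: "'a set \<Rightarrow> 'a set set" where
  "pairs W = {{a, b} | a b. a \<in> W \<and> b \<in> W \<and> a \<noteq> b}"

definition cross :: "'a set \<Rightarrow> 'a set \<Rightarrow> 'a set set" where
  "cross A B = {{a, b} | a b. a \<in> A \<and> b \<in> B}"

definition nbrs :: "'a set set \<Rightarrow> 'a \<Rightarrow> 'a set \<Rightarrow> 'a set" where
  "nbrs J v B = {b \<in> B. {v, b} \<in> J}"

definition edge_count :: "'a set set \<Rightarrow> 'a set \<Rightarrow> 'a set \<Rightarrow> nat" where
  "edge_count J A B = card {(a, b). a \<in> A \<and> b \<in> B \<and> {a, b} \<in> J}"

text \<open>Half of the usual regularity notion: only a lower bound on densities is asked for. It
  passes to subsets of \<open>X\<close> and \<open>Y\<close>, where the same threshold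
  \<open>u\<close> is merely a larger proportion.\<close>

definition dense_pair :: "'a set set \<Rightarrow> real \<Rightarrow> real \<Rightarrow> 'a set \<Rightarrow> 'a set \<Rightarrow> bool" where
  "dense_pair J u c X Y \<longleftrightarrow> (\<forall>A\<subseteq>X. \<forall>B\<subseteq>Y. u \<le> real (card A) \<longrightarrow> u \<le> real (card B) \<longrightarrow>
     c * real (card A) * real (card B) \<le> real (edge_count J A B))"

lemma dense_pairD:
  assumes "dense_pair J u c X Y" "A \<subseteq> X" "B \<subseteq> Y" "u \<le> real (card A)" "u \<le> real (card B)"
  shows "c * real (card A) * real (card B) \<le> real (edge_count J A B)"
  using assms unfolding dense_pair_def by simp

lemma nbrs_subset: "nbrs J v B \<subseteq> B"
  by (auto simp: nbrs_def)

lemma finite_nbrs: "finite B \<Longrightarrow> finite (nbrs J v B)"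
  by (rule finite_subset[OF nbrs_subset])

lemma edge_count_sum_right:
  assumes "finite A" "finite B"
  shows "edge_count J A B = (\<Sum>b\<in>B. card {a \<in> A. {a, b} \<in> J})"
proof -
  have "{(a, b). a \<in> A \<and> b \<in> B \<and> {a, b} \<in> J} = (\<lambda>(b, a). (a, b)) ` (SIGMA b:B. {a \<in> A. {a, b} \<in> J})"
    by auto
  moreover have "inj_on (\<lambda>(b, a). (a, b)) (SIGMA b:B. {a \<in> A. {a, b} \<in> J})" by (auto intro: inj_onI)
  ultimately show ?thesis using assms by (simp add: edge_count_def card_image)
qed

lemma edge_count_sum_left:
  assumes "finite A" "finite B"
  shows "edge_count J A B = (\<Sum>a\<in>A. card (nbrs J a B))"
proof -
  have "{(a, b). a \<in> A \<and> b \<in> B \<and> {a, b} \<in> J} = (SIGMA a:A. nbrs J a B)"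
    by (auto simp: nbrs_def)
  then show ?thesis using assms by (simp add: edge_count_def finite_nbrs)
qed

lemma inj_on_doubleton:
  assumes "A \<inter> B = {}"
  shows "inj_on (\<lambda>(a, b). {a, b}) (A \<times> B)"
  using assms by (auto simp: inj_on_def doubleton_eq_iff)

lemma edge_count_disjoint:
  assumes "A \<inter> B = {}"
  shows "edge_count J A B = card (J \<inter> cross A B)"
proof -
  have "J \<inter> cross A B = (\<lambda>(a, b). {a, b}) ` {(a, b). a \<in> A \<and> b \<in> B \<and> {a, b} \<in> J}"
    by (auto simp: cross_def)
  moreover have "inj_on (\<lambda>(a, b). {a, b}) {(a, b). a \<in> A \<and> b \<in> B \<and> {a, b} \<in> J}"
    by (rule inj_on_subset[OF inj_on_doubleton[OF assms]]) auto
  ultimately show ?thesis by (simp add: edge_count_def card_image)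
qed

lemma card_cross:
  assumes "A \<inter> B = {}" "finite A" "finite B"
  shows "card (cross A B) = card A * card B"
proof -
  have "cross A B = (\<lambda>(a, b). {a, b}) ` (A \<times> B)" by (auto simp: cross_def)
  then show ?thesis using inj_on_doubleton[OF assms(1)] by (simp add: card_image card_cartesian_product)
qed

lemma cross_subset_pairs: "A \<subseteq> W \<Longrightarrow> B \<subseteq> W \<Longrightarrow> A \<inter> B = {} \<Longrightarrow> cross A B \<subseteq> pairs W"
  by (fastforce simp: cross_def pairs_def)

lemma pairs_mono: "Z \<subseteq> W \<Longrightarrow> pairs Z \<subseteq> pairs W"
  by (fastforce simp: pairs_def)

lemma finite_pairs: "finite W \<Longrightarrow> finite (pairs W)"
  by (rule finite_subset[of _ "Pow W"]) (auto simp: pairs_def)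

lemma card_pairs_le: "finite W \<Longrightarrow> card (pairs W) \<le> card W * card W"
proof -
  assume W: "finite W"
  have "pairs W \<subseteq> (\<lambda>(a, b). {a, b}) ` (W \<times> W)" by (auto simp: pairs_def)
  then have "card (pairs W) \<le> card (W \<times> W)"
    using W by (meson card_image_le card_mono finite_SigmaI finite_imageI le_trans)
  then show ?thesis by (simp add: card_cartesian_product)
qed

text \<open>Otherwise the atypical vertices and \<open>Z\<close> would form a pair of large sets of
  density below \<open>c\<close>.\<close>

lemma few_atypical:
  assumes J: "dense_pair J u c X Y" and fin: "finite X" "finite Y" and c: "0 < c" and u: "0 < u" "u \<le> z"
    and Z: "Z \<subseteq> X" "z \<le> real (card Z)"
  shows "real (card {b \<in> Y. real (card ({x \<in> X. {x, b} \<in> J} \<inter> Z)) < c * z}) \<le> u"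
proof (rule ccontr)
  let ?B = "{b \<in> Y. real (card ({x \<in> X. {x, b} \<in> J} \<inter> Z)) < c * z}"
  assume "\<not> ?thesis"
  then have big: "u \<le> real (card ?B)" by simp
  then have ne: "?B \<noteq> {}" using u by (metis card.empty of_nat_0 not_less)
  have "c * real (card Z) * real (card ?B) \<le> real (edge_count J Z ?B)"
    using J Z u big unfolding dense_pair_def by auto
  also have "\<dots> = (\<Sum>b\<in>?B. real (card {a \<in> Z. {a, b} \<in> J}))"
    using fin Z finite_subset[OF Z(1)] by (subst edge_count_sum_right) auto
  also have "\<dots> = (\<Sum>b\<in>?B. real (card ({x \<in> X. {x, b} \<in> J} \<inter> Z)))"
    using Z by (intro sum.cong refl arg_cong[of _ _ "\<lambda>S. real (card S)"]) auto
  also have "\<dots> < (\<Sum>b\<in>?B. c * z)"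
    using fin ne by (intro sum_strict_mono) auto
  also have "\<dots> = real (card ?B) * (c * z)" by simp
  also have "\<dots> \<le> real (card ?B) * (c * real (card Z))"
    using c Z by (intro mult_left_mono) auto
  finally show False by (simp add: mult_ac)
qed

text \<open>Three ways in which neighbourhoods, used as candidate lists, can fail: many vertices may send \<open>m\<close>
  edges into a small used set, an \<open>m\<close>-subset of a list may leave a positive proportion of the next
  class without neighbours, and two lists may contain a hole of \<open>J\<close>. Here \<open>J\<close> is the (unknown)
  subgraph of one colour.\<close>

definition few_flooded :: "'a set set \<Rightarrow> 'a set \<Rightarrow> nat \<Rightarrow> nat \<Rightarrow> nat \<Rightarrow> bool" where
  "few_flooded G W k m g \<longleftrightarrow> (\<forall>U\<subseteq>W. \<forall>P\<subseteq>W - U. card U \<le> k \<longrightarrow> card P = g \<longrightarrow>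
     (\<exists>v\<in>P. card (nbrs G v U) < m))"

definition host_dense :: "'a set set \<Rightarrow> 'a set \<Rightarrow> real \<Rightarrow> real \<Rightarrow> bool" where
  "host_dense G W z p \<longleftrightarrow> (\<forall>A\<subseteq>W. \<forall>B\<subseteq>W. A \<inter> B = {} \<longrightarrow> z \<le> real (card A) \<longrightarrow> z \<le> real (card B) \<longrightarrow>
     p * real (card A) * real (card B) / 2 \<le> real (edge_count G A B))"

definition lists_cover :: "'a set set \<Rightarrow> 'a set \<Rightarrow> nat \<Rightarrow> real \<Rightarrow> real \<Rightarrow> real \<Rightarrow> nat \<Rightarrow> nat \<Rightarrow> bool" where
  "lists_cover G W h c u z m g \<longleftrightarrow> (\<forall>X\<subseteq>W. \<forall>Y\<subseteq>W. \<forall>J\<subseteq>G \<inter> cross X Y. \<forall>P\<subseteq>W - (X \<union> Y).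
     X \<inter> Y = {} \<longrightarrow> card X = h \<longrightarrow> card Y = h \<longrightarrow> dense_pair J u c X Y \<longrightarrow> card P = g \<longrightarrow>
     (\<exists>v\<in>P. \<forall>B\<subseteq>nbrs G v Y. card B = m \<longrightarrow> real (card {x \<in> X. nbrs J x B = {}}) < z))"

text \<open>This makes atypical picks rare when the list \<open>L\<close> is the set to be covered:
  a vertex of \<open>X\<close> is typical for a part of \<open>L\<close> with at least
  \<open>m\<close> elements if it has \<open>T\<close> neighbours there.\<close>

definition covering_list :: "'a set set \<Rightarrow> 'a set \<Rightarrow> 'a set \<Rightarrow> nat \<Rightarrow> nat \<Rightarrow> nat \<Rightarrow> real \<Rightarrow> bool" where
  "covering_list J X L D m T u \<longleftrightarrow> card L = D \<and>
     (\<forall>B\<subseteq>L. card B = m \<longrightarrow> real (card {x \<in> X. card (nbrs J x B) < T}) \<le> u)"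

text \<open>The lists of the vertices of \<open>Q\<close> are encoded as neighbourhoods in
  \<open>J\<close>, so that one choice of \<open>J\<close> fixes them all and they need no separate
  count. \<open>P\<close> is disjoint from the three other sets, which makes the edges at
  \<open>P\<close> independent of \<open>J\<close>.\<close>

definition lists_linked :: "'a set set \<Rightarrow> 'a set \<Rightarrow> nat \<Rightarrow> nat \<Rightarrow> nat \<Rightarrow> nat \<Rightarrow> real \<Rightarrow> nat \<Rightarrow> bool" where
  "lists_linked G W h D m T u g \<longleftrightarrow> (\<forall>X\<subseteq>W. \<forall>Y\<subseteq>W. \<forall>Q\<subseteq>W. \<forall>J\<subseteq>G \<inter> (cross X Y \<union> cross Q Y). \<forall>P\<subseteq>W - (X \<union> Y \<union> Q).
     X \<inter> Y = {} \<longrightarrow> X \<inter> Q = {} \<longrightarrow> Y \<inter> Q = {} \<longrightarrow> card X = h \<longrightarrow> card Y = h \<longrightarrow> card Q = h \<longrightarrow> card P = g \<longrightarrow>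
     (\<exists>v\<in>P. \<forall>A\<subseteq>nbrs G v X. card A = m \<longrightarrow>
        (\<forall>q\<in>Q. covering_list J X (nbrs J q Y) D m T u \<longrightarrow>
           (\<forall>B\<subseteq>nbrs J q Y. card B = m \<longrightarrow> (\<exists>a\<in>A. nbrs J a B \<noteq> {})))))"

section \<open>Union bounds for the failure of the host properties\<close>

context
  fixes W :: "'a set" and p :: real
  assumes W: "finite W" and p: "0 \<le> p" "p \<le> 1"
begin

text \<open>A pair with one end outside \<open>Z\<close> is not a pair of \<open>Z\<close>, so the
  stars at \<open>P\<close> avoid all edges available to \<open>J\<close>.\<close>

lemma rprob_first_moment_pairs:
  fixes F :: "'a set set \<Rightarrow> 'a set set"
  assumes Z: "Z \<subseteq> W" and JJ: "JJ \<subseteq> pairs Z"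
    and F: "\<And>J. J \<subseteq> JJ \<Longrightarrow> F J \<subseteq> {A. A \<subseteq> Z \<and> card A = m}"
    and b: "\<And>J. J \<subseteq> JJ \<Longrightarrow> real (card (F J)) \<le> b"
  shows "rprob (pairs W) p (\<lambda>G. \<exists>J\<subseteq>JJ. J \<subseteq> G \<and> (\<exists>P\<subseteq>W - Z. card P = g \<and> (\<forall>v\<in>P. \<exists>A\<in>F J. \<forall>a\<in>A. {v, a} \<in> G)))
     \<le> (1 + p) ^ card JJ * 2 ^ card W * (b * p ^ m) ^ g"
proof (rule rprob_first_moment[OF finite_pairs[OF W] p W Z _ _ _ F b])
  show "JJ \<subseteq> pairs W" using JJ pairs_mono[OF Z] by blast
  show "{v, a} \<in> pairs W - JJ" if "v \<in> W - Z" "a \<in> Z" for v a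
  proof -
    have "{v, a} \<notin> pairs Z" using that by (auto simp: pairs_def doubleton_eq_iff)
    moreover have "{v, a} \<in> pairs W" using that Z by (auto simp: pairs_def)
    ultimately show ?thesis using JJ by auto
  qed
  show "v = v' \<and> a = a'" if "v \<in> W - Z" "a \<in> Z" "v' \<in> W - Z" "a' \<in> Z" "{v, a} = {v', a'}" for v a v' a'
    using that by (auto simp: doubleton_eq_iff)
qed

text \<open>No subgraph enters here: \<open>JJ\<close> is empty, and the bad sets for a fixed
  \<open>U\<close> are all its \<open>m\<close>-subsets, at most \<open>(exp 1 * k / m) ^ m\<close>
  many. The two factors \<open>2 ^ card W\<close> pay for \<open>U\<close> and for
  \<open>P\<close>.\<close>

lemma rprob_not_few_flooded:
  assumes m: "0 < m"
  shows "rprob (pairs W) p (\<lambda>G. \<not> few_flooded G W k m g)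
    \<le> 2 ^ card W * (2 ^ card W * ((exp 1 * real k / real m) ^ m * p ^ m) ^ g)"
proof -
  define U where "U = {U. U \<subseteq> W \<and> card U \<le> k}"
  have Us: "U \<subseteq> Pow W" by (auto simp: U_def)
  then have finU: "finite U" using W by (auto intro: finite_subset)
  have "card U \<le> 2 ^ card W" using card_mono[OF _ Us] W by (simp add: card_Pow)
  then have "real (card U) \<le> real (2 ^ card W)" by (rule of_nat_mono)
  then have cU: "real (card U) \<le> 2 ^ card W" by simp
  let ?F = "\<lambda>U (J :: 'a set set). {A. A \<subseteq> U \<and> card A = m}"
  have "rprob (pairs W) p (\<lambda>G. \<not> few_flooded G W k m g) \<le> rprob (pairs W) p (\<lambda>G. \<exists>U\<in>U.
      \<exists>J\<subseteq>{}. J \<subseteq> G \<and> (\<exists>P\<subseteq>W - U. card P = g \<and> (\<forall>v\<in>P. \<exists>A\<in>?F U J. \<forall>a\<in>A. {v, a} \<in> G)))"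
  proof (rule rprob_mono[OF finite_pairs[OF W] p])
    fix G assume "\<not> few_flooded G W k m g"
    then obtain V P where UP: "V \<subseteq> W" "P \<subseteq> W - V" "card V \<le> k" "card P = g" "\<forall>v\<in>P. \<not> card (nbrs G v V) < m"
      unfolding few_flooded_def by blast
    have "\<exists>A\<in>?F V {}. \<forall>a\<in>A. {v, a} \<in> G" if "v \<in> P" for v
    proof -
      have "m \<le> card (nbrs G v V)" using UP(5) that by (auto simp: not_less)
      then obtain A where "A \<subseteq> nbrs G v V" "card A = m" by (rule obtain_subset_with_card_n)
      then show ?thesis by (auto simp: nbrs_def)
    qed
    then have "\<exists>J\<subseteq>{}. J \<subseteq> G \<and> (\<exists>P\<subseteq>W - V. card P = g \<and> (\<forall>v\<in>P. \<exists>A\<in>?F V J. \<forall>a\<in>A. {v, a} \<in> G))"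
      using UP(2,4) by (intro exI[of _ "{}"] conjI exI[of _ P]) simp_all
    moreover have "V \<in> U" using UP(1,3) by (simp add: U_def)
    ultimately show "\<exists>U\<in>U. \<exists>J\<subseteq>{}. J \<subseteq> G \<and> (\<exists>P\<subseteq>W - U. card P = g \<and> (\<forall>v\<in>P. \<exists>A\<in>?F U J. \<forall>a\<in>A. {v, a} \<in> G))"
      by (rule rev_bexI[rotated])
  qed
  also have "\<dots> \<le> (\<Sum>U\<in>U. rprob (pairs W) p (\<lambda>G. \<exists>J\<subseteq>{}. J \<subseteq> G \<and>
      (\<exists>P\<subseteq>W - U. card P = g \<and> (\<forall>v\<in>P. \<exists>A\<in>?F U J. \<forall>a\<in>A. {v, a} \<in> G))))"
    by (rule rprob_UN[OF finite_pairs[OF W] p finU])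
  also have "\<dots> \<le> (\<Sum>U\<in>U. 2 ^ card W * ((exp 1 * real k / real m) ^ m * p ^ m) ^ g)"
  proof (rule sum_mono)
    fix V assume V: "V \<in> U"
    then have Vk: "V \<subseteq> W" "card V \<le> k" by (auto simp: U_def)
    have fV: "finite V" using Vk W finite_subset by auto
    have "real (card {A. A \<subseteq> V \<and> card A = m}) * fact m \<le> real k ^ m"
    proof -
      have "(card V choose m) * fact m \<le> k ^ m"
        using binomial_fact_pow[of "card V" m] power_mono[OF Vk(2), of m] by simp
      then have "real ((card V choose m) * fact m) \<le> real (k ^ m)" by (rule of_nat_mono)
      then show ?thesis by (simp add: n_subsets[OF fV])
    qed
    then have b: "real (card {A. A \<subseteq> V \<and> card A = m}) \<le> (exp 1 * real k / real m) ^ m"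
      using m by (intro le_power_div_fact) auto
    show "rprob (pairs W) p (\<lambda>G. \<exists>J\<subseteq>{}. J \<subseteq> G \<and>
      (\<exists>P\<subseteq>W - V. card P = g \<and> (\<forall>v\<in>P. \<exists>A\<in>?F V J. \<forall>a\<in>A. {v, a} \<in> G)))
      \<le> 2 ^ card W * ((exp 1 * real k / real m) ^ m * p ^ m) ^ g"
      using rprob_first_moment_pairs[OF Vk(1), of "{}" "?F V" m "(exp 1 * real k / real m) ^ m" g] b by simp
  qed
  also have "\<dots> = real (card U) * (2 ^ card W * ((exp 1 * real k / real m) ^ m * p ^ m) ^ g)" by simp
  also have "\<dots> \<le> 2 ^ card W * (2 ^ card W * ((exp 1 * real k / real m) ^ m * p ^ m) ^ g)"
    using cU p by (intro mult_right_mono) auto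
  finally show ?thesis .
qed

lemma rprob_not_host_dense:
  assumes z: "0 \<le> z"
  shows "rprob (pairs W) p (\<lambda>G. \<not> host_dense G W z p) \<le> 4 ^ card W * exp (- (p * z ^ 2 / 8))"
proof -
  define R where "R = {(A, B). A \<subseteq> W \<and> B \<subseteq> W \<and> A \<inter> B = {} \<and> z \<le> real (card A) \<and> z \<le> real (card B)}"
  have Rs: "R \<subseteq> Pow W \<times> Pow W" by (auto simp: R_def)
  then have finR: "finite R" using W by (rule_tac finite_subset) auto
  have "card R \<le> card (Pow W \<times> Pow W)" using Rs W by (intro card_mono) auto
  also have "\<dots> = 4 ^ card W" using W by (simp add: card_cartesian_product card_Pow power_mult_distrib[symmetric])
  finally have "real (card R) \<le> real (4 ^ card W)" by (rule of_nat_mono)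
  then have cR: "real (card R) \<le> 4 ^ card W" by simp
  let ?Q = "\<lambda>(A, B) G. real (card (G \<inter> cross A B)) < p * real (card (cross A B)) / 2"
  have "rprob (pairs W) p (\<lambda>G. \<not> host_dense G W z p) \<le> rprob (pairs W) p (\<lambda>G. \<exists>i\<in>R. ?Q i G)"
  proof (rule rprob_mono[OF finite_pairs[OF W] p])
    fix G assume "\<not> host_dense G W z p"
    then obtain A B where AB: "A \<subseteq> W" "B \<subseteq> W" "A \<inter> B = {}" "z \<le> real (card A)" "z \<le> real (card B)"
      "\<not> p * real (card A) * real (card B) / 2 \<le> real (edge_count G A B)"
      unfolding host_dense_def by blast
    have "finite A" "finite B" using AB(1,2) W by (auto intro: finite_subset)
    then have "?Q (A, B) G" using AB by (simp add: edge_count_disjoint card_cross mult.assoc)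
    then show "\<exists>i\<in>R. ?Q i G" using AB by (intro bexI[of _ "(A, B)"]) (auto simp: R_def)
  qed
  also have "\<dots> \<le> (\<Sum>i\<in>R. rprob (pairs W) p (?Q i))"
    by (rule rprob_UN[OF finite_pairs[OF W] p finR, of ?Q])
  also have "\<dots> \<le> (\<Sum>i\<in>R. exp (- (p * z ^ 2 / 8)))"
  proof (rule sum_mono)
    fix i assume "i \<in> R"
    then obtain A B where i: "i = (A, B)" and AB: "A \<subseteq> W" "B \<subseteq> W" "A \<inter> B = {}" "z \<le> real (card A)" "z \<le> real (card B)"
      by (auto simp: R_def)
    have fAB: "finite A" "finite B" using AB(1,2) W by (auto intro: finite_subset)
    have "rprob (pairs W) p (?Q i) \<le> exp (- (p * real (card (cross A B)) / 8))"
      unfolding i prod.case using cross_subset_pairs[OF AB(1-3)]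
      by (intro rprob_lower_tail[OF finite_pairs[OF W] p])
    also have "\<dots> \<le> exp (- (p * z ^ 2 / 8))"
    proof -
      have "z ^ 2 \<le> real (card A) * real (card B)" using z AB(4,5) by (simp add: power2_eq_square mult_mono)
      then have "p * z ^ 2 \<le> p * real (card (cross A B))"
        using p fAB AB(3) by (intro mult_left_mono) (auto simp: card_cross)
      then show ?thesis by simp
    qed
    finally show "rprob (pairs W) p (?Q i) \<le> exp (- (p * z ^ 2 / 8))" .
  qed
  also have "\<dots> = real (card R) * exp (- (p * z ^ 2 / 8))" by simp
  also have "\<dots> \<le> 4 ^ card W * exp (- (p * z ^ 2 / 8))" using cR by (intro mult_right_mono) auto
  finally show ?thesis .
qed

text \<open>The picks are the elements of an \<open>m\<close>-subset \<open>B\<close> of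
  \<open>Y\<close>, whose \<open>J\<close>-neighbourhoods should cover \<open>X\<close>. As long as
  \<open>z\<close> vertices are uncovered, density makes all but \<open>u\<close> elements of
  \<open>Y\<close> typical with \<open>\<xi> = c * z\<close>, and by \<open>mc\<close> at most
  \<open>m / 2\<close> typical picks fit into \<open>X\<close>; so few sets \<open>B\<close> leave
  that much uncovered.\<close>

lemma rprob_not_lists_cover:
  assumes m: "0 < m" and c: "0 < c" and u: "0 < u" "u \<le> z" "z \<le> real h" and mc: "real h / (c * z) \<le> real m / 2"
  shows "rprob (pairs W) p (\<lambda>G. \<not> lists_cover G W h c u z m g)
    \<le> 4 ^ card W * ((1 + p) ^ (h * h) * 2 ^ card W * ((exp 1 * (2 * sqrt (u * real h)) / real m) ^ m * p ^ m) ^ g)"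
proof -
  define R where "R = {(X, Y). X \<subseteq> W \<and> Y \<subseteq> W \<and> X \<inter> Y = {} \<and> card X = h \<and> card Y = h}"
  have Rs: "R \<subseteq> Pow W \<times> Pow W" by (auto simp: R_def)
  then have finR: "finite R" using W by (rule_tac finite_subset) auto
  have "card R \<le> card (Pow W \<times> Pow W)" using Rs W by (intro card_mono) auto
  also have "\<dots> = 4 ^ card W" using W by (simp add: card_cartesian_product card_Pow power_mult_distrib[symmetric])
  finally have "real (card R) \<le> real (4 ^ card W)" by (rule of_nat_mono)
  then have cR: "real (card R) \<le> 4 ^ card W" by simp
  \<comment> \<open>Density of \<open>J\<close> is made part of the family, which is then empty for
    all other \<open>J\<close>, so the count holds for every \<open>J\<close>.\<close>
  define F where "F = (\<lambda>(X :: 'a set) Y J. {B. B \<subseteq> Y \<and> card B = m \<and> dense_pair J u c X Y \<and> z \<le> real (card {x \<in> X. nbrs J x B = {}})})"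
  let ?b = "(exp 1 * (2 * sqrt (u * real h)) / real m) ^ m"
  let ?Q = "\<lambda>(X, Y) G. \<exists>J\<subseteq>cross X Y. J \<subseteq> G \<and>
      (\<exists>P\<subseteq>W - (X \<union> Y). card P = g \<and> (\<forall>v\<in>P. \<exists>A\<in>F X Y J. \<forall>a\<in>A. {v, a} \<in> G))"
  have "rprob (pairs W) p (\<lambda>G. \<not> lists_cover G W h c u z m g) \<le> rprob (pairs W) p (\<lambda>G. \<exists>i\<in>R. ?Q i G)"
  proof (rule rprob_mono[OF finite_pairs[OF W] p])
    fix G assume neg: "\<not> lists_cover G W h c u z m g"
    show "\<exists>i\<in>R. ?Q i G"
    proof (rule ccontr)
      assume nR: "\<not> ?thesis"
      have "lists_cover G W h c u z m g"
        unfolding lists_cover_def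
      proof (intro allI impI, rule ccontr)
        fix X Y J P
        assume XY: "X \<subseteq> W" "Y \<subseteq> W" "J \<subseteq> G \<inter> cross X Y" "P \<subseteq> W - (X \<union> Y)" "X \<inter> Y = {}"
          "card X = h" "card Y = h" "dense_pair J u c X Y" "card P = g"
          and nv: "\<not> (\<exists>v\<in>P. \<forall>B\<subseteq>nbrs G v Y. card B = m \<longrightarrow> real (card {x \<in> X. nbrs J x B = {}}) < z)"
    have "\<exists>A\<in>F X Y J. \<forall>a\<in>A. {v, a} \<in> G" if v: "v \<in> P" for v
    proof -
      obtain B where B: "B \<subseteq> nbrs G v Y" "card B = m" "\<not> real (card {x \<in> X. nbrs J x B = {}}) < z"
        using nv v by auto
      have "B \<subseteq> Y" using B(1) nbrs_subset by (rule order_trans)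
      then have "B \<in> F X Y J" using XY(8) B(2,3) by (simp add: F_def not_less)
      moreover have "\<forall>a\<in>B. {v, a} \<in> G" using B(1) by (auto simp: nbrs_def)
      ultimately show ?thesis by blast
    qed
    then have "?Q (X, Y) G" unfolding prod.case
      using XY(3,4,9) by (intro exI[of _ J] conjI exI[of _ P] ballI) auto
    moreover have "(X, Y) \<in> R" using XY(1,2,5-7) by (simp add: R_def)
    ultimately show False using nR by (meson bexI)
  qed
      then show False using neg by contradiction
    qed
  qed
  also have "\<dots> \<le> (\<Sum>i\<in>R. rprob (pairs W) p (?Q i))"
    by (rule rprob_UN[OF finite_pairs[OF W] p finR, of ?Q])
  also have "\<dots> \<le> (\<Sum>i\<in>R. (1 + p) ^ (h * h) * 2 ^ card W * (?b * p ^ m) ^ g)"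
  proof (rule sum_mono)
    fix i assume iR: "i \<in> R"
    obtain X Y where i: "i = (X, Y)" by (cases i)
    have XY: "X \<subseteq> W" "Y \<subseteq> W" "X \<inter> Y = {}" "card X = h" "card Y = h"
      using iR unfolding i R_def by simp_all
    have fXY: "finite X" "finite Y" using XY(1,2) W by (auto intro: finite_subset)
    have b: "real (card (F X Y J)) \<le> ?b" for J
    proof (cases "dense_pair J u c X Y")
      case True
      define N where "N b = {x \<in> X. {x, b} \<in> J}" for b
      have "X - (\<Union>b\<in>B. N b) = {x \<in> X. nbrs J x B = {}}" for B
        by (auto simp: N_def nbrs_def)
      then have "F X Y J = {B. B \<subseteq> Y \<and> card B = m \<and> z \<le> real (card (X - (\<Union>b\<in>B. N b)))}"
        using True by (simp add: F_def)
      also have "real (card \<dots>) \<le> ?b"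
      proof (rule card_subsets_leaving_uncovered[where \<xi> = "c * z"])
        show "real (card {a \<in> Y. real (card (N a \<inter> Z')) < c * z}) \<le> u" if "Z' \<subseteq> X" "z \<le> real (card Z')" for Z'
          unfolding N_def by (rule few_atypical[OF True fXY c u(1,2) that])
      qed (use fXY XY u c m mc in auto)
      finally show ?thesis .
    next
      case False
      then have "F X Y J = {}" by (auto simp: F_def)
      then show ?thesis using u by simp
    qed
    have "rprob (pairs W) p (?Q i) \<le> (1 + p) ^ card (cross X Y) * 2 ^ card W * (?b * p ^ m) ^ g"
      unfolding i prod.case
    proof (rule rprob_first_moment_pairs)
      show "cross X Y \<subseteq> pairs (X \<union> Y)" using XY by (intro cross_subset_pairs) auto
    qed (use XY b in \<open>auto simp: F_def\<close>)
    also have "card (cross X Y) = h * h" using XY fXY by (simp add: card_cross)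
    finally show "rprob (pairs W) p (?Q i) \<le> (1 + p) ^ (h * h) * 2 ^ card W * (?b * p ^ m) ^ g" .
  qed
  also have "\<dots> = real (card R) * ((1 + p) ^ (h * h) * 2 ^ card W * (?b * p ^ m) ^ g)" by simp
  also have "\<dots> \<le> 4 ^ card W * ((1 + p) ^ (h * h) * 2 ^ card W * (?b * p ^ m) ^ g)"
    using cR p u by (intro mult_right_mono) auto
  finally show ?thesis .
qed

text \<open>The roles are exchanged: the set to be covered is the list of a vertex \<open>q\<close>,
  of size \<open>D\<close>, and the picks are the elements of \<open>A\<close>. If \<open>A\<close>
  sends no edge to \<open>B\<close>, the \<open>m\<close> elements of \<open>B\<close> stay
  uncovered. A typical pick covers \<open>T\<close> elements, so at most
  \<open>D / T \<le> m / 2\<close> picks are typical. The additional factor \<open>h\<close> pays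
  for the choice of \<open>q\<close>.\<close>

lemma rprob_not_lists_linked:
  assumes m: "0 < m" and T: "0 < T" "real D / real T \<le> real m / 2" and u: "0 < u" "u \<le> real h"
  shows "rprob (pairs W) p (\<lambda>G. \<not> lists_linked G W h D m T u g)
    \<le> 8 ^ card W * ((1 + p) ^ (2 * h * h) * 2 ^ card W * (real h * (exp 1 * (2 * sqrt (u * real h)) / real m) ^ m * p ^ m) ^ g)"
proof -
  define R where "R = {(X, Y, Q). X \<subseteq> W \<and> Y \<subseteq> W \<and> Q \<subseteq> W \<and> X \<inter> Y = {} \<and> X \<inter> Q = {} \<and> Y \<inter> Q = {} \<and>
    card X = h \<and> card Y = h \<and> card Q = h}"
  have Rs: "R \<subseteq> Pow W \<times> Pow W \<times> Pow W" by (auto simp: R_def)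
  then have finR: "finite R" using W by (rule_tac finite_subset) auto
  have "card R \<le> card (Pow W \<times> Pow W \<times> Pow W)" using Rs W by (intro card_mono) auto
  also have "\<dots> = 8 ^ card W" using W by (simp add: card_cartesian_product card_Pow power_mult_distrib[symmetric])
  finally have "real (card R) \<le> real (8 ^ card W)" by (rule of_nat_mono)
  then have cR: "real (card R) \<le> 8 ^ card W" by simp
  define FF where "FF = (\<lambda>(X :: 'a set) Y q J. {A. A \<subseteq> X \<and> card A = m \<and> covering_list J X (nbrs J q Y) D m T u \<and>
      (\<exists>B\<subseteq>nbrs J q Y. card B = m \<and> (\<forall>a\<in>A. nbrs J a B = {}))})"
  define F where "F = (\<lambda>(X :: 'a set) Y Q J. \<Union>q\<in>Q. FF X Y q J)"
  let ?bb = "(exp 1 * (2 * sqrt (u * real h)) / real m) ^ m"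
  let ?Q = "\<lambda>(X, Y, Q) G. \<exists>J\<subseteq>cross X Y \<union> cross Q Y. J \<subseteq> G \<and>
      (\<exists>P\<subseteq>W - (X \<union> Y \<union> Q). card P = g \<and> (\<forall>v\<in>P. \<exists>A\<in>F X Y Q J. \<forall>a\<in>A. {v, a} \<in> G))"
  have "rprob (pairs W) p (\<lambda>G. \<not> lists_linked G W h D m T u g) \<le> rprob (pairs W) p (\<lambda>G. \<exists>i\<in>R. ?Q i G)"
  proof (rule rprob_mono[OF finite_pairs[OF W] p])
    fix G assume neg: "\<not> lists_linked G W h D m T u g"
    show "\<exists>i\<in>R. ?Q i G"
    proof (rule ccontr)
      assume nR: "\<not> ?thesis"
      have "lists_linked G W h D m T u g"
        unfolding lists_linked_def
      proof (intro allI impI, rule ccontr)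
        fix X Y Q J P
        assume XY: "X \<subseteq> W" "Y \<subseteq> W" "Q \<subseteq> W" "J \<subseteq> G \<inter> (cross X Y \<union> cross Q Y)" "P \<subseteq> W - (X \<union> Y \<union> Q)"
          "X \<inter> Y = {}" "X \<inter> Q = {}" "Y \<inter> Q = {}" "card X = h" "card Y = h" "card Q = h" "card P = g"
        assume nv: "\<not> (\<exists>v\<in>P. \<forall>A\<subseteq>nbrs G v X. card A = m \<longrightarrow>
          (\<forall>q\<in>Q. covering_list J X (nbrs J q Y) D m T u \<longrightarrow>
           (\<forall>B\<subseteq>nbrs J q Y. card B = m \<longrightarrow> (\<exists>a\<in>A. nbrs J a B \<noteq> {}))))"
        have bad: "\<exists>A\<subseteq>nbrs G v X. card A = m \<and> (\<exists>q\<in>Q. covering_list J X (nbrs J q Y) D m T u \<and>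
           (\<exists>B\<subseteq>nbrs J q Y. card B = m \<and> (\<forall>a\<in>A. nbrs J a B = {})))" if v: "v \<in> P" for v
          using nv v by simp
    have "\<exists>A\<in>F X Y Q J. \<forall>a\<in>A. {v, a} \<in> G" if v: "v \<in> P" for v
    proof -
      obtain A q B where A: "A \<subseteq> nbrs G v X" "card A = m" "q \<in> Q" "covering_list J X (nbrs J q Y) D m T u"
        "B \<subseteq> nbrs J q Y" "card B = m" "\<forall>a\<in>A. nbrs J a B = {}" using bad[OF v] by auto
      have "A \<subseteq> X" using A(1) nbrs_subset by (rule order_trans)
      then have "A \<in> FF X Y q J" using A(2,4-7) by (auto simp: FF_def)
      then have "A \<in> F X Y Q J" using A(3) by (auto simp: F_def)
      moreover have "\<forall>a\<in>A. {v, a} \<in> G" using A(1) by (auto simp: nbrs_def)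
      ultimately show ?thesis by blast
    qed
    then have "?Q (X, Y, Q) G" unfolding prod.case
      using XY(4,5,12) by (intro exI[of _ J] conjI exI[of _ P] ballI) auto
    moreover have "(X, Y, Q) \<in> R" using XY(1-3,6-11) by (simp add: R_def)
    ultimately show False using nR by (meson bexI)
  qed
      then show False using neg by contradiction
    qed
  qed
  also have "\<dots> \<le> (\<Sum>i\<in>R. rprob (pairs W) p (?Q i))"
    by (rule rprob_UN[OF finite_pairs[OF W] p finR, of ?Q])
  also have "\<dots> \<le> (\<Sum>i\<in>R. (1 + p) ^ (2 * h * h) * 2 ^ card W * (real h * ?bb * p ^ m) ^ g)"
  proof (rule sum_mono)
    fix i assume iR: "i \<in> R"
    obtain X Y Q where i: "i = (X, Y, Q)" by (cases i)
    have XY: "X \<subseteq> W" "Y \<subseteq> W" "Q \<subseteq> W" "X \<inter> Y = {}" "X \<inter> Q = {}" "Y \<inter> Q = {}"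
      "card X = h" "card Y = h" "card Q = h"
      using iR unfolding i R_def by simp_all
    have fXY: "finite X" "finite Y" "finite Q" using XY(1-3) W by (auto intro: finite_subset)
    have FFb: "real (card (FF X Y q J)) \<le> ?bb" for q J
    proof (cases "covering_list J X (nbrs J q Y) D m T u")
      case True
      let ?L = "nbrs J q Y"
      have fL: "finite ?L" using fXY(2) by (rule finite_nbrs)
      have "FF X Y q J \<subseteq> {A. A \<subseteq> X \<and> card A = m \<and> real m \<le> real (card (?L - (\<Union>a\<in>A. nbrs J a ?L)))}"
      proof
        fix A assume "A \<in> FF X Y q J"
        then obtain B where B: "A \<subseteq> X" "card A = m" "B \<subseteq> ?L" "card B = m" "\<forall>a\<in>A. nbrs J a B = {}"
          by (auto simp: FF_def)
        have "B \<subseteq> ?L - (\<Union>a\<in>A. nbrs J a ?L)" using B(3,5) by (auto simp: nbrs_def)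
        then have "m \<le> card (?L - (\<Union>a\<in>A. nbrs J a ?L))" using fL B(4) card_mono finite_Diff by metis
        then show "A \<in> {A. A \<subseteq> X \<and> card A = m \<and> real m \<le> real (card (?L - (\<Union>a\<in>A. nbrs J a ?L)))}"
          using B by simp
      qed
      then have "card (FF X Y q J) \<le> card {A. A \<subseteq> X \<and> card A = m \<and> real m \<le> real (card (?L - (\<Union>a\<in>A. nbrs J a ?L)))}"
        using fXY by (intro card_mono) auto
      then have "real (card (FF X Y q J)) \<le> real (card {A. A \<subseteq> X \<and> card A = m \<and> real m \<le> real (card (?L - (\<Union>a\<in>A. nbrs J a ?L)))})"
        by (rule of_nat_mono)
      also have "\<dots> \<le> ?bb"
      proof (rule card_subsets_leaving_uncovered[where \<xi> = "real T"])
        show "real (card {a \<in> X. real (card (nbrs J a ?L \<inter> Z')) < real T}) \<le> u" if Z': "Z' \<subseteq> ?L" "real m \<le> real (card Z')" for Z'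
        proof -
          obtain B where B: "B \<subseteq> Z'" "card B = m" by (rule obtain_subset_with_card_n[of m Z']) (use Z'(2) in auto)
          have fZ: "finite Z'" using Z' fL finite_subset by auto
          have "{a \<in> X. real (card (nbrs J a ?L \<inter> Z')) < real T} \<subseteq> {x \<in> X. card (nbrs J x B) < T}"
          proof clarify
            fix a assume "real (card (nbrs J a ?L \<inter> Z')) < real T"
            moreover have "nbrs J a B \<subseteq> nbrs J a ?L \<inter> Z'" using B Z' by (auto simp: nbrs_def)
            then have "card (nbrs J a B) \<le> card (nbrs J a ?L \<inter> Z')" using fZ by (intro card_mono) auto
            ultimately show "card (nbrs J a B) < T" by simp
          qed
          then have "card {a \<in> X. real (card (nbrs J a ?L \<inter> Z')) < real T} \<le> card {x \<in> X. card (nbrs J x B) < T}"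
            using fXY by (intro card_mono) auto
          moreover have "real (card {x \<in> X. card (nbrs J x B) < T}) \<le> u"
            using True B Z' unfolding covering_list_def by auto
          ultimately show ?thesis by linarith
        qed
        show "real (card ?L) / real T \<le> real m / 2" using True T by (simp add: covering_list_def)
      qed (use fXY XY fL u T m in auto)
      finally show ?thesis .
    next
      case False
      then have "FF X Y q J = {}" by (auto simp: FF_def)
      then show ?thesis using u by simp
    qed
    have b: "real (card (F X Y Q J)) \<le> real h * ?bb" for J
    proof -
      have "card (F X Y Q J) \<le> (\<Sum>q\<in>Q. card (FF X Y q J))" unfolding F_def using fXY by (intro card_UN_le)
      then have "real (card (F X Y Q J)) \<le> (\<Sum>q\<in>Q. real (card (FF X Y q J)))" by (simp flip: of_nat_sum)
      also have "\<dots> \<le> (\<Sum>q\<in>Q. ?bb)" using FFb by (intro sum_mono)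
      finally show ?thesis using XY by simp
    qed
    have "rprob (pairs W) p (?Q i) \<le> (1 + p) ^ card (cross X Y \<union> cross Q Y) * 2 ^ card W * (real h * ?bb * p ^ m) ^ g"
      unfolding i prod.case
    proof (rule rprob_first_moment_pairs)
      have "cross X Y \<subseteq> pairs (X \<union> Y \<union> Q)" by (rule cross_subset_pairs) (use XY in auto)
      moreover have "cross Q Y \<subseteq> pairs (X \<union> Y \<union> Q)" by (rule cross_subset_pairs) (use XY in auto)
      ultimately show "cross X Y \<union> cross Q Y \<subseteq> pairs (X \<union> Y \<union> Q)" by blast
      show "F X Y Q J \<subseteq> {A. A \<subseteq> X \<union> Y \<union> Q \<and> card A = m}" for J by (auto simp: F_def FF_def)
    qed (use XY b in auto)
    also have "\<dots> \<le> (1 + p) ^ (2 * h * h) * 2 ^ card W * (real h * ?bb * p ^ m) ^ g"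
    proof -
      have "card (cross X Y \<union> cross Q Y) \<le> card (cross X Y) + card (cross Q Y)" by (rule card_Un_le)
      also have "\<dots> = 2 * h * h" using XY fXY by (simp add: card_cross Int_commute)
      finally have "(1 + p) ^ card (cross X Y \<union> cross Q Y) \<le> (1 + p) ^ (2 * h * h)"
        using p by (intro power_increasing) auto
      then show ?thesis using p u by (intro mult_right_mono) auto
    qed
    finally show "rprob (pairs W) p (?Q i) \<le> (1 + p) ^ (2 * h * h) * 2 ^ card W * (real h * ?bb * p ^ m) ^ g" .
  qed
  also have "\<dots> = real (card R) * ((1 + p) ^ (2 * h * h) * 2 ^ card W * (real h * ?bb * p ^ m) ^ g)" by simp
  also have "\<dots> \<le> 8 ^ card W * ((1 + p) ^ (2 * h * h) * 2 ^ card W * (real h * ?bb * p ^ m) ^ g)"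
    using cR p u by (intro mult_right_mono) auto
  finally show ?thesis .
qed

end

section \<open>Edge counts and densities under passing to subsets\<close>

lemma edge_count_commute: "edge_count J A B = edge_count J B A"
proof -
  have "{(a, b). a \<in> A \<and> b \<in> B \<and> {a, b} \<in> J} = prod.swap ` {(a, b). a \<in> B \<and> b \<in> A \<and> {a, b} \<in> J}"
    by (auto simp: insert_commute)
  moreover have "inj_on prod.swap {(a, b). a \<in> B \<and> b \<in> A \<and> {a, b} \<in> J}" by (auto intro: inj_onI)
  ultimately show ?thesis by (simp add: edge_count_def card_image)
qed

lemma dense_pair_commute: "dense_pair J u c X Y \<Longrightarrow> dense_pair J u c Y X"
  unfolding dense_pair_def
proof (intro allI impI)
  fix A B
  assume d: "\<forall>A\<subseteq>X. \<forall>B\<subseteq>Y. u \<le> real (card A) \<longrightarrow> u \<le> real (card B) \<longrightarrow>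
     c * real (card A) * real (card B) \<le> real (edge_count J A B)"
    and AB: "A \<subseteq> Y" "B \<subseteq> X" "u \<le> real (card A)" "u \<le> real (card B)"
  have "c * real (card B) * real (card A) \<le> real (edge_count J B A)" using d AB by simp
  then show "c * real (card A) * real (card B) \<le> real (edge_count J A B)"
    by (simp add: edge_count_commute[of J A B] mult_ac)
qed

lemma dense_pair_subset:
  assumes "dense_pair J u c X Y" "X' \<subseteq> X" "Y' \<subseteq> Y" "u \<le> u'"
  shows "dense_pair J u' c X' Y'"
  unfolding dense_pair_def
proof (intro allI impI)
  fix A B assume "A \<subseteq> X'" "B \<subseteq> Y'" "u' \<le> real (card A)" "u' \<le> real (card B)"
  then show "c * real (card A) * real (card B) \<le> real (edge_count J A B)"
    using assms unfolding dense_pair_def by (meson order_trans)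
qed

lemma edge_count_split_left:
  assumes "finite A" "finite B" "A' \<subseteq> A"
  shows "edge_count J A B = edge_count J A' B + edge_count J (A - A') B"
proof -
  have "finite A'" using assms finite_subset by auto
  then show ?thesis using assms
    by (simp add: edge_count_sum_left sum.subset_diff[OF assms(3,1)] add.commute)
qed

lemma edge_count_split_right:
  assumes "finite A" "finite B" "B' \<subseteq> B"
  shows "edge_count J A B = edge_count J A B' + edge_count J A (B - B')"
  using edge_count_split_left[OF assms(2,1,3), of J]
    edge_count_commute[of J A B] edge_count_commute[of J A B'] edge_count_commute[of J A "B - B'"] by linarith

text \<open>Dropping an element of largest value never raises the average; this is repeated until
  \<open>b\<close> elements are left.\<close>

lemma subset_sum_below_average:
  fixes f :: "'a \<Rightarrow> real"
  assumes "finite A" "b \<le> card A"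
  shows "\<exists>A'\<subseteq>A. card A' = b \<and> sum f A' * real (card A) \<le> real b * sum f A"
  using assms
proof (induction "card A - b" arbitrary: A)
  case 0
  then have "card A = b" by simp
  then show ?case by (intro exI[of _ A] conjI) (simp_all add: mult.commute)
next
  case (Suc k)
  have ne: "A \<noteq> {}" using Suc.hyps(2) by (cases "A = {}") simp_all
  have "\<exists>x\<in>A. \<forall>y\<in>A. f y \<le> f x"
    using finite_has_maximal[of "f ` A"] Suc.prems(1) ne by (auto simp: not_less) (metis linorder_le_cases)
  then obtain x where x: "x \<in> A" "\<forall>y\<in>A. f y \<le> f x" by blast
  have card: "card (A - {x}) = card A - 1" using x Suc.prems by simp
  have k: "k = card (A - {x}) - b" and bl: "b \<le> card (A - {x})" using card Suc.hyps(2) by simp_all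
  obtain A' where A': "A' \<subseteq> A - {x}" "card A' = b" "sum f A' * real (card (A - {x})) \<le> real b * sum f (A - {x})"
    using Suc.hyps(1)[OF k finite_Diff[OF Suc.prems(1)] bl] by blast
  have sumx: "sum f A = f x + sum f (A - {x})" using x Suc.prems by (simp add: sum.remove)
  have le: "sum f (A - {x}) \<le> real (card (A - {x})) * f x"
    using x sum_bounded_above[of "A - {x}" f "f x"] by simp
  show ?case
  proof (cases "b = 0")
    case True
    then show ?thesis using A' Suc.prems finite_subset[of A' A]
      by (intro exI[of _ A']) (auto dest: finite_subset)
  next
    case False
    define k where "k = real (card (A - {x}))"
    have k1: "0 < k" using card Suc.hyps(2) False by (simp add: k_def)
    have cA: "real (card A) = k + 1" unfolding k_def using card ne Suc.prems card_gt_0_iff[of A] by simp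
    have "k * (sum f A' * (k + 1)) \<le> (k + 1) * (real b * sum f (A - {x}))"
      using mult_left_mono[OF A'(3), of "k + 1"] k1 by (simp add: k_def mult_ac)
    also have "\<dots> = real b * (k * sum f (A - {x}) + sum f (A - {x}))" by (simp add: algebra_simps)
    also have "\<dots> \<le> real b * (k * sum f (A - {x}) + k * f x)"
      using le by (intro mult_left_mono add_left_mono) (auto simp: k_def)
    also have "\<dots> = k * (real b * sum f A)" by (simp add: sumx algebra_simps)
    finally have "sum f A' * (k + 1) \<le> real b * sum f A" using k1 by simp
    then show ?thesis using A' cA by (intro exI[of _ A']) auto
  qed
qed

subsection \<open>Regularisation\<close>

definition dense_at :: "'a set set \<Rightarrow> real \<Rightarrow> 'a set \<Rightarrow> 'a set \<Rightarrow> nat \<Rightarrow> bool" where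
  "dense_at J r X Y b \<longleftrightarrow> (\<forall>A\<subseteq>X. \<forall>B\<subseteq>Y. card A = b \<longrightarrow> card B = b \<longrightarrow> r * real b * real b \<le> real (edge_count J A B))"

text \<open>\<open>A\<close> has a \<open>b\<close>-subset \<open>A'\<close> of at most average
  degree, and relative to it \<open>B\<close> has such a \<open>B'\<close>; so a sparse pair of
  larger sets would contain a sparse pair of size exactly \<open>b\<close>. Testing one size is
  therefore enough.\<close>

lemma dense_atD:
  assumes d: "dense_at J r X Y b" and fin: "finite X" "finite Y" and b: "0 < b"
    and AB: "A \<subseteq> X" "B \<subseteq> Y" "b \<le> card A" "b \<le> card B"
  shows "r * real (card A) * real (card B) \<le> real (edge_count J A B)"
proof -
  have fA: "finite A" "finite B" using finite_subset[OF AB(1) fin(1)] finite_subset[OF AB(2) fin(2)] .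
  obtain A' where A': "A' \<subseteq> A" "card A' = b" "(\<Sum>a\<in>A'. real (card (nbrs J a B))) * real (card A) \<le> real b * (\<Sum>a\<in>A. real (card (nbrs J a B)))"
    using subset_sum_below_average[OF fA(1) AB(3), of "\<lambda>a. real (card (nbrs J a B))"] by blast
  have fA': "finite A'" using A'(1) fA(1) by (rule finite_subset)
  obtain B' where B': "B' \<subseteq> B" "card B' = b"
    "(\<Sum>b\<in>B'. real (card {a \<in> A'. {a, b} \<in> J})) * real (card B) \<le> real b * (\<Sum>b\<in>B. real (card {a \<in> A'. {a, b} \<in> J}))"
    using subset_sum_below_average[OF fA(2) AB(4), of "\<lambda>b. real (card {a \<in> A'. {a, b} \<in> J})"] by blast
  have fB': "finite B'" using B'(1) fA(2) by (rule finite_subset)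
  have 1: "real (edge_count J A' B) * real (card A) \<le> real b * real (edge_count J A B)"
    using A'(3) fA fA' by (simp add: edge_count_sum_left)
  have 2: "real (edge_count J A' B') * real (card B) \<le> real b * real (edge_count J A' B)"
    using B'(3) fA fA' fB' by (simp add: edge_count_sum_right)
  have "A' \<subseteq> X" "B' \<subseteq> Y" using A'(1) B'(1) AB by auto
  then have "r * real b * real b \<le> real (edge_count J A' B')"
    using d A'(2) B'(2) unfolding dense_at_def by simp
  then have "r * real b * real b * (real (card A) * real (card B)) \<le> real (edge_count J A' B') * (real (card A) * real (card B))"
    by (intro mult_right_mono) auto
  also have "\<dots> = (real (edge_count J A' B') * real (card B)) * real (card A)" by simp
  also have "\<dots> \<le> (real b * real (edge_count J A' B)) * real (card A)" using 2 by (intro mult_right_mono) auto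
  also have "\<dots> = real b * (real (edge_count J A' B) * real (card A))" by simp
  also have "\<dots> \<le> real b * (real b * real (edge_count J A B))" using 1 by (intro mult_left_mono) auto
  finally have "(real b * real b) * (r * real (card A) * real (card B)) \<le> (real b * real b) * real (edge_count J A B)"
    by (simp add: mult_ac)
  then show ?thesis using b by simp
qed

lemma dense_at_mono:
  assumes "dense_at J r X Y b" "finite X" "finite Y" "0 < b" "b \<le> b'"
  shows "dense_at J r X Y b'"
  unfolding dense_at_def
proof (intro allI impI)
  fix A B assume AB: "A \<subseteq> X" "B \<subseteq> Y" "card A = b'" "card B = b'"
  show "r * real b' * real b' \<le> real (edge_count J A B)"
    using dense_atD[OF assms(1-4) AB(1,2)] AB(3,4) assms(5) by simp
qed

text \<open>The minimal density at scale \<open>b\<close> in units of \<open>p / (4 * n)\<close>,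
  rounded down and capped at \<open>p / 4\<close>. Rounding bounds the number of drops by
  \<open>n\<close>; the cap is harmless, because a red density of \<open>p / 4\<close> is already
  sufficient. Index \<open>0\<close> always qualifies, so the maximum exists.\<close>

definition level :: "'a set set \<Rightarrow> real \<Rightarrow> nat \<Rightarrow> 'a set \<Rightarrow> 'a set \<Rightarrow> nat \<Rightarrow> nat" where
  "level J p n X Y b = Max {j. j \<le> n \<and> dense_at J (real j / (4 * real n) * p) X Y b}"

lemma level:
  shows level_le: "level J p n X Y b \<le> n"
    and level_dense: "dense_at J (real (level J p n X Y b) / (4 * real n) * p) X Y b"
    and level_ge: "j \<le> n \<Longrightarrow> dense_at J (real j / (4 * real n) * p) X Y b \<Longrightarrow> j \<le> level J p n X Y b"
proof -
  let ?S = "{j. j \<le> n \<and> dense_at J (real j / (4 * real n) * p) X Y b}"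
  have fin: "finite ?S" by auto
  have "0 \<in> ?S" by (auto simp: dense_at_def)
  then have "Max ?S \<in> ?S" using fin by (intro Max_in) auto
  then show "level J p n X Y b \<le> n" "dense_at J (real (level J p n X Y b) / (4 * real n) * p) X Y b"
    by (auto simp: level_def)
  show "j \<le> n \<Longrightarrow> dense_at J (real j / (4 * real n) * p) X Y b \<Longrightarrow> j \<le> level J p n X Y b"
    unfolding level_def using fin by (intro Max_ge) auto
qed

lemma level_mono:
  assumes "finite X" "finite Y" "0 < b" "b \<le> b'"
  shows "level J p n X Y b \<le> level J p n X Y b'"
  using level_ge[OF level_le dense_at_mono[OF level_dense assms]] .

text \<open>If the red density does not drop between the scales \<open>b\<close> and \<open>b'\<close>, then either red is dense
  everywhere, or a pair of near-minimal red density is nearly regular, so that blue is dense on it.\<close>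

lemma stable_level_good:
  assumes W: "finite W" "X \<subseteq> W" "Y \<subseteq> W" "X \<inter> Y = {}" and G: "host_dense G W z p" and p: "0 \<le> p"
    and J: "\<And>a b. a \<in> X \<Longrightarrow> b \<in> Y \<Longrightarrow> {a, b} \<in> G \<Longrightarrow> {a, b} \<in> J \<or> {a, b} \<in> J'"
    and \<delta>: "0 < \<delta>" "\<delta> \<le> 1" and n: "4 \<le> \<delta>\<^sup>2 * real n"
    and b: "0 < b'" "real b' \<le> \<delta>\<^sup>2 / 8 * real b" "z \<le> \<delta> * real b" "b \<le> card X" "b \<le> card Y"
    and stable: "level J p n X Y b' = level J p n X Y b"
  shows "\<exists>A\<subseteq>X. \<exists>B\<subseteq>Y. card A = b \<and> card B = b \<and> (dense_pair J (\<delta> * real b) (p / 8) A B \<or> dense_pair J' (\<delta> * real b) (p / 8) A B)"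
proof -
  define j where "j = level J p n X Y b"
  define r where "r = real j / (4 * real n)"
  have fin: "finite X" "finite Y" using finite_subset[OF W(2,1)] finite_subset[OF W(3,1)] .
  have n0: "0 < n" using n by (cases n) simp_all
  have jn: "j \<le> n" unfolding j_def by (rule level_le)
  have r4: "0 \<le> r" "r \<le> 1 / 4" using jn n0 by (auto simp: r_def field_simps)
  have "dense_at J (r * p) X Y b'" using level_dense[of J p n X Y b'] stable by (simp add: r_def j_def)
  note D = dense_atD[OF this fin b(1)]
  have d1: "\<delta>\<^sup>2 \<le> \<delta>" using \<delta> by (simp add: power2_eq_square mult_left_le)
  have b'\<delta>: "real b' \<le> \<delta> * real b"
  proof -
    have "\<delta>\<^sup>2 / 8 * real b \<le> \<delta> * real b" using d1 \<delta> by (intro mult_right_mono) auto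
    then show ?thesis using b(2) by linarith
  qed
  show ?thesis
  proof (cases "j = n")
    case True
    obtain A B where AB: "A \<subseteq> X" "card A = b" "B \<subseteq> Y" "card B = b"
      by (rule obtain_subset_with_card_n[OF b(4)], rule obtain_subset_with_card_n[OF b(5)])
    have "dense_pair J (\<delta> * real b) (p / 8) A B"
      unfolding dense_pair_def
    proof (intro allI impI)
      fix A' B' assume A': "A' \<subseteq> A" "B' \<subseteq> B" "\<delta> * real b \<le> real (card A')" "\<delta> * real b \<le> real (card B')"
      have "p / 8 * real (card A') * real (card B') \<le> r * p * real (card A') * real (card B')"
        using True n0 p by (intro mult_right_mono) (auto simp: r_def)
      also have "\<dots> \<le> real (edge_count J A' B')" using A' AB b'\<delta> by (intro D) auto
      finally show "p / 8 * real (card A') * real (card B') \<le> real (edge_count J A' B')" .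
    qed
    then show ?thesis using AB by blast
  next
    case False
    have "\<not> dense_at J (real (j + 1) / (4 * real n) * p) X Y b"
    proof
      assume "dense_at J (real (j + 1) / (4 * real n) * p) X Y b"
      then have "j + 1 \<le> j" using level_ge[of "j + 1" n J p X Y b] False jn unfolding j_def by simp
      then show False by simp
    qed
    then obtain A B where AB: "A \<subseteq> X" "B \<subseteq> Y" "card A = b" "card B = b"
      and few: "real (edge_count J A B) < real (j + 1) / (4 * real n) * p * real b * real b"
      unfolding dense_at_def by (auto simp: not_le)
    have fAB: "finite A" "finite B" using AB(1,2) fin by (auto intro: finite_subset)
    have r1: "real (j + 1) / (4 * real n) \<le> r + \<delta>\<^sup>2 / 16"
      using n n0 by (simp add: r_def field_simps)
    \<comment> \<open>Red edges between \<open>A'\<close> and \<open>B'\<close> are counted by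
      subtraction: the density between \<open>A\<close> and \<open>B\<close> is nearly minimal,
      while the discarded pairs \<open>A - A'\<close>, \<open>B\<close> and \<open>A'\<close>,
      \<open>B - B'\<close> have density at least \<open>r * p\<close> by stability. At most
      \<open>3 / 8 * p * x * y\<close> red edges are left, against \<open>p * x * y / 2\<close>
      edges of the host.\<close>
    have "dense_pair J' (\<delta> * real b) (p / 8) A B"
      unfolding dense_pair_def
    proof (intro allI impI)
      fix A' B' assume A': "A' \<subseteq> A" "B' \<subseteq> B" "\<delta> * real b \<le> real (card A')" "\<delta> * real b \<le> real (card B')"
      define x where "x = real (card A')"
      define y where "y = real (card B')"
      have fA': "finite A'" "finite B'" using A'(1,2) fAB by (auto intro: finite_subset)
      have xb: "x \<le> real b" "y \<le> real b" using card_mono[OF fAB(1) A'(1)] card_mono[OF fAB(2) A'(2)] AB by (auto simp: x_def y_def)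
      have x0: "0 \<le> x" "0 \<le> y" by (auto simp: x_def y_def)
      have cA: "real (card (A - A')) = real b - x" "real (card (B - B')) = real b - y"
        using A' fA' AB card_mono[OF fAB(1) A'(1)] card_mono[OF fAB(2) A'(2)]
        by (auto simp: card_Diff_subset x_def y_def of_nat_diff)
      \<comment> \<open>Subtracting \<open>b'\<close> makes the estimate vacuous when the complement
        has fewer than \<open>b'\<close> elements, where the density bound says nothing.\<close>
      have e1: "r * p * (real b - x - real b') * real b \<le> real (edge_count J (A - A') B)"
      proof (cases "b' \<le> card (A - A')")
        case True
        have "r * p * real (card (A - A')) * real (card B) \<le> real (edge_count J (A - A') B)"
          using True AB b'\<delta> A' xb by (intro D) (auto simp: y_def)
        moreover have "r * p * (real b - x - real b') * real b \<le> r * p * real (card (A - A')) * real (card B)"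
          unfolding AB(4) cA by (intro mult_right_mono mult_left_mono) (use r4 p in auto)
        ultimately show ?thesis by linarith
      next
        case False
        then have "real b - x - real b' \<le> 0" using cA by linarith
        then have "r * p * (real b - x - real b') * real b \<le> 0"
          using r4 p by (intro mult_nonpos_nonneg mult_nonneg_nonpos) auto
        then show ?thesis by linarith
      qed
      have e2: "r * p * x * (real b - y - real b') \<le> real (edge_count J A' (B - B'))"
      proof (cases "b' \<le> card (B - B')")
        case True
        have "r * p * real (card A') * real (card (B - B')) \<le> real (edge_count J A' (B - B'))"
          using True AB b'\<delta> A' by (intro D) auto
        moreover have "r * p * x * (real b - y - real b') \<le> r * p * real (card A') * real (card (B - B'))"
          unfolding cA x_def[symmetric] by (intro mult_left_mono) (use r4 p x0 in auto)
        ultimately show ?thesis by linarith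
      next
        case False
        then have "real b - y - real b' \<le> 0" using cA by linarith
        then have "r * p * x * (real b - y - real b') \<le> 0"
          using r4 p x0 by (intro mult_nonneg_nonpos) auto
        then show ?thesis by linarith
      qed
      have "edge_count J A B = edge_count J A' B' + edge_count J A' (B - B') + edge_count J (A - A') B"
        using edge_count_split_left[OF fAB A'(1), of J] edge_count_split_right[OF fA'(1) fAB(2) A'(2), of J] by simp
      moreover have "real (edge_count J A B) \<le> (r + \<delta>\<^sup>2 / 16) * (p * real b * real b)"
      proof -
        have "real (j + 1) / (4 * real n) * (p * real b * real b) \<le> (r + \<delta>\<^sup>2 / 16) * (p * real b * real b)"
          using r1 p by (intro mult_right_mono) auto
        then show ?thesis using few by (simp add: mult.assoc)
      qed
      ultimately have "real (edge_count J A' B') \<le> (r + \<delta>\<^sup>2 / 16) * (p * real b * real b)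
          - r * p * (real b - x - real b') * real b - r * p * x * (real b - y - real b')"
        using e1 e2 by simp
      also have "\<dots> = p * (r * x * y + \<delta>\<^sup>2 / 16 * (real b * real b) + r * real b' * (real b + x))"
        by (simp add: algebra_simps)
      also have "\<dots> \<le> p * (1 / 4 * (x * y) + \<delta>\<^sup>2 / 16 * (real b * real b) + \<delta>\<^sup>2 / 16 * (real b * real b))"
      proof (intro mult_left_mono add_mono)
        show "r * x * y \<le> 1 / 4 * (x * y)" using r4 x0 mult_right_mono[of r "1/4" "x * y"] by (simp add: mult.assoc)
        have "r * real b' * (real b + x) \<le> 1 / 4 * (\<delta>\<^sup>2 / 8 * real b) * (2 * real b)"
          using r4 b(2) xb x0 by (intro mult_mono) auto
        then show "r * real b' * (real b + x) \<le> \<delta>\<^sup>2 / 16 * (real b * real b)" by (simp add: mult_ac)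
      qed (use p in auto)
      also have "\<dots> = p * (1 / 4 * (x * y) + 1 / 8 * ((\<delta> * real b) * (\<delta> * real b)))" by (simp add: power2_eq_square)
      also have "\<dots> \<le> p * (1 / 4 * (x * y) + 1 / 8 * (x * y))"
        using A'(3,4) p \<delta> x0 by (intro mult_left_mono add_left_mono mult_mono) (auto simp: x_def y_def)
      finally have red: "real (edge_count J A' B') \<le> 3 / 8 * p * x * y" by simp
      have lower: "p * x * y / 2 \<le> real (edge_count G A' B')"
      proof -
        have "A' \<subseteq> W" "B' \<subseteq> W" "A' \<inter> B' = {}" using A'(1,2) AB(1,2) W(2-4) by blast+
        moreover have "z \<le> real (card A')" "z \<le> real (card B')" using A' b(3) by auto
        ultimately show ?thesis using G unfolding host_dense_def x_def y_def by blast
      qed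
      have upper: "edge_count G A' B' \<le> edge_count J A' B' + edge_count J' A' B'"
      proof -
        have sub: "{(a, b). a \<in> A' \<and> b \<in> B' \<and> {a, b} \<in> G} \<subseteq>
            {(a, b). a \<in> A' \<and> b \<in> B' \<and> {a, b} \<in> J} \<union> {(a, b). a \<in> A' \<and> b \<in> B' \<and> {a, b} \<in> J'}"
        proof (rule subsetI)
          fix e assume "e \<in> {(a, b). a \<in> A' \<and> b \<in> B' \<and> {a, b} \<in> G}"
          then obtain a b where ab: "e = (a, b)" "a \<in> A'" "b \<in> B'" "{a, b} \<in> G" by blast
          have "a \<in> X" "b \<in> Y" using ab(2,3) A'(1,2) AB(1,2) by auto
          then have "{a, b} \<in> J \<or> {a, b} \<in> J'" using ab(4) by (rule J)
          then show "e \<in> {(a, b). a \<in> A' \<and> b \<in> B' \<and> {a, b} \<in> J} \<union> {(a, b). a \<in> A' \<and> b \<in> B' \<and> {a, b} \<in> J'}"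
            using ab(1-3) by blast
        qed
        have "finite {(a, b). a \<in> A' \<and> b \<in> B' \<and> {a, b} \<in> K}" for K
          by (rule finite_subset[of _ "A' \<times> B'"]) (use fA' in auto)
        then have "card {(a, b). a \<in> A' \<and> b \<in> B' \<and> {a, b} \<in> G} \<le>
            card ({(a, b). a \<in> A' \<and> b \<in> B' \<and> {a, b} \<in> J} \<union> {(a, b). a \<in> A' \<and> b \<in> B' \<and> {a, b} \<in> J'})"
          using sub by (intro card_mono) auto
        also have "\<dots> \<le> edge_count J A' B' + edge_count J' A' B'" unfolding edge_count_def by (rule card_Un_le)
        finally show ?thesis unfolding edge_count_def .
      qed
      have "p * x * y / 2 \<le> real (edge_count J A' B') + real (edge_count J' A' B')"
        using lower upper by linarith
      then have "p / 8 * x * y \<le> real (edge_count J' A' B')" using red by simp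
      then show "p / 8 * real (card A') * real (card B') \<le> real (edge_count J' A' B')"
        by (simp add: x_def y_def)
    qed
    then show ?thesis using AB by blast
  qed
qed

lemma card_drops_le:
  fixes f :: "nat \<Rightarrow> nat"
  assumes "\<And>i. f (Suc i) \<le> f i"
  shows "card {i. i < N \<and> f (Suc i) \<noteq> f i} + f N \<le> f 0"
proof (induction N)
  case (Suc N)
  show ?case
  proof (cases "f (Suc N) = f N")
    case True
    then have "{i. i < Suc N \<and> f (Suc i) \<noteq> f i} = {i. i < N \<and> f (Suc i) \<noteq> f i}" using less_Suc_eq by auto
    then show ?thesis using Suc True by simp
  next
    case False
    then have "{i. i < Suc N \<and> f (Suc i) \<noteq> f i} = insert N {i. i < N \<and> f (Suc i) \<noteq> f i}" using less_Suc_eq by auto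
    then show ?thesis using Suc False assms[of N] by simp
  qed
qed simp

text \<open>Each \<open>f e\<close> drops at most \<open>n\<close> times, so all \<open>N\<close>
  scales together see at most \<open>n * card M\<close> drops, and some scale sees no more than the
  average.\<close>

lemma few_unstable_scale:
  fixes f :: "'e \<Rightarrow> nat \<Rightarrow> nat"
  assumes M: "finite M" and mono: "\<And>e i. e \<in> M \<Longrightarrow> f e (Suc i) \<le> f e i" and n: "\<And>e. e \<in> M \<Longrightarrow> f e 0 \<le> n"
    and N: "0 < N"
  shows "\<exists>i<N. N * card {e \<in> M. f e (Suc i) \<noteq> f e i} \<le> n * card M"
proof (rule ccontr)
  assume neg: "\<not> ?thesis"
  have "(\<Sum>i<N. card {e \<in> M. f e (Suc i) \<noteq> f e i}) = (\<Sum>e\<in>M. card {i. i < N \<and> f e (Suc i) \<noteq> f e i})"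
  proof -
    have "(\<Sum>i<N. card {e \<in> M. f e (Suc i) \<noteq> f e i}) = (\<Sum>i<N. \<Sum>e\<in>M. if f e (Suc i) \<noteq> f e i then 1 else 0)"
      using M by (simp add: sum.If_cases Int_def)
    also have "\<dots> = (\<Sum>e\<in>M. \<Sum>i<N. if f e (Suc i) \<noteq> f e i then 1 else 0)" by (rule sum.swap)
    also have "\<dots> = (\<Sum>e\<in>M. card {i. i < N \<and> f e (Suc i) \<noteq> f e i})" by (simp add: sum.If_cases Int_def)
    finally show ?thesis .
  qed
  also have "\<dots> \<le> (\<Sum>e\<in>M. n)"
  proof (rule sum_mono)
    fix e assume e: "e \<in> M"
    show "card {i. i < N \<and> f e (Suc i) \<noteq> f e i} \<le> n"
      using card_drops_le[of "f e" N, OF mono[OF e]] n[OF e] by linarith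
  qed
  also have "\<dots> = n * card M" by simp
  finally have le: "N * (\<Sum>i<N. card {e \<in> M. f e (Suc i) \<noteq> f e i}) \<le> N * (n * card M)" by simp
  have "(\<Sum>i<N. n * card M) < (\<Sum>i<N. N * card {e \<in> M. f e (Suc i) \<noteq> f e i})"
    using neg N by (intro sum_strict_mono) (auto simp: not_le)
  also have "\<dots> = N * (\<Sum>i<N. card {e \<in> M. f e (Suc i) \<noteq> f e i})" by (simp add: sum_distrib_left)
  finally show False using le by simp
qed

locale blobs =
  fixes V :: "nat set" and E :: "nat \<Rightarrow> nat \<Rightarrow> bool" and c :: "nat \<Rightarrow> nat"
    and G :: "'a set set" and W :: "'a set" and p :: real and J :: "nat \<Rightarrow> nat \<Rightarrow> bool \<Rightarrow> 'a set set"
    and B :: "nat \<Rightarrow> 'a set"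
  assumes finV: "finite V" and symE: "\<And>x y. E x y \<Longrightarrow> E y x" and EV: "\<And>x y. E x y \<Longrightarrow> x \<in> V"
    and c1: "\<And>x y. E x y \<Longrightarrow> c x \<noteq> c y" and c2: "\<And>x y z. E x y \<Longrightarrow> E x z \<Longrightarrow> y \<noteq> z \<Longrightarrow> c y \<noteq> c z"
    and finW: "finite W" and p0: "0 \<le> p"
    and BW: "\<And>x. x \<in> V \<Longrightarrow> B x \<subseteq> W" and Bdisj: "\<And>x y. E x y \<Longrightarrow> B x \<inter> B y = {}"
    and Jcover: "\<And>x y a b. E x y \<Longrightarrow> a \<in> B x \<Longrightarrow> b \<in> B y \<Longrightarrow> {a, b} \<in> G \<Longrightarrow> {a, b} \<in> J x y True \<or> {a, b} \<in> J x y False"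
begin

lemma EV2: "E x y \<Longrightarrow> y \<in> V" using EV symE by blast

text \<open>Edges with a fixed pair of colours form a matching, so a blob is shrunk on behalf of at
  most one of them. One scale is chosen for the whole matching, which keeps all blobs at a common
  size \<open>t'\<close>; the endpoints of the few edges that are unstable at this scale form
  \<open>D\<close>.\<close>

lemma regularise_class:
  assumes \<delta>: "0 < \<delta>" "\<delta> \<le> 1" and n: "4 \<le> \<delta>\<^sup>2 * real n" and N: "0 < N"
    and bad: "2 * real n \<le> \<xi> * real N"
    and X: "\<And>x. x \<in> V \<Longrightarrow> X x \<subseteq> B x" "\<And>x. x \<in> V \<Longrightarrow> card (X x) = t" and t: "1 \<le> (\<delta>\<^sup>2 / 16) ^ N * real t"
    and host: "host_dense G W z p" "z \<le> \<delta> * (\<delta>\<^sup>2 / 16) ^ N * real t"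
  shows "\<exists>X' t' D. (\<forall>x\<in>V. X' x \<subseteq> X x \<and> card (X' x) = t') \<and> (\<delta>\<^sup>2 / 16) ^ N * real t \<le> real t' \<and>
    D \<subseteq> V \<and> real (card D) \<le> \<xi> * real (card V) \<and>
    (\<forall>x\<in>V - D. \<forall>y\<in>V - D. E x y \<longrightarrow> c x = i0 \<longrightarrow> c y = j0 \<longrightarrow>
       (\<exists>b. dense_pair (J x y b) (\<delta> * real t') (p / 8) (X' x) (X' y)))"
proof -
  let ?r = "\<delta>\<^sup>2 / 16"
  have eps: "0 < ?r" "?r \<le> 1" using \<delta> power_le_one[of \<delta> 2] by auto
  \<comment> \<open>The ratio \<open>\<delta>\<^sup>2 / 16\<close> is half of what a stable pair
    requires, since rounding up a number that is at least one can double it.\<close>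
  define s where "s i = nat \<lceil>?r ^ i * real t\<rceil>" for i
  have s_ge: "?r ^ i * real t \<le> real (s i)" for i unfolding s_def by (rule real_nat_ceiling_ge)
  have pw: "1 \<le> ?r ^ i * real t" "?r ^ N * real t \<le> ?r ^ i * real t" if "i \<le> N" for i
  proof -
    show "?r ^ N * real t \<le> ?r ^ i * real t" 
      using power_decreasing[OF that less_imp_le[OF eps(1)] eps(2)] by (intro mult_right_mono) auto
    then show "1 \<le> ?r ^ i * real t" using t by linarith
  qed
  have s_le: "real (s i) \<le> ?r ^ i * real t + 1" for i
  proof -
    have "0 \<le> ?r ^ i * real t" using eps by simp
    then show ?thesis unfolding s_def by linarith
  qed
  have s_pos: "0 < s i" if "i \<le> N" for i
    using s_ge[of i] pw(1)[OF that] by (cases "s i") auto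
  have s_next: "real (s (Suc i)) \<le> \<delta>\<^sup>2 / 8 * real (s i)" if "Suc i \<le> N" for i
  proof -
    have "real (s (Suc i)) \<le> 2 * (?r ^ Suc i * real t)" using s_le[of "Suc i"] pw(1)[OF that] by linarith
    also have "\<dots> = \<delta>\<^sup>2 / 8 * (?r ^ i * real t)" by simp
    also have "\<dots> \<le> \<delta>\<^sup>2 / 8 * real (s i)" using s_ge[of i] by (intro mult_left_mono) auto
    finally show ?thesis .
  qed
  have s_mono: "s (Suc i) \<le> s i" for i
  proof -
    have "?r * (?r ^ i * real t) \<le> 1 * (?r ^ i * real t)" using eps by (intro mult_right_mono) auto
    then show ?thesis unfolding s_def by (intro nat_mono ceiling_mono) (simp add: mult.assoc)
  qed
  have s_t: "s i \<le> t" for i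
  proof -
    have "?r ^ i * real t \<le> 1 * real t" using eps by (intro mult_right_mono power_le_one) auto
    then have "\<lceil>?r ^ i * real t\<rceil> \<le> int t" by (simp add: ceiling_le_iff)
    then show ?thesis unfolding s_def by linarith
  qed
  have finX: "finite (X x)" if "x \<in> V" for x
    using finite_subset[OF order_trans[OF X(1)[OF that] BW[OF that]] finW] .
  define M where "M = {(x, y). E x y \<and> c x = i0 \<and> c y = j0}"
  have MV: "M \<subseteq> V \<times> V" using EV EV2 by (auto simp: M_def)
  have finM: "finite M" by (rule finite_subset[OF MV]) (use finV in auto)
  have uniq1: "y = y'" if "(x, y) \<in> M" "(x, y') \<in> M" for x y y' using that c2 by (auto simp: M_def)
  have uniq2: "x = x'" if "(x, y) \<in> M" "(x', y) \<in> M" for x x' y using that c2 symE unfolding M_def by blast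
  have apart: False if "(x, y) \<in> M" "(y, z) \<in> M" for x y z using that c1[of x y] by (simp add: M_def)
  have cM: "card M \<le> card V"
  proof -
    have "inj_on fst M" using uniq1 by (auto intro!: inj_onI)
    moreover have "fst ` M \<subseteq> V" using MV by auto
    ultimately show ?thesis using finV by (rule card_inj_on_le)
  qed
  \<comment> \<open>Freezing the scale at \<open>N\<close> makes \<open>lev\<close> nonincreasing
    for all indices, as the averaging over scales expects.\<close>
  define lev where "lev e i = level (J (fst e) (snd e) True) p n (X (fst e)) (X (snd e)) (s (min i N))" for e i
  have "\<exists>i<N. N * card {e \<in> M. lev e (Suc i) \<noteq> lev e i} \<le> n * card M"
  proof (rule few_unstable_scale[OF finM _ _ N])
    show "lev e (Suc i) \<le> lev e i" if "e \<in> M" for e i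
    proof (cases "Suc i \<le> N")
      case True
      have "fst e \<in> V" "snd e \<in> V" using that MV by auto
      then show ?thesis unfolding lev_def using True s_pos[OF True] s_mono[of i] finX
        by (simp add: min_def) (rule level_mono; simp)
    next
      case False
      then have "min (Suc i) N = N" "min i N = N" by auto
      then show ?thesis by (simp add: lev_def)
    qed
    show "lev e 0 \<le> n" for e unfolding lev_def by (rule level_le)
  qed
  then obtain i where i: "i < N" "N * card {e \<in> M. lev e (Suc i) \<noteq> lev e i} \<le> n * card M" by blast
  define U where "U = {e \<in> M. lev e (Suc i) \<noteq> lev e i}"
  define D where "D = fst ` U \<union> snd ` U"
  have finU: "finite U" using finM by (simp add: U_def)
  have DV: "D \<subseteq> V" using MV by (auto simp: D_def U_def)
  have "card D \<le> card (fst ` U) + card (snd ` U)" unfolding D_def by (rule card_Un_le)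
  also have "\<dots> \<le> card U + card U" using finU by (intro add_mono card_image_le)
  finally have "N * card D \<le> 2 * (N * card U)" by (simp add: mult_left_mono[of _ _ N])
  also have "\<dots> \<le> 2 * (n * card V)" 
    using order_trans[OF i(2) mult_le_mono2[OF cM]] unfolding U_def by (rule mult_le_mono2)
  finally have "real (N * card D) \<le> real (2 * (n * card V))" by (rule of_nat_mono)
  then have "real N * real (card D) \<le> (2 * real n) * real (card V)" by simp
  also have "\<dots> \<le> (\<xi> * real N) * real (card V)" using bad by (intro mult_right_mono) auto
  finally have cD: "real (card D) \<le> \<xi> * real (card V)" using N by (simp add: mult_ac)
  let ?good = "\<lambda>x y A A'. A \<subseteq> X x \<and> A' \<subseteq> X y \<and> card A = s i \<and> card A' = s i \<and>
      (\<exists>b. dense_pair (J x y b) (\<delta> * real (s i)) (p / 8) A A')"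
  have good: "\<exists>A A'. ?good x y A A'" if xy: "(x, y) \<in> M - U" for x y
  proof -
    have xV: "x \<in> V" "y \<in> V" "E x y" using xy MV by (auto simp: M_def)
    have st: "level (J x y True) p n (X x) (X y) (s (Suc i)) = level (J x y True) p n (X x) (X y) (s i)"
      using xy i(1) by (simp add: U_def lev_def min_def)
    have "z \<le> \<delta> * real (s i)"
    proof -
      have "\<delta> * (?r ^ N * real t) \<le> \<delta> * real (s i)"
        using pw(2)[of i] s_ge[of i] i(1) \<delta> by (intro mult_left_mono) auto
      then show ?thesis using host(2) by (simp add: mult.assoc)
    qed
    then have "\<exists>A\<subseteq>X x. \<exists>B\<subseteq>X y. card A = s i \<and> card B = s i \<and>
        (dense_pair (J x y True) (\<delta> * real (s i)) (p / 8) A B \<or> dense_pair (J x y False) (\<delta> * real (s i)) (p / 8) A B)"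
    proof (intro stable_level_good[OF finW _ _ _ host(1) p0 _ \<delta> n s_pos s_next _ _ _ st])
      show "X x \<subseteq> W" "X y \<subseteq> W" using X(1) BW xV by (meson order_trans)+
      show "X x \<inter> X y = {}" using X(1)[OF xV(1)] X(1)[OF xV(2)] Bdisj[OF xV(3)] by blast
      show "{a, b} \<in> J x y True \<or> {a, b} \<in> J x y False" if "a \<in> X x" "b \<in> X y" "{a, b} \<in> G" for a b
        using Jcover[OF xV(3)] X(1)[OF xV(1)] X(1)[OF xV(2)] that by blast
      show "Suc i \<le> N" "Suc i \<le> N" using i(1) by simp_all
      show "s i \<le> card (X x)" "s i \<le> card (X y)" using X(2) xV s_t by simp_all
    qed
    then show ?thesis by blast
  qed
  define AA where "AA x y = (SOME P. ?good x y (fst P) (snd P))" for x y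
  have AA: "?good x y (fst (AA x y)) (snd (AA x y))" if xy: "(x, y) \<in> M - U" for x y
  proof -
    have "\<exists>P. ?good x y (fst P) (snd P)" using good[OF xy] by auto
    then show ?thesis unfolding AA_def by (rule someI_ex)
  qed
  \<comment> \<open>A vertex that lies on no stable matching edge receives an arbitrary subset of
    the right size, so that all blobs stay equally large.\<close>
  have "\<exists>A. A \<subseteq> X v \<and> card A = s i \<and> (\<forall>y. (v, y) \<in> M - U \<longrightarrow> A = fst (AA v y)) \<and> (\<forall>x. (x, v) \<in> M - U \<longrightarrow> A = snd (AA x v))"
    if v: "v \<in> V" for v
  proof -
    consider (a) y where "(v, y) \<in> M - U" | (b) x where "(x, v) \<in> M - U" | (c) "\<forall>y. (v, y) \<notin> M - U" "\<forall>x. (x, v) \<notin> M - U" by blast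
    then show ?thesis
    proof cases
      case a
      have u: "y' = y" if "(v, y') \<in> M - U" for y' using uniq1 that a by blast
      have no: "(x, v) \<notin> M - U" for x using apart a by blast
      show ?thesis by (rule exI[of _ "fst (AA v y)"]) (use AA[OF a] u no in auto)
    next
      case b
      have u: "x' = x" if "(x', v) \<in> M - U" for x' using uniq2 that b by blast
      have no: "(v, y) \<notin> M - U" for y using apart b by blast
      show ?thesis by (rule exI[of _ "snd (AA x v)"]) (use AA[OF b] u no in auto)
    next
      case c
      have "s i \<le> card (X v)" using X(2)[OF v] s_t by simp
      then obtain A where "A \<subseteq> X v" "card A = s i" by (rule obtain_subset_with_card_n)
      then show ?thesis using c by blast
    qed
  qed
  then have "\<forall>v\<in>V. \<exists>A. A \<subseteq> X v \<and> card A = s i \<and> (\<forall>y. (v, y) \<in> M - U \<longrightarrow> A = fst (AA v y)) \<and> (\<forall>x. (x, v) \<in> M - U \<longrightarrow> A = snd (AA x v))"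
    by blast
  from bchoice[OF this] obtain X' where X'0: "\<forall>v\<in>V. X' v \<subseteq> X v \<and> card (X' v) = s i \<and>
      (\<forall>y. (v, y) \<in> M - U \<longrightarrow> X' v = fst (AA v y)) \<and> (\<forall>x. (x, v) \<in> M - U \<longrightarrow> X' v = snd (AA x v))" ..
  have X': "X' v \<subseteq> X v" "card (X' v) = s i" if "v \<in> V" for v
    using bspec[OF X'0 that] by simp_all
  have X'M: "X' v = fst (AA v y)" if "v \<in> V" "(v, y) \<in> M - U" for v y
    using bspec[OF X'0 that(1)] that(2) by blast
  have X'M2: "X' v = snd (AA x v)" if "v \<in> V" "(x, v) \<in> M - U" for x v
    using bspec[OF X'0 that(1)] that(2) by blast
  have "\<exists>b. dense_pair (J x y b) (\<delta> * real (s i)) (p / 8) (X' x) (X' y)"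
    if xy: "x \<in> V - D" "y \<in> V - D" "E x y" "c x = i0" "c y = j0" for x y
  proof -
    have "(x, y) \<in> M" using xy by (simp add: M_def)
    moreover have "(x, y) \<notin> U" using xy(1) by (force simp: D_def)
    ultimately have m: "(x, y) \<in> M - U" by simp
    have "X' x = fst (AA x y)" "X' y = snd (AA x y)" using X'M[OF _ m] X'M2[OF _ m] xy by simp_all
    then show ?thesis using AA[OF m] by simp
  qed
  moreover have "?r ^ N * real t \<le> real (s i)" using pw(2)[of i] s_ge[of i] i(1) by simp
  ultimately show ?thesis using X' DV cD
    by (intro exI[of _ X'] exI[of _ "s i"] exI[of _ D] conjI) simp_all
qed

end

text \<open>The density scale used for a class has to be small compared with the shrinking caused by the
  classes that are processed after it.\<close>

lemma regularise:
  fixes cs :: "(nat \<times> nat) list"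
  assumes \<delta>: "0 < \<delta>" "\<delta> \<le> 1" and \<xi>: "0 < \<xi>"
  shows "\<exists>\<nu> :: real. 0 < \<nu> \<and> \<nu> \<le> 1 \<and> (\<forall>V E c (G :: 'a set set) W p J B X t z. blobs V E c G W p J B \<longrightarrow>
    (\<forall>x\<in>V. X x \<subseteq> B x \<and> card (X x) = t) \<longrightarrow> 1 \<le> \<nu> * real t \<longrightarrow> host_dense G W z p \<longrightarrow> z \<le> \<delta> * \<nu> * real t \<longrightarrow>
    (\<exists>X' t' D. (\<forall>x\<in>V. X' x \<subseteq> X x \<and> card (X' x) = t') \<and> \<nu> * real t \<le> real t' \<and>
      D \<subseteq> V \<and> real (card D) \<le> \<xi> * real (card V) \<and>
      (\<forall>x\<in>V - D. \<forall>y\<in>V - D. E x y \<longrightarrow> (c x, c y) \<in> set cs \<longrightarrow>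
        (\<exists>b. dense_pair (J x y b) (\<delta> * real t') (p / 8) (X' x) (X' y)))))"
  using \<xi>
proof (induction cs arbitrary: \<xi>)
  case Nil
  show ?case
  proof (intro exI[of _ 1] conjI allI impI)
    fix V E c W p B t z and G :: "'a set set" and J and X :: "nat \<Rightarrow> 'a set"
    assume "\<forall>x\<in>V. X x \<subseteq> B x \<and> card (X x) = t"
    then show "\<exists>X' t' D. (\<forall>x\<in>V. X' x \<subseteq> X x \<and> card (X' x) = t') \<and> 1 * real t \<le> real t' \<and>
      D \<subseteq> V \<and> real (card D) \<le> \<xi> * real (card V) \<and>
      (\<forall>x\<in>V - D. \<forall>y\<in>V - D. E x y \<longrightarrow> (c x, c y) \<in> set [] \<longrightarrow>
        (\<exists>b. dense_pair (J x y b) (\<delta> * real t') (p / 8) (X' x) (X' y)))"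
      using Nil by (intro exI[of _ X] exI[of _ t] exI[of _ "{}"]) auto
  qed auto
next
  case (Cons c0 cs)
  obtain \<nu> where \<nu>: "0 < \<nu>" "\<nu> \<le> 1" and IH: "\<And>V E c (G :: 'a set set) W p J B X t z. blobs V E c G W p J B \<Longrightarrow>
    (\<forall>x\<in>V. X x \<subseteq> B x \<and> card (X x) = t) \<Longrightarrow> 1 \<le> \<nu> * real t \<Longrightarrow> host_dense G W z p \<Longrightarrow> z \<le> \<delta> * \<nu> * real t \<Longrightarrow>
    (\<exists>X' t' D. (\<forall>x\<in>V. X' x \<subseteq> X x \<and> card (X' x) = t') \<and> \<nu> * real t \<le> real t' \<and>
      D \<subseteq> V \<and> real (card D) \<le> \<xi> / 2 * real (card V) \<and>
      (\<forall>x\<in>V - D. \<forall>y\<in>V - D. E x y \<longrightarrow> (c x, c y) \<in> set cs \<longrightarrow>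
        (\<exists>b. dense_pair (J x y b) (\<delta> * real t') (p / 8) (X' x) (X' y))))"
    using Cons.IH[of "\<xi> / 2"] Cons.prems by auto
  define \<delta>0 where "\<delta>0 = \<delta> * \<nu>"
  have \<delta>0: "0 < \<delta>0" "\<delta>0 \<le> 1" using \<delta> \<nu> by (auto simp: \<delta>0_def intro: mult_le_one)
  \<comment> \<open>\<open>n\<close> makes one density step at most
    \<open>\<delta>0\<^sup>2 / 16 * p\<close>; \<open>N\<close> is then large enough for the
    unstable edges of this class, with two endpoints each, to spoil at most a proportion
    \<open>\<xi> / 2\<close> of \<open>V\<close>.\<close>
  define n where "n = nat \<lceil>4 / \<delta>0\<^sup>2\<rceil>"
  have "4 / \<delta>0\<^sup>2 \<le> real n" unfolding n_def by (rule real_nat_ceiling_ge)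
  then have n: "4 \<le> \<delta>0\<^sup>2 * real n" using \<delta>0 by (simp add: field_simps)
  define N where "N = nat \<lceil>4 * real n / \<xi>\<rceil> + 1"
  have "4 * real n / \<xi> \<le> real N" unfolding N_def using real_nat_ceiling_ge[of "4 * real n / \<xi>"] by simp
  then have bad: "2 * real n \<le> \<xi> / 2 * real N" using Cons.prems by (simp add: field_simps)
  have N: "0 < N" by (simp add: N_def)
  define \<nu>0 where "\<nu>0 = (\<delta>0\<^sup>2 / 16) ^ N"
  have \<nu>0: "0 < \<nu>0" "\<nu>0 \<le> 1"
  proof -
    show "0 < \<nu>0" using \<delta>0 by (simp add: \<nu>0_def)
    have "\<delta>0\<^sup>2 \<le> 1" using \<delta>0 by (simp add: power_le_one)
    then show "\<nu>0 \<le> 1" unfolding \<nu>0_def by (intro power_le_one) auto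
  qed
  show ?case
  proof (intro exI[of _ "\<nu>0 * \<nu>"] conjI allI impI)
    show "0 < \<nu>0 * \<nu>" "\<nu>0 * \<nu> \<le> 1" using \<nu> \<nu>0 by (auto intro: mult_le_one)
    fix V E c W p B t z and G :: "'a set set" and J and X :: "nat \<Rightarrow> 'a set"
    assume bl: "blobs V E c G W p J B" and X: "\<forall>x\<in>V. X x \<subseteq> B x \<and> card (X x) = t"
      and t: "1 \<le> \<nu>0 * \<nu> * real t" and host: "host_dense G W z p" "z \<le> \<delta> * (\<nu>0 * \<nu>) * real t"
    have t0: "1 \<le> \<nu>0 * real t"
    proof -
      have "\<nu> * (\<nu>0 * real t) \<le> 1 * (\<nu>0 * real t)" using \<nu> \<nu>0 by (intro mult_right_mono) auto
      then show ?thesis using t by (simp add: mult_ac)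
    qed
    have z0: "z \<le> \<delta>0 * \<nu>0 * real t" using host(2) by (simp add: \<delta>0_def mult_ac)
    obtain X1 t1 D1 where X1: "\<forall>x\<in>V. X1 x \<subseteq> X x \<and> card (X1 x) = t1" "\<nu>0 * real t \<le> real t1"
      "D1 \<subseteq> V" "real (card D1) \<le> \<xi> / 2 * real (card V)"
      "\<forall>x\<in>V - D1. \<forall>y\<in>V - D1. E x y \<longrightarrow> c x = fst c0 \<longrightarrow> c y = snd c0 \<longrightarrow>
       (\<exists>b. dense_pair (J x y b) (\<delta>0 * real t1) (p / 8) (X1 x) (X1 y))"
      using blobs.regularise_class[OF bl \<delta>0 n N bad, of X t z "fst c0" "snd c0"] X t0 host(1) z0
      unfolding \<nu>0_def by blast
    have X1B: "\<forall>x\<in>V. X1 x \<subseteq> B x \<and> card (X1 x) = t1" using X X1(1) by blast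
    have t1: "1 \<le> \<nu> * real t1"
    proof -
      have "\<nu> * (\<nu>0 * real t) \<le> \<nu> * real t1" using X1(2) \<nu> by (intro mult_left_mono) auto
      then show ?thesis using t by (simp add: mult_ac)
    qed
    have z1: "z \<le> \<delta> * \<nu> * real t1"
    proof -
      have "\<delta> * \<nu> * (\<nu>0 * real t) \<le> \<delta> * \<nu> * real t1" using X1(2) \<nu> \<delta> by (intro mult_left_mono) auto
      then show ?thesis using host(2) by (simp add: mult_ac)
    qed
    obtain X2 t2 D2 where X2: "\<forall>x\<in>V. X2 x \<subseteq> X1 x \<and> card (X2 x) = t2" "\<nu> * real t1 \<le> real t2"
      "D2 \<subseteq> V" "real (card D2) \<le> \<xi> / 2 * real (card V)"
      "\<forall>x\<in>V - D2. \<forall>y\<in>V - D2. E x y \<longrightarrow> (c x, c y) \<in> set cs \<longrightarrow>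
        (\<exists>b. dense_pair (J x y b) (\<delta> * real t2) (p / 8) (X2 x) (X2 y))"
      using IH[OF bl X1B t1 host(1) z1] by blast
    have "\<exists>b. dense_pair (J x y b) (\<delta> * real t2) (p / 8) (X2 x) (X2 y)"
      if xy: "x \<in> V - (D1 \<union> D2)" "y \<in> V - (D1 \<union> D2)" "E x y" "(c x, c y) \<in> set (c0 # cs)" for x y
    proof (cases "(c x, c y) \<in> set cs")
      case True
      then show ?thesis using X2(5) xy by blast
    next
      case False
      then have "c x = fst c0" "c y = snd c0" using xy(4) by auto
      then obtain b where b: "dense_pair (J x y b) (\<delta>0 * real t1) (p / 8) (X1 x) (X1 y)"
        using X1(5) xy by blast
      have "\<delta>0 * real t1 \<le> \<delta> * real t2"
        using mult_left_mono[OF X2(2), of \<delta>] \<delta> by (simp add: \<delta>0_def mult.assoc)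
      then have "dense_pair (J x y b) (\<delta> * real t2) (p / 8) (X2 x) (X2 y)"
        using X2(1) xy by (intro dense_pair_subset[OF b]) auto
      then show ?thesis by blast
    qed
    moreover have "\<nu>0 * \<nu> * real t \<le> real t2"
    proof -
      have "\<nu> * (\<nu>0 * real t) \<le> \<nu> * real t1" using X1(2) \<nu> by (intro mult_left_mono) auto
      then show ?thesis using X2(2) by (simp add: mult_ac)
    qed
    moreover have "real (card (D1 \<union> D2)) \<le> \<xi> * real (card V)"
    proof -
      have "real (card (D1 \<union> D2)) \<le> real (card D1) + real (card D2)"
        using card_Un_le[of D1 D2] by (simp flip: of_nat_add)
      then show ?thesis using X1(4) X2(4) by (simp add: field_simps)
    qed
    moreover have "\<forall>x\<in>V. X2 x \<subseteq> X x \<and> card (X2 x) = t2" using X1(1) X2(1) by blast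
    ultimately show "\<exists>X' t' D. (\<forall>x\<in>V. X' x \<subseteq> X x \<and> card (X' x) = t') \<and> \<nu>0 * \<nu> * real t \<le> real t' \<and>
      D \<subseteq> V \<and> real (card D) \<le> \<xi> * real (card V) \<and>
      (\<forall>x\<in>V - D. \<forall>y\<in>V - D. E x y \<longrightarrow> (c x, c y) \<in> set (c0 # cs) \<longrightarrow>
        (\<exists>b. dense_pair (J x y b) (\<delta> * real t') (p / 8) (X' x) (X' y)))"
      using X1(3) X2(3) by (intro exI[of _ X2] exI[of _ t2] exI[of _ "D1 \<union> D2"]) blast
  qed
qed

subsection \<open>The random host\<close>

text \<open>Chosen so small that the decay \<open>(2 * sqrt u) ^ (m * g)\<close> of the counting bound beats the
  \<open>exp (O(h\<^sup>2 / q))\<close> choices of \<open>J\<close> weighted by their probability.\<close>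

definition \<theta> :: real where "\<theta> = exp (- 16408)"
definition \<delta> :: real where "\<delta> = exp (- 393246)"

text \<open>\<open>m\<close> is the unit of list sizes. A vertex with density
  \<open>1 / (8 * q)\<close> towards \<open>h / 2\<close> candidates has
  \<open>h / (16 * q) \<ge> 256 * m\<close> of them as neighbours, whence
  \<open>4096 = 16 * 256\<close>. In a list of \<open>256 * m\<close>, fewer than
  \<open>64 * m\<close> are occupied and fewer than \<open>32 * m\<close> flooded, which leaves more
  than the \<open>2 * (32 * m)\<close> needed for linking. The value of \<open>g\<close> grants each
  of two kinds of exceptional vertices at most an eighth of a blob half.\<close>

definition host_at :: "'a set set \<Rightarrow> 'a set \<Rightarrow> nat \<Rightarrow> nat \<Rightarrow> nat \<Rightarrow> bool" where
  "host_at G W k q h \<longleftrightarrow> (let m = h div (4096 * q); g = h div 8 + 1 in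
     few_flooded G W k (64 * m) (32 * m) \<and>
     lists_cover G W h (1 / (8 * real q)) (\<delta> * real h) (\<theta> * real h) m g \<and>
     lists_linked G W h (256 * m) (32 * m) 16 (2 * \<theta> * real h) g)"

lemma theta_delta: "0 < \<theta>" "\<theta> \<le> 1 / 16" "0 < \<delta>" "\<delta> \<le> \<theta>"
proof -
  have "exp 4 \<ge> (16::real)"
  proof -
    have "(2::real) ^ 4 \<le> exp 1 ^ 4" using exp_ge_add_one_self[of "1::real"] by (intro power_mono) auto
    then show ?thesis using exp_of_nat_mult[of 4 "1::real"] by simp
  qed
  then have "exp (- 4) \<le> (1 / 16 :: real)" by (simp add: exp_minus field_simps)
  moreover have "\<theta> \<le> exp (- 4)" unfolding \<theta>_def by simp
  ultimately show "\<theta> \<le> 1 / 16" by linarith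
qed (simp_all add: \<theta>_def \<delta>_def)

lemma two_power_le_exp: "(2::real) ^ n \<le> exp (real n)"
proof -
  have "(2::real) ^ n \<le> exp 1 ^ n" using exp_ge_add_one_self[of "1::real"] by (intro power_mono) auto
  then show ?thesis by (simp add: exp_of_nat_mult[symmetric])
qed

lemma power_le_exp:
  assumes "0 \<le> y" "y \<le> exp (- a)" "0 \<le> a" "r \<le> real n"
  shows "y ^ n \<le> exp (- (a * r))"
proof -
  have "y ^ n \<le> exp (- a) ^ n" using assms by (intro power_mono) auto
  also have "\<dots> = exp (- (a * real n))" by (simp add: exp_of_nat_mult[symmetric] mult.commute)
  also have "\<dots> \<le> exp (- (a * r))" using assms by (simp add: mult_left_mono)
  finally show ?thesis .
qed

section \<open>Numerical estimates for the three failure bounds\<close>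

context
  fixes C q w h :: nat and \<sigma> :: real
  assumes \<sigma>: "0 < \<sigma>" "\<sigma> \<le> 1" and C: "131072 \<le> \<sigma> ^ 2 * \<theta> * real C"
    and q: "24 \<le> q" and w: "w = C * q ^ 2" and h: "\<sigma> * real w \<le> real h" "h \<le> w"
begin

private definition m where "m = h div (4096 * q)"
private definition g where "g = h div 8 + 1"

private lemma qpos: "0 < real q" using q by simp

private lemma Cs: "131072 \<le> \<sigma> ^ 2 * real C" "131072 \<le> \<sigma> * \<theta> * real C" "131072 \<le> \<sigma> * real C" "131072 \<le> real C"
proof -
  have *: "x * y \<le> y" if "x \<le> 1" "0 \<le> y" for x y :: real
    using mult_right_mono[OF that] by simp
  show 1: "131072 \<le> \<sigma> ^ 2 * real C"
    using C *[of \<theta> "\<sigma> ^ 2 * real C"] theta_delta by (simp add: mult_ac)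
  show 2: "131072 \<le> \<sigma> * \<theta> * real C"
  proof -
    have "\<sigma> * (\<sigma> * \<theta> * real C) \<le> \<sigma> * \<theta> * real C" using \<sigma> theta_delta by (intro *) auto
    moreover have "\<sigma> ^ 2 * \<theta> * real C = \<sigma> * (\<sigma> * \<theta> * real C)" by (simp add: power2_eq_square)
    ultimately show ?thesis using C by linarith
  qed
  show 3: "131072 \<le> \<sigma> * real C"
  proof -
    have "\<theta> * (\<sigma> * real C) \<le> \<sigma> * real C" using \<sigma> theta_delta by (intro *) auto
    moreover have "\<sigma> * \<theta> * real C = \<theta> * (\<sigma> * real C)" by simp
    ultimately show ?thesis using 2 by linarith
  qed
  show "131072 \<le> real C"
    using 3 *[of \<sigma> "real C"] \<sigma> by linarith
qed

private lemma wreal: "real w = real C * real q * real q"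
  by (simp add: w power2_eq_square)

private lemma hq: "131072 * real q \<le> real h" "\<sigma> * real C * real q \<le> real h / real q"
proof -
  have "\<sigma> * real C * real q * real q \<le> real h" using h wreal by (simp add: mult_ac)
  then show *: "\<sigma> * real C * real q \<le> real h / real q" using qpos by (simp add: field_simps)
  have "131072 * 1 \<le> \<sigma> * real C * real q" using Cs q \<sigma> by (intro mult_mono) auto
  then have "131072 \<le> real h / real q" using * by simp
  then show "131072 * real q \<le> real h" using qpos by (simp add: field_simps)
qed

private lemma mbounds: "0 < m" "real h / (8192 * real q) \<le> real m" "4096 * real q * real m \<le> real h"
proof -
  have "4096 * q * m \<le> h" unfolding m_def by (simp add: mult.commute)
  then have "real (4096 * q * m) \<le> real h" by (rule of_nat_mono)
  then show "4096 * real q * real m \<le> real h" by simp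
  have "h < 4096 * q * (m + 1)" unfolding m_def using q
    by (metis Suc_eq_plus1 dividend_less_times_div mult_pos_pos mult_Suc_right zero_less_numeral less_le_trans add.commute)
  then have "real h < real (4096 * q * (m + 1))" by (rule of_nat_less_iff[THEN iffD2])
  then have lt: "real h < 4096 * real q * real m + 4096 * real q" by (simp add: algebra_simps)
  then have "real h \<le> 8192 * real q * real m" using hq(1) by linarith
  then show "real h / (8192 * real q) \<le> real m" using qpos by (simp add: field_simps)
  show "0 < m"
  proof (rule ccontr)
    assume "\<not> 0 < m"
    then show False using lt hq(1) by auto
  qed
qed

private lemma sCq: "\<sigma> * real C * real q \<le> 8192 * real m"
proof -
  have "real h / real q \<le> 8192 * real m" using mbounds(2) qpos by (simp add: field_simps)
  then show ?thesis using hq(2) by linarith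
qed

private lemma gbounds: "real h / 8 \<le> real g"
proof -
  have "h \<le> 8 * g" unfolding g_def by (simp add: dividend_less_times_div[THEN less_imp_le])
  then have "real h \<le> real (8 * g)" by (rule of_nat_mono)
  then show ?thesis by simp
qed

private lemma hm: "real h / (real m * real q) \<le> 8192" "0 \<le> real h / (real m * real q)"
  using mbounds qpos by (auto simp: field_simps)

private lemma h2: "131072 * real w \<le> (real h)\<^sup>2 / real q"
proof -
  have "\<sigma>\<^sup>2 * (real w)\<^sup>2 \<le> (real h)\<^sup>2"
    using h(1) \<sigma> by (metis power_mult_distrib power_mono mult_nonneg_nonneg of_nat_0_le_iff less_imp_le)
  then have "\<sigma>\<^sup>2 * (real w)\<^sup>2 / real q \<le> (real h)\<^sup>2 / real q" using qpos by (intro divide_right_mono) auto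
  moreover have "131072 * real w \<le> \<sigma>\<^sup>2 * (real w)\<^sup>2 / real q"
  proof -
    have "131072 * real w * real q \<le> (\<sigma>\<^sup>2 * real C) * real w * real q * 1"
      using Cs by (simp add: mult_right_mono)
    also have "\<dots> \<le> (\<sigma>\<^sup>2 * real C) * real w * real q * real q" using q by (intro mult_left_mono) auto
    also have "\<dots> = \<sigma>\<^sup>2 * (real w)\<^sup>2" by (simp add: wreal power2_eq_square)
    finally show ?thesis using qpos by (simp add: field_simps)
  qed
  ultimately show ?thesis by linarith
qed

private lemma p_power: "(1 + 1 / real q) ^ n \<le> exp (real n / real q)"
proof -
  have "(1 + 1 / real q) ^ n \<le> exp (1 / real q) ^ n"
    using exp_ge_add_one_self[of "1 / real q"] by (intro power_mono) auto
  then show ?thesis by (simp add: exp_of_nat_mult[symmetric])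
qed

private lemma mg: "(real h)\<^sup>2 / (65536 * real q) \<le> real (m * g)"
proof -
  have "real h / (8192 * real q) * (real h / 8) \<le> real m * real g"
    using mbounds gbounds by (intro mult_mono) auto
  then show ?thesis by (simp add: power2_eq_square field_simps)
qed

text \<open>Each of the \<open>64 * m * (32 * m)\<close> edges contributes a factor of at most
  \<open>exp (- 1)\<close>, so \<open>2048 * m\<^sup>2 \<ge> 3 * w\<close> is needed. As
  \<open>m\<close> is of order \<open>h / q\<close> and \<open>w = C * q\<^sup>2\<close>, both sides
  are of order \<open>q\<^sup>2\<close>, and a large \<open>C\<close> decides.\<close>

private lemma flooded_bound:
  assumes k: "real k \<le> \<sigma> * real w / 10000"
  shows "2 ^ w * (2 ^ w * ((exp 1 * real k / real (64 * m)) ^ (64 * m) * (1 / real q) ^ (64 * m)) ^ (32 * m)) \<le> exp (- real w)"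
proof -
  let ?y = "exp 1 * real k / real (64 * m) * (1 / real q)"
  have e3: "exp 1 \<le> (3::real)" by (rule exp_le)
  have e9: "exp 1 * exp 1 \<le> (9::real)" using mult_mono[OF e3 e3] by simp
  have "?y \<le> exp (- 1)"
  proof -
    have "real k \<le> real h / 10000" using k h(1) by simp
    also have "\<dots> \<le> 8192 * real q * real m / 10000" using mbounds qpos by (simp add: field_simps)
    finally have kk: "real k \<le> 8192 * real q * real m / 10000" .
    have "exp 1 * exp 1 * real k \<le> 9 * (8192 * real q * real m / 10000)"
      using e9 kk by (intro mult_mono) auto
    also have "\<dots> \<le> 64 * real m * real q" using mbounds qpos by (simp add: field_simps)
    finally show ?thesis using mbounds qpos by (simp add: exp_minus field_simps)
  qed
  then have "?y ^ (64 * m * (32 * m)) \<le> exp (- (1 * real (64 * m * (32 * m))))"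
    by (intro power_le_exp) auto
  also have "\<dots> \<le> exp (- (3 * real w))"
  proof -
    have "(real h)\<^sup>2 / (8192 * real q)\<^sup>2 \<le> (real m)\<^sup>2"
      using power_mono[OF mbounds(2), of 2] by (simp add: power_divide)
    then have "2048 * ((real h)\<^sup>2 / (8192 * real q)\<^sup>2) \<le> 2048 * (real m)\<^sup>2" by simp
    moreover have "3 * real w \<le> 2048 * ((real h)\<^sup>2 / (8192 * real q)\<^sup>2)"
    proof -
      have "\<sigma> * real C * real q * (\<sigma> * real C * real q) \<le> real h / real q * (real h / real q)"
        using hq(2) \<sigma> by (intro mult_mono) auto
      then have a: "\<sigma>\<^sup>2 * real C * real w \<le> (real h)\<^sup>2 / (real q)\<^sup>2"
        by (simp add: wreal power2_eq_square mult_ac)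
      have "131072 * real w \<le> \<sigma>\<^sup>2 * real C * real w" using Cs by (intro mult_right_mono) auto
      then show ?thesis using a by (simp add: power_mult_distrib)
    qed
    ultimately show ?thesis by (simp add: power2_eq_square)
  qed
  finally have y: "?y ^ (64 * m * (32 * m)) \<le> exp (- (3 * real w))" .
  have "2 ^ w * (2 ^ w * ((exp 1 * real k / real (64 * m)) ^ (64 * m) * (1 / real q) ^ (64 * m)) ^ (32 * m))
     = 2 ^ w * (2 ^ w * ?y ^ (64 * m * (32 * m)))"
    by (simp only: power_mult_distrib power_mult)
  also have "\<dots> \<le> exp (real w) * (exp (real w) * exp (- (3 * real w)))"
    using two_power_le_exp[of w] y by (intro mult_mono) auto
  also have "\<dots> = exp (- real w)" by (simp add: exp_add[symmetric])
  finally show ?thesis .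
qed

text \<open>Choosing \<open>J\<close> costs \<open>exp (h\<^sup>2 / q)\<close>. Since
  \<open>m * g \<ge> h\<^sup>2 / (65536 * q)\<close>, a factor \<open>exp (- 196608)\<close> per
  edge gains \<open>exp (- 3 * h\<^sup>2 / q)\<close>, as \<open>196608 = 3 * 65536\<close>; terms
  in \<open>w\<close> are negligible beside \<open>h\<^sup>2 / q\<close>. The exponent
  \<open>196623\<close> of \<open>sqrt \<delta>\<close> adds \<open>1\<close> for the factor
  \<open>exp 1\<close> and \<open>14\<close> for \<open>2 * 8192 = 2 ^ 14\<close>.\<close>

private lemma cover_bound:
  "4 ^ w * ((1 + 1 / real q) ^ (h * h) * 2 ^ w * ((exp 1 * (2 * sqrt (\<delta> * real h * real h)) / real m) ^ m * (1 / real q) ^ m) ^ g)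
    \<le> exp (- real w)"
proof -
  let ?y = "exp 1 * (2 * sqrt (\<delta> * real h * real h)) / real m * (1 / real q)"
  have "sqrt \<delta> = exp (- 196623)"
    unfolding \<delta>_def by (rule real_sqrt_unique) (simp_all add: power2_eq_square exp_add[symmetric])
  then have s: "sqrt (\<delta> * real h * real h) = exp (- 196623) * real h"
    by (simp add: real_sqrt_mult)
  have "?y = exp 1 * 2 * exp (- 196623) * (real h / (real m * real q))" unfolding s by simp
  also have "\<dots> \<le> exp 1 * 2 * exp (- 196623) * 8192" using hm by (intro mult_left_mono) auto
  also have "\<dots> = exp 1 * exp (- 196623) * 2 ^ 14" by simp
  also have "\<dots> \<le> exp 1 * exp (- 196623) * exp (real 14)" using two_power_le_exp[of 14] by (intro mult_left_mono) auto
  also have "\<dots> = exp (- 196608)" by (simp add: exp_add[symmetric])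
  finally have "?y \<le> exp (- 196608)" .
  then have "?y ^ (m * g) \<le> exp (- (196608 * ((real h)\<^sup>2 / (65536 * real q))))"
    using mg by (intro power_le_exp) (auto simp: \<delta>_def)
  also have "196608 * ((real h)\<^sup>2 / (65536 * real q)) = 3 * ((real h)\<^sup>2 / real q)" by simp
  finally have y: "?y ^ (m * g) \<le> exp (- (3 * ((real h)\<^sup>2 / real q)))" .
  have "4 ^ w * ((1 + 1 / real q) ^ (h * h) * 2 ^ w * ((exp 1 * (2 * sqrt (\<delta> * real h * real h)) / real m) ^ m * (1 / real q) ^ m) ^ g)
    = 2 ^ (2 * w) * ((1 + 1 / real q) ^ (h * h) * 2 ^ w * ?y ^ (m * g))"
    by (simp only: power_mult_distrib power_mult) simp
  also have "\<dots> \<le> exp (real (2 * w)) * (exp (real (h * h) / real q) * exp (real w) * exp (- (3 * ((real h)\<^sup>2 / real q))))"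
    using two_power_le_exp[of w] two_power_le_exp[of "2 * w"] p_power[of "h * h"] y by (intro mult_mono) (auto simp: \<delta>_def)
  also have "\<dots> = exp (3 * real w - 2 * ((real h)\<^sup>2 / real q))"
    by (simp add: exp_add[symmetric] power2_eq_square)
  also have "\<dots> \<le> exp (- real w)" using h2 by simp
  finally show ?thesis .
qed

text \<open>Choosing \<open>J\<close> costs \<open>exp (2 * h\<^sup>2 / q)\<close>, and the
  \<open>32 * m * g\<close> edges gain \<open>exp (- 4 * h\<^sup>2 / q)\<close> at a factor
  \<open>exp (- 8192)\<close> each. The exponent \<open>8204\<close> of \<open>sqrt \<theta>\<close>
  adds \<open>2\<close> for two factors \<open>exp 1\<close> and \<open>10\<close> for bounding
  \<open>sqrt 2 * 512\<close> by \<open>2 ^ 10\<close>.\<close>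

private lemma linked_bound:
  "8 ^ w * ((1 + 1 / real q) ^ (2 * h * h) * 2 ^ w *
     (real h * (exp 1 * (2 * sqrt (2 * \<theta> * real h * real h)) / real (32 * m)) ^ (32 * m) * (1 / real q) ^ (32 * m)) ^ g) \<le> exp (- real w)"
proof -
  let ?z = "exp 1 * (2 * sqrt (2 * \<theta> * real h * real h)) / real (32 * m) * (1 / real q)"
  let ?y = "exp 1 * ?z"
  \<comment> \<open>The factor \<open>h\<close> for the choice of a list is only quadratic in
    \<open>m\<close>, so it is absorbed by one more \<open>exp 1\<close> per edge, which is the
    difference between \<open>?y\<close> and \<open>?z\<close>.\<close>
  have hexp: "real h \<le> exp 1 ^ (32 * m)"
  proof -
    have "real h \<le> real w" using h by simp
    also have "\<dots> \<le> (32 * real m)\<^sup>2 / 2"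
    proof -
      have "(\<sigma> * real C * real q)\<^sup>2 \<le> (8192 * real m)\<^sup>2" using \<sigma> sCq by (intro power_mono) auto
      then have "(\<sigma>\<^sup>2 * real C) * real w \<le> (8192 * real m)\<^sup>2" by (simp add: wreal power2_eq_square mult_ac)
      moreover have "131072 * real w \<le> (\<sigma>\<^sup>2 * real C) * real w" using Cs by (intro mult_right_mono) auto
      ultimately show ?thesis by (simp add: power2_eq_square)
    qed
    also have "\<dots> \<le> exp (32 * real m)" using exp_lower_Taylor_quadratic[of "32 * real m"] by simp
    also have "\<dots> = exp 1 ^ (32 * m)" by (simp add: exp_of_nat_mult[symmetric])
    finally show ?thesis .
  qed
  have z0: "0 \<le> ?z" using theta_delta by auto
  have y0: "0 \<le> ?y" by (rule mult_nonneg_nonneg[OF _ z0]) simp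
  have "sqrt \<theta> = exp (- 8204)"
    unfolding \<theta>_def by (rule real_sqrt_unique) (simp_all add: power2_eq_square exp_add[symmetric])
  then have s: "sqrt (2 * \<theta> * real h * real h) = sqrt 2 * exp (- 8204) * real h"
    by (simp add: real_sqrt_mult)
  have "?y = exp 1 * exp 1 * (sqrt 2 * exp (- 8204) / 16) * (real h / (real m * real q))" unfolding s by (simp add: mult_ac)
  also have "\<dots> \<le> exp 1 * exp 1 * (sqrt 2 * exp (- 8204) / 16) * 8192" using hm by (intro mult_left_mono) auto
  also have "\<dots> = exp 1 * exp 1 * exp (- 8204) * (sqrt 2 * 512)" by simp
  also have "\<dots> \<le> exp 1 * exp 1 * exp (- 8204) * (2 ^ 10)" using sqrt2_less_2 by (intro mult_left_mono) auto
  also have "\<dots> \<le> exp 1 * exp 1 * exp (- 8204) * exp (real 10)" using two_power_le_exp[of 10] by (intro mult_left_mono) auto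
  also have "\<dots> = exp (- 8192)" by (simp add: exp_add[symmetric])
  finally have "?y \<le> exp (- 8192)" .
  moreover have "(real h)\<^sup>2 / (2048 * real q) \<le> real (32 * m * g)" using mg by simp
  ultimately have "?y ^ (32 * m * g) \<le> exp (- (8192 * ((real h)\<^sup>2 / (2048 * real q))))"
    by (intro power_le_exp y0) simp_all
  also have "8192 * ((real h)\<^sup>2 / (2048 * real q)) = 4 * ((real h)\<^sup>2 / real q)" by simp
  finally have y: "?y ^ (32 * m * g) \<le> exp (- (4 * ((real h)\<^sup>2 / real q)))" .
  have "real h * (exp 1 * (2 * sqrt (2 * \<theta> * real h * real h)) / real (32 * m)) ^ (32 * m) * (1 / real q) ^ (32 * m) = real h * ?z ^ (32 * m)"
    by (simp only: power_mult_distrib mult.assoc)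
  also have "\<dots> \<le> exp 1 ^ (32 * m) * ?z ^ (32 * m)" using hexp z0 by (intro mult_right_mono) auto
  also have "\<dots> = ?y ^ (32 * m)" by (simp only: power_mult_distrib)
  finally have "(real h * (exp 1 * (2 * sqrt (2 * \<theta> * real h * real h)) / real (32 * m)) ^ (32 * m) * (1 / real q) ^ (32 * m)) ^ g
      \<le> (?y ^ (32 * m)) ^ g"
    using theta_delta by (intro power_mono) auto
  also have "\<dots> = ?y ^ (32 * m * g)" by (simp only: power_mult)
  also note y
  finally have v: "(real h * (exp 1 * (2 * sqrt (2 * \<theta> * real h * real h)) / real (32 * m)) ^ (32 * m) * (1 / real q) ^ (32 * m)) ^ g
     \<le> exp (- (4 * ((real h)\<^sup>2 / real q)))" .
  have e8: "(8::real) ^ w \<le> exp (real (3 * w))" using two_power_le_exp[of "3 * w"] by (simp add: power_mult)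
  have "8 ^ w * ((1 + 1 / real q) ^ (2 * h * h) * 2 ^ w *
     (real h * (exp 1 * (2 * sqrt (2 * \<theta> * real h * real h)) / real (32 * m)) ^ (32 * m) * (1 / real q) ^ (32 * m)) ^ g)
    \<le> exp (real (3 * w)) * (exp (real (2 * h * h) / real q) * exp (real w) * exp (- (4 * ((real h)\<^sup>2 / real q))))"
    using two_power_le_exp[of w] e8 p_power[of "2 * h * h"] v theta_delta by (intro mult_mono) auto
  also have "\<dots> = exp (4 * real w - 2 * ((real h)\<^sup>2 / real q))"
    by (simp add: exp_add[symmetric] power2_eq_square)
  also have "\<dots> \<le> exp (- real w)" using h2 by simp
  finally show ?thesis .
qed

lemma rprob_not_host_at:
  assumes k: "real k \<le> \<sigma> * real w / 10000"
  shows "rprob (pairs {..<w}) (1 / real q) (\<lambda>G. \<not> host_at G {..<w} k q h) \<le> 3 * exp (- real w)"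
proof -
  let ?P = "rprob (pairs {..<w}) (1 / real q)"
  have p: "0 \<le> 1 / real q" "1 / real q \<le> 1" using q by auto
  have h0: "0 < real h" using hq(1) qpos by linarith
  note fin = finite_pairs[of "{..<w}", simplified]
  have "?P (\<lambda>G. \<not> host_at G {..<w} k q h) \<le>
     ?P (\<lambda>G. \<not> few_flooded G {..<w} k (64 * m) (32 * m) \<or>
       (\<not> lists_cover G {..<w} h (1 / (8 * real q)) (\<delta> * real h) (\<theta> * real h) m g \<or>
        \<not> lists_linked G {..<w} h (256 * m) (32 * m) 16 (2 * \<theta> * real h) g))"
    by (rule rprob_mono[OF fin p]) (auto simp: host_at_def m_def g_def Let_def)
  also have "\<dots> \<le> ?P (\<lambda>G. \<not> few_flooded G {..<w} k (64 * m) (32 * m)) +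
      (?P (\<lambda>G. \<not> lists_cover G {..<w} h (1 / (8 * real q)) (\<delta> * real h) (\<theta> * real h) m g) +
       ?P (\<lambda>G. \<not> lists_linked G {..<w} h (256 * m) (32 * m) 16 (2 * \<theta> * real h) g))"
    by (intro order_trans[OF rprob_disj[OF fin p]] add_left_mono rprob_disj[OF fin p])
  also have "?P (\<lambda>G. \<not> few_flooded G {..<w} k (64 * m) (32 * m)) \<le> exp (- real w)"
    using rprob_not_few_flooded[OF _ p, of "{..<w}" "64 * m" k "32 * m"] mbounds(1) flooded_bound[OF k] by simp
  also have "?P (\<lambda>G. \<not> lists_cover G {..<w} h (1 / (8 * real q)) (\<delta> * real h) (\<theta> * real h) m g) \<le> exp (- real w)"
  proof -
    have "real h / (1 / (8 * real q) * (\<theta> * real h)) \<le> real m / 2"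
    proof -
      \<comment> \<open>Origin of \<open>131072 = 16 * 8192\<close>: the \<open>16\<close> comes
        from \<open>8 * q / \<theta> \<le> m / 2\<close> and the \<open>8192\<close> from the lower
        bound on \<open>m\<close>.\<close>
      have "16 * 8192 * real q \<le> \<sigma> * \<theta> * real C * real q" using Cs by (intro mult_right_mono) auto
      also have "\<dots> = \<theta> * (\<sigma> * real C * real q)" by simp
      also have "\<dots> \<le> \<theta> * (8192 * real m)" using sCq theta_delta
        by (intro mult_left_mono) auto
      finally show ?thesis using theta_delta h0 qpos by (simp add: field_simps)
    qed
    moreover have "\<delta> * real h \<le> \<theta> * real h" "\<theta> * real h \<le> 1 * real h"
      using theta_delta by (intro mult_right_mono; simp)+
    ultimately have "?P (\<lambda>G. \<not> lists_cover G {..<w} h (1 / (8 * real q)) (\<delta> * real h) (\<theta> * real h) m g) \<le>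
      4 ^ card {..<w} * ((1 + 1 / real q) ^ (h * h) * 2 ^ card {..<w} *
        ((exp 1 * (2 * sqrt (\<delta> * real h * real h)) / real m) ^ m * (1 / real q) ^ m) ^ g)"
      using mbounds(1) qpos theta_delta h0 by (intro rprob_not_lists_cover[OF _ p]) auto
    then show ?thesis using cover_bound by simp
  qed
  also have "?P (\<lambda>G. \<not> lists_linked G {..<w} h (256 * m) (32 * m) 16 (2 * \<theta> * real h) g) \<le> exp (- real w)"
  proof -
    have "2 * \<theta> * real h \<le> 1 * real h" using theta_delta by (intro mult_right_mono) auto
    then have "?P (\<lambda>G. \<not> lists_linked G {..<w} h (256 * m) (32 * m) 16 (2 * \<theta> * real h) g) \<le>
      8 ^ card {..<w} * ((1 + 1 / real q) ^ (2 * h * h) * 2 ^ card {..<w} *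
       (real h * (exp 1 * (2 * sqrt (2 * \<theta> * real h * real h)) / real (32 * m)) ^ (32 * m) * (1 / real q) ^ (32 * m)) ^ g)"
      using mbounds(1) theta_delta h0 by (intro rprob_not_lists_linked[OF _ p]) auto
    then show ?thesis using linked_bound by simp
  qed
  finally show ?thesis by simp
qed

end

text \<open>The common size \<open>h\<close> of the blob halves depends on the colouring, which
  comes after the host; so \<open>host_at\<close> is secured for every \<open>h\<close> in the
  possible range at once. The at most \<open>w + 1\<close> values are outweighed by
  \<open>exp (- w)\<close>.\<close>

lemma host_exists:
  fixes C q w :: nat and \<sigma> \<zeta> :: real
  assumes \<sigma>: "0 < \<sigma>" "\<sigma> \<le> 1" and C: "131072 \<le> \<sigma> ^ 2 * \<theta> * real C"
    and q: "24 \<le> q" "24 \<le> \<zeta> ^ 2 * real q" and \<zeta>: "0 < \<zeta>" and w: "w = C * q ^ 2" and k: "real k \<le> \<sigma> * real w / 10000"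
  shows "\<exists>G. G \<subseteq> pairs {..<w} \<and> real (card G) \<le> 4 * (real w)\<^sup>2 / real q \<and>
    host_dense G {..<w} (\<zeta> * real w) (1 / real q) \<and>
    (\<forall>h. \<sigma> * real w \<le> real h \<longrightarrow> h \<le> w \<longrightarrow> host_at G {..<w} k q h)"
proof -
  let ?P = "rprob (pairs {..<w}) (1 / real q)"
  have p: "0 \<le> 1 / real q" "1 / real q \<le> 1" using q by auto
  note fin = finite_pairs[of "{..<w}", simplified]
  define H where "H = {h. \<sigma> * real w \<le> real h \<and> h \<le> w}"
  have H: "finite H" "card H \<le> w + 1"
  proof -
    have "H \<subseteq> {..w}" by (auto simp: H_def)
    then show "finite H" "card H \<le> w + 1" using card_mono[of "{..w}" H] by (auto intro: finite_subset)
  qed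
  have "\<theta> \<le> 1" using theta_delta by simp
  then have C1: "1 \<le> C"
    using C by (cases C) auto
  have w24: "24 * 24 \<le> w"
  proof -
    have "24 * 24 \<le> q * q" using q by (intro mult_mono) auto
    also have "\<dots> \<le> C * (q * q)" using C1 by simp
    finally show ?thesis by (simp add: w power2_eq_square)
  qed
  let ?N = "4 * (1 / real q) * real (card (pairs {..<w}))"
  let ?bad = "\<lambda>G. ?N \<le> real (card G) \<or> (\<not> host_dense G {..<w} (\<zeta> * real w) (1 / real q) \<or> (\<exists>h\<in>H. \<not> host_at G {..<w} k q h))"
  have "?P ?bad \<le> ?P (\<lambda>G. ?N \<le> real (card G)) + (?P (\<lambda>G. \<not> host_dense G {..<w} (\<zeta> * real w) (1 / real q)) +
      ?P (\<lambda>G. \<exists>h\<in>H. \<not> host_at G {..<w} k q h))"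
    by (intro order_trans[OF rprob_disj[OF fin p]] add_left_mono rprob_disj[OF fin p])
  also have "?P (\<lambda>G. ?N \<le> real (card G)) \<le> 1 / 4"
  proof (rule rprob_card_ge[OF fin p])
    have "{0, 1} \<in> pairs {..<w}" unfolding pairs_def
      by (rule CollectI, rule exI[of _ 0], rule exI[of _ 1]) (use w24 in auto)
    then have "0 < card (pairs {..<w})" using fin by (auto simp: card_gt_0_iff)
    then show "0 < 1 / real q * real (card (pairs {..<w}))" using q by simp
  qed
  also have "?P (\<lambda>G. \<not> host_dense G {..<w} (\<zeta> * real w) (1 / real q)) \<le> exp (- real w)"
  proof -
    have "?P (\<lambda>G. \<not> host_dense G {..<w} (\<zeta> * real w) (1 / real q)) \<le> 4 ^ card {..<w} * exp (- (1 / real q * (\<zeta> * real w)\<^sup>2 / 8))"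
      using \<zeta> by (intro rprob_not_host_dense[OF _ p]) auto
    also have "\<dots> \<le> exp (real (2 * w)) * exp (- (3 * real w))"
    proof (rule mult_mono)
      show "(4::real) ^ card {..<w} \<le> exp (real (2 * w))" using two_power_le_exp[of "2 * w"] by (simp add: power_mult)
      have "24 * real w \<le> (\<zeta>\<^sup>2 * real q) * real w" using q by (intro mult_right_mono) auto
      also have "\<dots> = (\<zeta>\<^sup>2 * real q) * real w * 1" by simp
      also have "\<dots> \<le> (\<zeta>\<^sup>2 * real q) * real w * real C" using C1 by (intro mult_left_mono) auto
      also have "\<dots> = 1 / real q * (\<zeta> * real w)\<^sup>2" using q by (simp add: w power2_eq_square)
      finally show "exp (- (1 / real q * (\<zeta> * real w)\<^sup>2 / 8)) \<le> exp (- (3 * real w))" by simp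
    qed auto
    also have "\<dots> = exp (- real w)" by (simp add: exp_add[symmetric])
    finally show ?thesis .
  qed
  also have "?P (\<lambda>G. \<exists>h\<in>H. \<not> host_at G {..<w} k q h) \<le> (\<Sum>h\<in>H. ?P (\<lambda>G. \<not> host_at G {..<w} k q h))"
    by (rule rprob_UN[OF fin p H(1)])
  also have "\<dots> \<le> (\<Sum>h\<in>H. 3 * exp (- real w))"
    using rprob_not_host_at[OF \<sigma> C q(1) w _ _ k] by (intro sum_mono) (auto simp: H_def)
  also have "\<dots> \<le> (real w + 1) * (3 * exp (- real w))"
    using H(2) by (auto intro!: mult_right_mono)
  finally have "?P ?bad \<le> 1 / 4 + (exp (- real w) + (real w + 1) * (3 * exp (- real w)))" by simp
  also have "\<dots> \<le> 1 / 4 + 7 * real w * exp (- real w)"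
  proof -
    have "(1 + (real w + 1) * 3) * exp (- real w) \<le> (7 * real w) * exp (- real w)"
      using w24 by (intro mult_right_mono) auto
    then show ?thesis by (simp add: algebra_simps)
  qed
  also have "\<dots> < 1"
  proof -
    have "(real w)\<^sup>2 / 2 \<le> exp (real w)" using exp_lower_Taylor_quadratic[of "real w"] by simp
    moreover have "14 * real w \<le> (real w)\<^sup>2 / 2" using w24 by (simp add: power2_eq_square)
    ultimately have "14 * real w \<le> exp (real w)" by linarith
    then have "7 * real w * exp (- real w) \<le> 1 / 2" by (simp add: exp_minus field_simps)
    then show ?thesis by simp
  qed
  finally obtain G where G: "G \<subseteq> pairs {..<w}" "\<not> ?bad G" using rprob_less_one_ex[OF fin p] by blast
  have "real (card G) \<le> ?N" using G(2) by linarith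
  also have "\<dots> \<le> 4 * (1 / real q) * real (w * w)"
    using card_pairs_le[of "{..<w}"] by (intro mult_left_mono of_nat_mono) auto
  finally have "real (card G) \<le> 4 * (real w)\<^sup>2 / real q" by (simp add: power2_eq_square)
  then show ?thesis using G by (auto simp: H_def)
qed

subsection \<open>Row-by-row embedding\<close>

text \<open>In each layer fewer than \<open>hh\<close> vertices are unreachable from the first one:
  otherwise \<open>hh\<close> of them and \<open>hh\<close> reachable vertices of the preceding
  layer would be joined somewhere. Of \<open>2 * hh\<close> vertices at least \<open>hh\<close> thus
  remain reachable.\<close>

lemma layered_path:
  fixes S :: "nat \<Rightarrow> 'a set"
  assumes fin: "\<And>j. j < r \<Longrightarrow> finite (S j)" and big: "\<And>j. j < r \<Longrightarrow> 2 * hh \<le> card (S j)" and hh: "0 < hh"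
    and link: "\<And>j A B. Suc j < r \<Longrightarrow> A \<subseteq> S j \<Longrightarrow> B \<subseteq> S (Suc j) \<Longrightarrow> card A = hh \<Longrightarrow> card B = hh \<Longrightarrow> \<exists>a\<in>A. \<exists>b\<in>B. T j a b"
  shows "\<exists>v. (\<forall>j<r. v j \<in> S j) \<and> (\<forall>j. Suc j < r \<longrightarrow> T j (v j) (v (Suc j)))"
proof -
  define reach where "reach j x \<longleftrightarrow> (\<exists>v. v j = x \<and> (\<forall>i\<le>j. v i \<in> S i) \<and> (\<forall>i<j. T i (v i) (v (Suc i))))" for j x
  have ext: "reach (Suc j) b" if "reach j a" "T j a b" "b \<in> S (Suc j)" for j a b
  proof -
    obtain v where v: "v j = a" "\<forall>i\<le>j. v i \<in> S i" "\<forall>i<j. T i (v i) (v (Suc i))" using \<open>reach j a\<close> by (auto simp: reach_def)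
    show ?thesis unfolding reach_def
      by (rule exI[of _ "v(Suc j := b)"]) (use v that in \<open>auto simp: le_Suc_eq less_Suc_eq\<close>)
  qed
  have "hh \<le> card {x \<in> S j. reach j x}" if "j < r" for j
    using that
  proof (induction j)
    case 0
    have "{x \<in> S 0. reach 0 x} = S 0" by (auto simp: reach_def)
    then show ?case using big[OF 0] by simp
  next
    case (Suc j)
    define Q where "Q = {x \<in> S (Suc j). \<not> reach (Suc j) x}"
    have "card Q < hh"
    proof (rule ccontr)
      assume "\<not> card Q < hh"
      then obtain B where B: "B \<subseteq> Q" "card B = hh" using obtain_subset_with_card_n[of hh Q] by (metis not_less)
      have "hh \<le> card {x \<in> S j. reach j x}" using Suc by simp
      then obtain A where A: "A \<subseteq> {x \<in> S j. reach j x}" "card A = hh" by (rule obtain_subset_with_card_n)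
      have "A \<subseteq> S j" "B \<subseteq> S (Suc j)" using A(1) B(1) by (auto simp: Q_def)
      then obtain a b where ab: "a \<in> A" "b \<in> B" "T j a b" using link[OF Suc.prems _ _ A(2) B(2)] by blast
      have "reach j a" "b \<in> S (Suc j)" "\<not> reach (Suc j) b" using A(1) B(1) ab by (auto simp: Q_def)
      then show False using ext ab(3) by blast
    qed
    moreover have "card (S (Suc j)) = card Q + card {x \<in> S (Suc j). reach (Suc j) x}"
      using fin[OF Suc.prems] by (subst card_Un_disjoint[symmetric]) (auto simp: Q_def intro: arg_cong[of _ _ card])
    ultimately show ?case using big[OF Suc.prems] by simp
  qed
  then show ?thesis
  proof (cases r)
    case (Suc r')
    then have "hh \<le> card {x \<in> S r'. reach r' x}" using \<open>\<And>j. j < r \<Longrightarrow> hh \<le> card {x \<in> S j. reach j x}\<close> by simp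
    then have "{x \<in> S r'. reach r' x} \<noteq> {}" using hh by (metis card.empty not_less)
    then obtain x where "reach r' x" by blast
    then show ?thesis unfolding reach_def Suc by (auto simp: less_Suc_eq_le)
  qed simp
qed

text \<open>A vertex with few neighbours in \<open>B\<close> misses most of the 32 blocks of \<open>B\<close>.\<close>

lemma many_neighbours_in_blocks:
  assumes X: "finite X" and B: "finite B" "card B = 32 * m" and m: "0 < m"
    and cover: "\<And>B'. B' \<subseteq> B \<Longrightarrow> card B' = m \<Longrightarrow> real (card {x \<in> X. nbrs J x B' = {}}) < z"
  shows "real (card {x \<in> X. card (nbrs J x B) < 16}) \<le> 2 * z"
proof -
  obtain e where e: "bij_betw e {..<32 * m} B" using ex_bij_betw_nat_finite[OF B(1)] B(2) by (metis atLeast0LessThan)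
  define P where "P r = e ` {r * m..<(r + 1) * m}" for r
  have inj: "inj_on e {..<32 * m}" and img: "e ` {..<32 * m} = B" using e by (auto simp: bij_betw_def)
  have sub: "{r * m..<(r + 1) * m} \<subseteq> {..<32 * m}" if "r < 32" for r
  proof -
    have "(r + 1) * m \<le> 32 * m" using that by (intro mult_le_mono1) simp
    then show ?thesis by (metis atLeastLessThan_iff lessThan_iff less_le_trans subsetI)
  qed
  have PB: "P r \<subseteq> B" and cP: "card (P r) = m" if "r < 32" for r
  proof -
    show "P r \<subseteq> B" unfolding P_def using sub[OF that] img by blast
    show "card (P r) = m" unfolding P_def using card_image[OF inj_on_subset[OF inj sub[OF that]]] by simp
  qed
  have disj: "r = r'" if y: "y \<in> P r" "y \<in> P r'" and r: "r < 32" "r' < 32" for y r r'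
  proof -
    obtain i i' where i: "i \<in> {r * m..<(r + 1) * m}" "y = e i" "i' \<in> {r' * m..<(r' + 1) * m}" "y = e i'"
      using y unfolding P_def by (elim imageE) (rule that)
    have "i \<in> {..<32 * m}" "i' \<in> {..<32 * m}" using i(1,3) sub[OF r(1)] sub[OF r(2)] by blast+
    then have "i = i'" using inj_onD[OF inj, of i i'] i(2,4) by simp
    moreover have "i div m = r" "i' div m = r'" using i m by (auto intro!: div_nat_eqI simp: mult.commute)
    ultimately show ?thesis by simp
  qed
  let ?bad = "{x \<in> X. card (nbrs J x B) < 16}"
  have miss: "16 \<le> card {r \<in> {..<32}. nbrs J x (P r) = {}}" if x: "card (nbrs J x B) < 16" for x
  proof -
    let ?H = "{r \<in> {..<32}. nbrs J x (P r) \<noteq> {}}"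
    have "card ?H \<le> card (nbrs J x B)"
    proof (rule card_inj_on_le)
      let ?f = "\<lambda>r. SOME y. y \<in> nbrs J x (P r)"
      have f: "?f r \<in> nbrs J x (P r)" if "r \<in> ?H" for r using that by (simp add: some_in_eq)
      show "inj_on ?f ?H"
      proof (rule inj_onI)
        fix r r' assume r: "r \<in> ?H" "r' \<in> ?H" "?f r = ?f r'"
        have "?f r \<in> P r" "?f r' \<in> P r'" using subsetD[OF nbrs_subset f[OF r(1)]] subsetD[OF nbrs_subset f[OF r(2)]] .
        then show "r = r'" using disj[of "?f r" r r'] r by simp
      qed
      show "?f ` ?H \<subseteq> nbrs J x B"
      proof (rule image_subsetI)
        fix r assume r: "r \<in> ?H"
        then have "nbrs J x (P r) \<subseteq> nbrs J x B" using PB[of r] by (auto simp: nbrs_def)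
        then show "?f r \<in> nbrs J x B" using f[OF r] by blast
      qed
      show "finite (nbrs J x B)" using B(1) by (rule finite_nbrs)
    qed
    then have "card ?H < 16" using x by simp
    moreover have "card ?H + card {r \<in> {..<32}. nbrs J x (P r) = {}} = card {..<32::nat}"
    proof -
      have "{..<32} = ?H \<union> {r \<in> {..<32}. nbrs J x (P r) = {}}" by auto
      moreover have "card (?H \<union> {r \<in> {..<32}. nbrs J x (P r) = {}}) = card ?H + card {r \<in> {..<32}. nbrs J x (P r) = {}}"
        by (rule card_Un_disjoint) auto
      ultimately show ?thesis by metis
    qed
    ultimately show ?thesis by simp
  qed
  \<comment> \<open>Double counting: a bad vertex misses at least \<open>16\<close> of the
    \<open>32\<close> blocks, and a block is missed by at most \<open>z\<close> vertices; hence
    \<open>2 * z\<close>.\<close>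
  have "16 * card ?bad = (\<Sum>x\<in>?bad. 16)" by simp
  also have "\<dots> \<le> (\<Sum>x\<in>?bad. card {r \<in> {..<32}. nbrs J x (P r) = {}})" using miss by (intro sum_mono) auto
  also have "\<dots> \<le> (\<Sum>x\<in>X. card {r \<in> {..<32}. nbrs J x (P r) = {}})" using X by (intro sum_mono2) auto
  also have "\<dots> = (\<Sum>x\<in>X. \<Sum>r<32. if nbrs J x (P r) = {} then 1 else 0)"
    by (simp add: sum.If_cases Int_def)
  also have "\<dots> = (\<Sum>r<32. \<Sum>x\<in>X. if nbrs J x (P r) = {} then 1 else 0)" by (rule sum.swap)
  also have "\<dots> = (\<Sum>r<32. card {x \<in> X. nbrs J x (P r) = {}})"
    using X by (simp add: sum.If_cases Int_def)
  finally have "real (16 * card ?bad) \<le> real (\<Sum>r<32. card {x \<in> X. nbrs J x (P r) = {}})" by (rule of_nat_mono)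
  then have "16 * real (card ?bad) \<le> (\<Sum>r<32. real (card {x \<in> X. nbrs J x (P r) = {}}))" by simp
  also have "\<dots> \<le> (\<Sum>r<(32::nat). z)" using cover[OF PB cP] by (intro sum_mono) (auto intro: less_imp_le)
  finally show ?thesis by simp
qed

lemma few_low_degree:
  assumes J: "dense_pair J u c X Y" and fin: "finite X" "finite Y" and L: "L \<subseteq> Y" "u \<le> real (card L)"
    and d: "real d \<le> c * real (card L)" and u: "0 < u"
  shows "real (card {v \<in> X. card (nbrs J v L) < d}) < u"
proof (rule ccontr)
  let ?P = "{v \<in> X. card (nbrs J v L) < d}"
  assume "\<not> ?thesis"
  then have big: "u \<le> real (card ?P)" by simp
  then have ne: "?P \<noteq> {}" using u by (metis card.empty of_nat_0 not_less)
  have fL: "finite L" using L(1) fin(2) by (rule finite_subset)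
  have "c * real (card ?P) * real (card L) \<le> real (edge_count J ?P L)"
    using J L big unfolding dense_pair_def by simp
  also have "\<dots> = (\<Sum>v\<in>?P. real (card (nbrs J v L)))" using fin fL by (simp add: edge_count_sum_left)
  also have "\<dots> < (\<Sum>v\<in>?P. real d)" using fin ne by (intro sum_strict_mono) auto
  also have "\<dots> = real (card ?P) * real d" by simp
  also have "\<dots> \<le> real (card ?P) * (c * real (card L))" using d by (intro mult_left_mono) auto
  finally show False by (simp add: mult_ac)
qed

lemma nbrs_Int_cross: "x \<in> X \<Longrightarrow> B \<subseteq> Y \<Longrightarrow> nbrs (J \<inter> cross X Y) x B = nbrs J x B"
proof -
  assume x: "x \<in> X" and B: "B \<subseteq> Y"
  have "{x, b} \<in> cross X Y" if "b \<in> B" for b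
    unfolding cross_def using x subsetD[OF B that] by (intro CollectI exI[of _ x] exI[of _ b]) simp
  then show ?thesis unfolding nbrs_def by (intro Collect_cong) blast
qed

lemma dense_pair_Int_cross: "dense_pair J u c X Y \<Longrightarrow> dense_pair (J \<inter> cross X Y) u c X Y"
proof -
  have "edge_count (J \<inter> cross X Y) A B = edge_count J A B" if AB: "A \<subseteq> X" "B \<subseteq> Y" for A B
  proof -
    have "{a, b} \<in> cross X Y" if "a \<in> A" "b \<in> B" for a b
      unfolding cross_def using subsetD[OF AB(1) that(1)] subsetD[OF AB(2) that(2)]
      by (intro CollectI exI[of _ a] exI[of _ b]) simp
    then have "{(a, b). a \<in> A \<and> b \<in> B \<and> {a, b} \<in> J \<inter> cross X Y} = {(a, b). a \<in> A \<and> b \<in> B \<and> {a, b} \<in> J}" by auto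
    then show ?thesis unfolding edge_count_def by simp
  qed
  then show "dense_pair J u c X Y \<Longrightarrow> dense_pair (J \<inter> cross X Y) u c X Y" unfolding dense_pair_def by simp
qed

lemma card_less_if_no_subset:
  assumes "\<And>P. P \<subseteq> S \<Longrightarrow> card P = g \<Longrightarrow> False"
  shows "card S < g"
proof (rule ccontr)
  assume "\<not> card S < g"
  then have "g \<le> card S" by simp
  then obtain P where "P \<subseteq> S" "card P = g" by (rule obtain_subset_with_card_n)
  then show False by (rule assms)
qed

section \<open>Live sets and candidate lists along a monochromatic path\<close>

text \<open>\<open>X k e\<close> is the half of the blob at position \<open>k\<close> that serves
  the rows of parity \<open>e\<close>. A grid vertex in blob \<open>i + j\<close> has its right and
  lower neighbours in blob \<open>i + j + 1\<close>, so every grid edge belongs to some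
  \<open>R k\<close>. Disjointness at distance two reflects the colouring of the square of the
  reduced graph; it separates the four sets to which the linking property is applied.\<close>

locale coloured_path =
  fixes G :: "'a set set" and W :: "'a set" and K q h L :: nat and X :: "nat \<Rightarrow> bool \<Rightarrow> 'a set" and R :: "nat \<Rightarrow> 'a set set"
  assumes finW: "finite W" and host: "host_at G W K q h" and q: "0 < q" and hq: "4096 * q \<le> h"
    and XW: "\<And>k e. k \<le> L \<Longrightarrow> X k e \<subseteq> W" and cX: "\<And>k e. k \<le> L \<Longrightarrow> card (X k e) = h"
    and disj0: "\<And>k. k \<le> L \<Longrightarrow> X k e \<inter> X k (\<not> e) = {}"
    and disj1: "\<And>k e e'. k < L \<Longrightarrow> X k e \<inter> X (k + 1) e' = {}"
    and disj2: "\<And>k e e'. k + 1 < L \<Longrightarrow> X k e \<inter> X (k + 2) e' = {}"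
    and RG: "\<And>k. R k \<subseteq> G"
    and dense: "\<And>k e e'. k < L \<Longrightarrow> dense_pair (R k) (\<delta> * real h) (1 / (8 * real q)) (X k e) (X (k + 1) e')"
begin

definition m where "m = h div (4096 * q)"

lemma m: "0 < m" "4096 * q * m \<le> h"
proof -
  show "0 < m" unfolding m_def using hq q by (simp add: div_greater_zero_iff)
  show "4096 * q * m \<le> h" unfolding m_def by (simp add: mult.commute)
qed

lemma host_flood: "few_flooded G W K (64 * m) (32 * m)"
  and host_cover: "lists_cover G W h (1 / (8 * real q)) (\<delta> * real h) (\<theta> * real h) m (h div 8 + 1)"
  and host_linked: "lists_linked G W h (256 * m) (32 * m) 16 (2 * \<theta> * real h) (h div 8 + 1)"
  using host unfolding host_at_def Let_def m_def by simp_all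

lemma h0: "4096 \<le> h" "0 < real h" "0 < \<delta> * real h" "\<delta> * real h \<le> real h / 16"
proof -
  have "4096 * 1 \<le> 4096 * q" using q by simp
  then show h: "4096 \<le> h" using hq by linarith
  then show "0 < real h" by simp
  then show "0 < \<delta> * real h" using theta_delta by simp
  show "\<delta> * real h \<le> real h / 16" using theta_delta mult_right_mono[of \<delta> "1/16" "real h"] by simp
qed

lemma finX: "k \<le> L \<Longrightarrow> finite (X k e)"
  using finite_subset[OF XW finW] .

text \<open>\<open>B0\<close> stands for a list inside \<open>X (k + 1) (\<not> e)\<close>. The
  condition looks back to \<open>X k (\<not> e)\<close>, the half that contains the list of the
  vertex one column further left, with which \<open>B0\<close> has to be linked.\<close>

definition covering :: "nat \<Rightarrow> bool \<Rightarrow> 'a set \<Rightarrow> bool" where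
  "covering k e B0 \<longleftrightarrow> (\<forall>B\<subseteq>B0. card B = 32 * m \<longrightarrow> real (card {x \<in> X k (\<not> e). card (nbrs (R k) x B) < 16}) \<le> 2 * \<theta> * real h)"

definition linked :: "nat \<Rightarrow> 'a set \<Rightarrow> 'a set \<Rightarrow> bool" where
  "linked k A0 B0 \<longleftrightarrow> (\<forall>A\<subseteq>A0. \<forall>B\<subseteq>B0. card A = 32 * m \<longrightarrow> card B = 32 * m \<longrightarrow> (\<exists>a\<in>A. nbrs (R k) a B \<noteq> {}))"

text \<open>\<open>Lv k e\<close> consists of the vertices from which the embedding can continue; \<open>N k e v\<close> is the list of
  candidates for the vertex below \<open>v\<close>.\<close>

definition live :: "nat \<Rightarrow> (nat \<Rightarrow> bool \<Rightarrow> 'a set) \<Rightarrow> (nat \<Rightarrow> bool \<Rightarrow> 'a \<Rightarrow> 'a set) \<Rightarrow> bool" where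
  "live k0 Lv N \<longleftrightarrow>
     (\<forall>k e. k0 \<le> k \<longrightarrow> k \<le> L \<longrightarrow> Lv k e \<subseteq> X k e \<and> real h / 2 \<le> real (card (Lv k e))) \<and>
     (\<forall>k e. \<forall>v\<in>Lv k e. k0 \<le> k \<longrightarrow> k < L \<longrightarrow>
        N k e v \<subseteq> nbrs (R k) v (Lv (k + 1) (\<not> e)) \<and> card (N k e v) = 256 * m \<and> covering k e (N k e v)) \<and>
     (\<forall>k e. \<forall>v\<in>Lv k e. \<forall>v'\<in>Lv (k + 1) e. k0 \<le> k \<longrightarrow> k + 1 < L \<longrightarrow> linked (k + 1) (N k e v) (N (k + 1) e v'))"

text \<open>Among any \<open>h div 8 + 1\<close> vertices the host property supplies one whose list
  leaves little of \<open>X k (\<not> e)\<close> uncovered by any \<open>m\<close>-subset. Cutting a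
  \<open>32 * m\<close>-subset into blocks strengthens one neighbour to \<open>16\<close>, at the
  price of the factor \<open>2\<close> in \<open>2 * \<theta> * h\<close>.\<close>

lemma few_not_covering:
  assumes k: "k < L" and S: "S \<subseteq> X k e" and N: "\<And>v. v \<in> S \<Longrightarrow> N v \<subseteq> nbrs G v (X (k + 1) (\<not> e))"
    and bad: "\<And>v. v \<in> S \<Longrightarrow> \<not> covering k e (N v)"
  shows "card S < h div 8 + 1"
proof (rule card_less_if_no_subset)
  fix P assume P: "P \<subseteq> S" "card P = h div 8 + 1"
  let ?X = "X k (\<not> e)" and ?Y = "X (k + 1) (\<not> e)"
  let ?J = "R k \<inter> cross ?X ?Y"
  have d: "?X \<inter> ?Y = {}" "X k e \<inter> ?X = {}" "X k e \<inter> ?Y = {}" using disj1[OF k] disj0[of k e] k by auto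
  have PX: "P \<subseteq> X k e" using P(1) S by (rule order_trans)
  have XkW: "X k e \<subseteq> W" using k by (intro XW) simp
  have "P \<subseteq> W - (?X \<union> ?Y)" using PX XkW d(2,3) by blast
  moreover have "?J \<subseteq> G \<inter> cross ?X ?Y" using RG[of k] by blast
  moreover have "?X \<subseteq> W" "?Y \<subseteq> W" "card ?X = h" "card ?Y = h" using XW cX k by simp_all
  ultimately have "\<exists>v\<in>P. \<forall>B\<subseteq>nbrs G v ?Y. card B = m \<longrightarrow> real (card {x \<in> ?X. nbrs ?J x B = {}}) < \<theta> * real h"
    using host_cover P(2) d(1) dense_pair_Int_cross[OF dense[OF k]] unfolding lists_cover_def by simp
  then obtain v where v: "v \<in> P" "\<And>B. B \<subseteq> nbrs G v ?Y \<Longrightarrow> card B = m \<Longrightarrow> real (card {x \<in> ?X. nbrs ?J x B = {}}) < \<theta> * real h"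
    by blast
  have vS: "v \<in> S" using v(1) P(1) by blast
  have "covering k e (N v)"
    unfolding covering_def
  proof (intro allI impI)
    fix B assume B: "B \<subseteq> N v" "card B = 32 * m"
    have BG: "B \<subseteq> nbrs G v ?Y" using B(1) N[OF vS] by (rule order_trans)
    then have BY: "B \<subseteq> ?Y" using nbrs_subset by (rule order_trans)
    have "k + 1 \<le> L" using k by simp
    then have fB: "finite B" by (rule finite_subset[OF BY finX])
    have "real (card {x \<in> ?X. card (nbrs (R k) x B) < 16}) \<le> 2 * (\<theta> * real h)"
    proof (rule many_neighbours_in_blocks[OF _ fB B(2) m(1)])
      show "finite ?X" using k by (intro finX) simp
      fix B' assume B': "B' \<subseteq> B" "card B' = m"
      have "{x \<in> ?X. nbrs ?J x B' = {}} = {x \<in> ?X. nbrs (R k) x B' = {}}"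
        using nbrs_Int_cross[of _ ?X B' ?Y "R k"] B'(1) BY by auto
      then show "real (card {x \<in> ?X. nbrs (R k) x B' = {}}) < \<theta> * real h"
        using v(2)[OF order_trans[OF B'(1) BG] B'(2)] by simp
    qed
    then show "real (card {x \<in> ?X. card (nbrs (R k) x B) < 16}) \<le> 2 * \<theta> * real h" by simp
  qed
  then show False using bad[OF vS] by contradiction
qed

lemma few_not_linked:
  assumes k: "k + 1 < L" and S: "S \<subseteq> X k e" and N: "\<And>v. v \<in> S \<Longrightarrow> N v \<subseteq> nbrs G v (X (k + 1) (\<not> e))"
    and Q: "Q \<subseteq> X (k + 1) e" and N': "\<And>v. v \<in> Q \<Longrightarrow> N' v \<subseteq> nbrs G v (X (k + 2) (\<not> e)) \<and> card (N' v) = 256 * m \<and> covering (k + 1) e (N' v)"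
    and bad: "\<And>v. v \<in> S \<Longrightarrow> \<exists>v'\<in>Q. \<not> linked (k + 1) (N v) (N' v')"
  shows "card S < h div 8 + 1"
proof (rule card_less_if_no_subset)
  fix P assume P: "P \<subseteq> S" "card P = h div 8 + 1"
  let ?X = "X (k + 1) (\<not> e)" and ?Y = "X (k + 2) (\<not> e)" and ?Q = "X (k + 1) e"
  \<comment> \<open>Between \<open>?Q\<close> and \<open>?Y\<close> only the edges from each vertex
    of \<open>Q\<close> to its own list are kept, so that the \<open>?J\<close>-neighbourhood of
    \<open>v'\<close> in \<open>?Y\<close> is exactly \<open>N' v'\<close>. The lists lie in
    \<open>G\<close>-neighbourhoods, so \<open>?J\<close> is an admissible subgraph.\<close>
  let ?J = "(R (k + 1) \<inter> cross ?X ?Y) \<union> {{v, b} | v b. v \<in> Q \<and> b \<in> N' v}"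
  have d: "?X \<inter> ?Y = {}" "?X \<inter> ?Q = {}" "?Y \<inter> ?Q = {}" using disj1[of "k + 1" "\<not> e" "\<not> e"] disj1[of "k + 1" e "\<not> e"] disj0[of "k + 1" e] k by auto
  have dP: "X k e \<inter> ?X = {}" "X k e \<inter> ?Q = {}" "X k e \<inter> ?Y = {}" using disj1[of k e] disj2[of k e] k by simp_all
  have PW: "P \<subseteq> W - (?X \<union> ?Y \<union> ?Q)" 
  proof -
    have PX: "P \<subseteq> X k e" using P(1) S by (rule order_trans)
    have XkW: "X k e \<subseteq> W" using k by (intro XW) simp
    show ?thesis using PX XkW dP by blast
  qed
  have JG: "?J \<subseteq> G \<inter> (cross ?X ?Y \<union> cross ?Q ?Y)"
  proof -
    have "{{v, b} | v b. v \<in> Q \<and> b \<in> N' v} \<subseteq> G \<inter> cross ?Q ?Y"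
      using Q N' unfolding nbrs_def cross_def by blast
    then show ?thesis using RG[of "k + 1"] by blast
  qed
  have sub: "?X \<subseteq> W" "?Y \<subseteq> W" "?Q \<subseteq> W" "card ?X = h" "card ?Y = h" "card ?Q = h" using XW cX k by simp_all
  have "\<exists>v\<in>P. \<forall>A\<subseteq>nbrs G v ?X. card A = 32 * m \<longrightarrow>
        (\<forall>q\<in>?Q. covering_list ?J ?X (nbrs ?J q ?Y) (256 * m) (32 * m) 16 (2 * \<theta> * real h) \<longrightarrow>
           (\<forall>B\<subseteq>nbrs ?J q ?Y. card B = 32 * m \<longrightarrow> (\<exists>a\<in>A. nbrs ?J a B \<noteq> {})))"
    using host_linked[unfolded lists_linked_def, rule_format, OF sub(1-3) JG PW d sub(4-6) P(2)] by blast
  then obtain v where v1: "v \<in> P" and v2: "\<forall>A\<subseteq>nbrs G v ?X. card A = 32 * m \<longrightarrow>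
        (\<forall>q\<in>?Q. covering_list ?J ?X (nbrs ?J q ?Y) (256 * m) (32 * m) 16 (2 * \<theta> * real h) \<longrightarrow>
           (\<forall>B\<subseteq>nbrs ?J q ?Y. card B = 32 * m \<longrightarrow> (\<exists>a\<in>A. nbrs ?J a B \<noteq> {})))"
    by (rule bexE)
  have vS: "v \<in> S" using v1 P(1) by blast
  obtain v' where v': "v' \<in> Q" "\<not> linked (k + 1) (N v) (N' v')" using bad[OF vS] by blast
  have JX: "nbrs ?J x B = nbrs (R (k + 1)) x B" if x: "x \<in> ?X" and B: "B \<subseteq> ?Y" for x B
  proof -
    have "{x, b} \<notin> {{v, b} | v b. v \<in> Q \<and> b \<in> N' v}" if "b \<in> B" for b
    proof
      assume "{x, b} \<in> {{v, b} | v b. v \<in> Q \<and> b \<in> N' v}"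
      then have "x \<in> Q \<or> b \<in> Q" by (auto simp: doubleton_eq_iff)
      then show False using d x B that Q by blast
    qed
    then have "nbrs ?J x B = nbrs (R (k + 1) \<inter> cross ?X ?Y) x B" unfolding nbrs_def by blast
    then show ?thesis using nbrs_Int_cross[OF x B] by simp
  qed
  have JQ: "nbrs ?J v' ?Y = N' v'"
  proof
    show "nbrs ?J v' ?Y \<subseteq> N' v'"
    proof
      fix b assume b: "b \<in> nbrs ?J v' ?Y"
      then have bY: "b \<in> ?Y" and e: "{v', b} \<in> ?J" by (auto simp: nbrs_def)
      have vQ: "v' \<in> ?Q" using v'(1) Q by blast
      have "{v', b} \<notin> cross ?X ?Y" using d vQ bY unfolding cross_def by (auto simp: doubleton_eq_iff)
      then obtain w b' where w: "{v', b} = {w, b'}" "w \<in> Q" "b' \<in> N' w" using e by blast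
      then have "v' = w \<and> b = b'" using d bY Q by (auto simp: doubleton_eq_iff)
      then show "b \<in> N' v'" using w(3) by simp
    qed
    show "N' v' \<subseteq> nbrs ?J v' ?Y" using v'(1) N' unfolding nbrs_def by blast
  qed
  have N'Y: "N' v' \<subseteq> ?Y" using N'[OF v'(1)] nbrs_subset[of G v' ?Y] by blast
  have cov: "covering_list ?J ?X (nbrs ?J v' ?Y) (256 * m) (32 * m) 16 (2 * \<theta> * real h)"
    unfolding JQ covering_list_def
  proof (intro conjI allI impI)
    show "card (N' v') = 256 * m" using N'[OF v'(1)] by blast
    fix B assume B: "B \<subseteq> N' v'" "card B = 32 * m"
    have "{x \<in> ?X. card (nbrs ?J x B) < 16} = {x \<in> ?X. card (nbrs (R (k + 1)) x B) < 16}"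
      using JX[OF _ order_trans[OF B(1) N'Y]] by auto
    then show "real (card {x \<in> ?X. card (nbrs ?J x B) < 16}) \<le> 2 * \<theta> * real h"
      using N'[OF v'(1)] B unfolding covering_def by simp
  qed
  have "linked (k + 1) (N v) (N' v')"
    unfolding linked_def
  proof (intro allI impI)
    fix A B assume AB: "A \<subseteq> N v" "B \<subseteq> N' v'" "card A = 32 * m" "card B = 32 * m"
    have AG: "A \<subseteq> nbrs G v ?X" using AB(1) N[OF vS] by (rule order_trans)
    have "v' \<in> ?Q" using v'(1) Q by blast
    then have "\<exists>a\<in>A. nbrs ?J a B \<noteq> {}"
      using v2[rule_format, OF AG AB(3) _ cov _ AB(4)] AB(2) JQ by simp
    then obtain a where a: "a \<in> A" "nbrs ?J a B \<noteq> {}" by (rule bexE)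
    have "a \<in> ?X" using a(1) AG nbrs_subset[of G v ?X] by blast
    then have "nbrs ?J a B = nbrs (R (k + 1)) a B" using JX order_trans[OF AB(2) N'Y] by simp
    then show "\<exists>a\<in>A. nbrs (R (k + 1)) a B \<noteq> {}" using a by auto
  qed
  then show False using v'(2) by contradiction
qed

lemma liveD:
  assumes "live k0 Lv N"
  shows live_subset: "k0 \<le> k \<Longrightarrow> k \<le> L \<Longrightarrow> Lv k e \<subseteq> X k e"
    and live_card: "k0 \<le> k \<Longrightarrow> k \<le> L \<Longrightarrow> real h / 2 \<le> real (card (Lv k e))"
    and live_list: "v \<in> Lv k e \<Longrightarrow> k0 \<le> k \<Longrightarrow> k < L \<Longrightarrow>
        N k e v \<subseteq> nbrs (R k) v (Lv (k + 1) (\<not> e)) \<and> card (N k e v) = 256 * m \<and> covering k e (N k e v)"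
    and live_linked: "v \<in> Lv k e \<Longrightarrow> v' \<in> Lv (k + 1) e \<Longrightarrow> k0 \<le> k \<Longrightarrow> k + 1 < L \<Longrightarrow> linked (k + 1) (N k e v) (N (k + 1) e v')"
proof -
  note a = conjunct1[OF assms[unfolded live_def], rule_format]
  note b = conjunct1[OF conjunct2[OF assms[unfolded live_def]], rule_format]
  note c = conjunct2[OF conjunct2[OF assms[unfolded live_def]], rule_format]
  show "k0 \<le> k \<Longrightarrow> k \<le> L \<Longrightarrow> Lv k e \<subseteq> X k e" "k0 \<le> k \<Longrightarrow> k \<le> L \<Longrightarrow> real h / 2 \<le> real (card (Lv k e))"
    using a[of k e] by simp_all
  show "v \<in> Lv k e \<Longrightarrow> k0 \<le> k \<Longrightarrow> k < L \<Longrightarrow>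
        N k e v \<subseteq> nbrs (R k) v (Lv (k + 1) (\<not> e)) \<and> card (N k e v) = 256 * m \<and> covering k e (N k e v)"
    by (rule b)
  show "v \<in> Lv k e \<Longrightarrow> v' \<in> Lv (k + 1) e \<Longrightarrow> k0 \<le> k \<Longrightarrow> k + 1 < L \<Longrightarrow> linked (k + 1) (N k e v) (N (k + 1) e v')"
    by (rule c)
qed

text \<open>Lists point forward, so live sets are built backwards along the path. A vertex is lost
  if it has too few neighbours in the live part of the next blob, if its list is not covering, or if
  its list fails to link with some list of the next blob. This costs at most
  \<open>h / 16 + h / 8 + h / 8\<close>, so at least half survives.\<close>

lemma live_step:
  assumes lv: "live (k0 + 1) Lv N" and k0: "k0 < L"
  shows "\<exists>Lv' N'. live k0 Lv' N'"
proof -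
  have lvX: "Lv k e \<subseteq> X k e" "real h / 2 \<le> real (card (Lv k e))" if "k0 + 1 \<le> k" "k \<le> L" for k e
    using live_subset[OF lv that] live_card[OF lv that] .
  have lvN: "N k e v \<subseteq> nbrs (R k) v (Lv (k + 1) (\<not> e)) \<and> card (N k e v) = 256 * m \<and> covering k e (N k e v)"
    if "v \<in> Lv k e" "k0 + 1 \<le> k" "k < L" for k e v
    by (rule live_list[OF lv that])
  have lvL: "linked (k + 1) (N k e v) (N (k + 1) e v')"
    if "v \<in> Lv k e" "v' \<in> Lv (k + 1) e" "k0 + 1 \<le> k" "k + 1 < L" for k e v v'
    by (rule live_linked[OF lv that])
  define Lq where "Lq e = Lv (k0 + 1) (\<not> e)" for e
  define S1 where "S1 e = {v \<in> X k0 e. 256 * m \<le> card (nbrs (R k0) v (Lq e))}" for e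
  define NN where "NN e v = (SOME B. B \<subseteq> nbrs (R k0) v (Lq e) \<and> card B = 256 * m)" for e v
  have NN: "NN e v \<subseteq> nbrs (R k0) v (Lq e) \<and> card (NN e v) = 256 * m" if v: "v \<in> S1 e" for e v
  proof -
    have "256 * m \<le> card (nbrs (R k0) v (Lq e))" using v by (simp add: S1_def)
    then obtain B where "B \<subseteq> nbrs (R k0) v (Lq e)" "card B = 256 * m" by (rule obtain_subset_with_card_n)
    then have "\<exists>B. B \<subseteq> nbrs (R k0) v (Lq e) \<and> card B = 256 * m" by blast
    then show ?thesis unfolding NN_def by (rule someI_ex)
  qed
  define S2 where "S2 e = {v \<in> S1 e. \<not> covering k0 e (NN e v)}" for e
  define S3 where "S3 e = {v \<in> S1 e. k0 + 1 < L \<and> (\<exists>v'\<in>Lv (k0 + 1) e. \<not> linked (k0 + 1) (NN e v) (N (k0 + 1) e v'))}" for e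
  define new where "new e = S1 e - S2 e - S3 e" for e
  have LqX: "Lq e \<subseteq> X (k0 + 1) (\<not> e)" for e unfolding Lq_def using lvX(1)[of "k0 + 1" "\<not> e"] k0 by simp
  have NNG: "NN e v \<subseteq> nbrs G v (X (k0 + 1) (\<not> e))" if v: "v \<in> S1 e" for e v
  proof -
    have "nbrs (R k0) v (Lq e) \<subseteq> nbrs G v (X (k0 + 1) (\<not> e))" using LqX[of e] RG[of k0] unfolding nbrs_def by blast
    then show ?thesis using NN[OF v] by blast
  qed
  have c1: "real (card (X k0 e - S1 e)) < \<delta> * real h" for e
  proof -
    have "X k0 e - S1 e = {v \<in> X k0 e. card (nbrs (R k0) v (Lq e)) < 256 * m}" by (auto simp: S1_def)
    moreover have "real (card {v \<in> X k0 e. card (nbrs (R k0) v (Lq e)) < 256 * m}) < \<delta> * real h"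
    proof (rule few_low_degree[OF dense[OF k0, of e "\<not> e"] _ _ LqX _ _ h0(3)])
      show "finite (X k0 e)" "finite (X (k0 + 1) (\<not> e))" using k0 by (auto intro: finX)
      have half: "real h / 2 \<le> real (card (Lq e))" unfolding Lq_def using lvX(2)[of "k0 + 1" "\<not> e"] k0 by simp
      then show "\<delta> * real h \<le> real (card (Lq e))" using h0 by linarith
      have "real (4096 * q * m) \<le> real h" using m(2) by (rule of_nat_mono)
      then have "real q * real (256 * m) \<le> real h / 2 / 8" by simp
      also have "\<dots> \<le> real (card (Lq e)) / 8" using half by simp
      finally show "real (256 * m) \<le> 1 / (8 * real q) * real (card (Lq e))" using q by (simp add: field_simps)
    qed
    ultimately show ?thesis by simp
  qed
  have c2: "card (S2 e) < h div 8 + 1" for e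
  proof (rule few_not_covering[OF k0, of _ e "NN e"])
    show "S2 e \<subseteq> X k0 e" by (auto simp: S2_def S1_def)
    show "NN e v \<subseteq> nbrs G v (X (k0 + 1) (\<not> e))" if "v \<in> S2 e" for v using that by (intro NNG) (simp add: S2_def)
    show "\<not> covering k0 e (NN e v)" if "v \<in> S2 e" for v using that by (simp add: S2_def)
  qed
  have c3: "card (S3 e) < h div 8 + 1" for e
  proof (cases "k0 + 1 < L")
    case True
    show ?thesis
    proof (rule few_not_linked[OF True, of _ e "NN e" "Lv (k0 + 1) e" "N (k0 + 1) e"])
      show "S3 e \<subseteq> X k0 e" by (auto simp: S3_def S1_def)
      show "NN e v \<subseteq> nbrs G v (X (k0 + 1) (\<not> e))" if "v \<in> S3 e" for v using that by (intro NNG) (simp add: S3_def)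
      show "Lv (k0 + 1) e \<subseteq> X (k0 + 1) e" using lvX(1)[of "k0 + 1"] k0 by simp
      show "N (k0 + 1) e v \<subseteq> nbrs G v (X (k0 + 2) (\<not> e)) \<and> card (N (k0 + 1) e v) = 256 * m \<and> covering (k0 + 1) e (N (k0 + 1) e v)"
        if v: "v \<in> Lv (k0 + 1) e" for v
      proof -
        have "Lv (k0 + 1 + 1) (\<not> e) \<subseteq> X (k0 + 2) (\<not> e)" using lvX(1)[of "k0 + 2" "\<not> e"] True by simp
        then have "nbrs (R (k0 + 1)) v (Lv (k0 + 1 + 1) (\<not> e)) \<subseteq> nbrs G v (X (k0 + 2) (\<not> e))"
          using RG[of "k0 + 1"] unfolding nbrs_def by blast
        then show ?thesis using lvN[OF v _ True] by blast
      qed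
      show "\<exists>v'\<in>Lv (k0 + 1) e. \<not> linked (k0 + 1) (NN e v) (N (k0 + 1) e v')" if "v \<in> S3 e" for v
        using that by (simp add: S3_def)
    qed
  next
    case False
    then show ?thesis by (simp add: S3_def)
  qed
  have cnew: "real h / 2 \<le> real (card (new e))" for e
  proof -
    have "X k0 e \<subseteq> (X k0 e - S1 e) \<union> (S2 e \<union> (S3 e \<union> new e))" by (auto simp: new_def)
    moreover have "finite ((X k0 e - S1 e) \<union> (S2 e \<union> (S3 e \<union> new e)))"
      by (rule finite_subset[of _ "X k0 e"]) (use finX[of k0 e] k0 in \<open>auto simp: S1_def S2_def S3_def new_def\<close>)
    ultimately have "card (X k0 e) \<le> card ((X k0 e - S1 e) \<union> (S2 e \<union> (S3 e \<union> new e)))" by (intro card_mono)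
    also have "\<dots> \<le> card (X k0 e - S1 e) + (card (S2 e) + (card (S3 e) + card (new e)))"
      by (intro order_trans[OF card_Un_le] add_left_mono) simp
    finally have "h \<le> card (X k0 e - S1 e) + (h div 8 + (h div 8 + card (new e)))"
      using c2[of e] c3[of e] cX[of k0 e] k0 by simp
    moreover have "8 * (h div 8) \<le> h" by simp
    ultimately show ?thesis using c1[of e] h0(4) by linarith
  qed
  let ?Lv = "Lv(k0 := new)" and ?N = "N(k0 := NN)"
  have "live k0 ?Lv ?N"
    unfolding live_def
  proof (intro conjI allI impI ballI)
    fix k e assume k: "k0 \<le> k" "k \<le> L"
    show "?Lv k e \<subseteq> X k e"
    proof (cases "k = k0")
      case True
      then show ?thesis by (auto simp: new_def S1_def)
    next
      case False
      then show ?thesis using lvX(1)[of k e] k by simp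
    qed
    show "real h / 2 \<le> real (card (?Lv k e))"
      using lvX(2)[of k e] k cnew[of e] by (cases "k = k0") simp_all
  next
    fix k e v assume v: "v \<in> ?Lv k e" and k: "k0 \<le> k" "k < L"
    have "?N k e v \<subseteq> nbrs (R k) v (?Lv (k + 1) (\<not> e)) \<and> card (?N k e v) = 256 * m \<and> covering k e (?N k e v)"
    proof (cases "k = k0")
      case True
      then have "v \<in> S1 e" "v \<notin> S2 e" using v by (auto simp: new_def)
      then show ?thesis using True NN[of v e] by (simp add: S2_def Lq_def)
    next
      case False
      then show ?thesis using lvN[of v k e] v k by simp
    qed
    then show "?N k e v \<subseteq> nbrs (R k) v (?Lv (k + 1) (\<not> e))" "card (?N k e v) = 256 * m" "covering k e (?N k e v)" by blast+
  next
    fix k e v v' assume v: "v \<in> ?Lv k e" "v' \<in> ?Lv (k + 1) e" and k: "k0 \<le> k" "k + 1 < L"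
    show "linked (k + 1) (?N k e v) (?N (k + 1) e v')"
    proof (cases "k = k0")
      case True
      then have "v \<in> S1 e" "v \<notin> S3 e" "v' \<in> Lv (k0 + 1) e" using v by (auto simp: new_def)
      then show ?thesis using True k by (simp add: S3_def)
    next
      case False
      then show ?thesis using lvL[of v k e v'] v k by simp
    qed
  qed
  then show ?thesis by blast
qed

lemma live_exists: "\<exists>Lv N. live 0 Lv N"
proof -
  have "\<exists>Lv N. live (L - d) Lv N" if "d \<le> L" for d
    using that
  proof (induction d)
    case 0
    \<comment> \<open>At the end of the path no lists are demanded, so whole blob halves with empty
      lists start the backward induction.\<close>
    have "live L X (\<lambda>_ _ _. {})" unfolding live_def using cX by auto
    then show ?case by auto
  next
    case (Suc d)
    then obtain Lv N where "live (L - d) Lv N" by auto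
    moreover have "L - d = (L - Suc d) + 1" using Suc.prems by simp
    ultimately show ?case using live_step[of "L - Suc d" Lv N] Suc.prems by simp
  qed
  from this[of L] show ?thesis by simp
qed

lemma embed_grid:
  assumes s: "s \<le> K" "2 * s \<le> L"
  shows "\<exists>f. (\<forall>i<s. \<forall>j<s. f i j \<in> X (i + j) (odd i)) \<and>
    (\<forall>i<s. \<forall>j. Suc j < s \<longrightarrow> {f i j, f i (Suc j)} \<in> R (i + j)) \<and>
    (\<forall>i j. Suc i < s \<longrightarrow> j < s \<longrightarrow> {f i j, f (Suc i) j} \<in> R (i + j)) \<and>
    (\<forall>i<s. \<forall>i'<i. \<forall>j<s. \<forall>j'<s. i + j = i' + j' \<longrightarrow> f i j \<noteq> f i' j')"
proof -
  obtain Lv N where lv: "live 0 Lv N" using live_exists by blast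
  have lvX: "Lv k e \<subseteq> X k e" "real h / 2 \<le> real (card (Lv k e))" if "k \<le> L" for k e
    using live_subset[OF lv _ that] live_card[OF lv _ that] by simp_all
  have lvN: "N k e v \<subseteq> nbrs (R k) v (Lv (k + 1) (\<not> e))" "card (N k e v) = 256 * m"
    if "v \<in> Lv k e" "k < L" for k e v
    using live_list[OF lv that(1) _ that(2)] by simp_all
  have lvL: "linked (k + 1) (N k e v) (N (k + 1) e v')"
    if "v \<in> Lv k e" "v' \<in> Lv (k + 1) e" "k + 1 < L" for k e v v'
    by (rule live_linked[OF lv that(1,2) _ that(3)]) simp
  define used where "used f r k e = {x. \<exists>i<r. \<exists>j<s. x = f i j \<and> i + j = k \<and> odd i = e}" for f :: "nat \<Rightarrow> nat \<Rightarrow> 'a" and r k e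
  have card_used: "card (used f r k e) \<le> r" for f r k e
  proof -
    \<comment> \<open>A row meets blob \<open>k\<close> in at most one vertex, the one in column
      \<open>k - i\<close>, so the occupied vertices number at most the rows placed so far.\<close>
    have "used f r k e \<subseteq> (\<lambda>i. f i (k - i)) ` {..<r}"
    proof
      fix x assume "x \<in> used f r k e"
      then obtain i j where ij: "i < r" "x = f i j" "i + j = k" by (auto simp: used_def)
      then have "x = f i (k - i)" by auto
      then show "x \<in> (\<lambda>i. f i (k - i)) ` {..<r}" using ij(1) by blast
    qed
    then have "card (used f r k e) \<le> card {..<r}" by (meson card_image_le card_mono finite_imageI finite_lessThan le_trans)
    then show ?thesis by simp
  qed
  \<comment> \<open>The last clause looks ahead: every vertex of the newest row sees fewer than
    \<open>64 * m\<close> occupied vertices in the half where the next row will go. The newest row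
    lies in the opposite halves and does not alter these occupied sets, so the clause can be secured
    while that row is placed. Distinctness is asked only for equal \<open>i + j\<close>, since
    different path positions give different host vertices anyway.\<close>
  define ok where "ok f r \<longleftrightarrow> (\<forall>i<r. \<forall>j<s. f i j \<in> Lv (i + j) (odd i)) \<and>
    (\<forall>i<r. \<forall>j. Suc j < s \<longrightarrow> {f i j, f i (Suc j)} \<in> R (i + j)) \<and>
    (\<forall>i j. Suc i < r \<longrightarrow> j < s \<longrightarrow> {f i j, f (Suc i) j} \<in> R (i + j)) \<and>
    (\<forall>i<r. \<forall>i'<i. \<forall>j<s. \<forall>j'<s. i + j = i' + j' \<longrightarrow> f i j \<noteq> f i' j') \<and>
    (\<forall>i j. r = Suc i \<longrightarrow> j < s \<longrightarrow> card (nbrs G (f i j) (used f r (r + j) (\<not> odd i))) < 64 * m)"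
    for f :: "nat \<Rightarrow> nat \<Rightarrow> 'a" and r
  have "\<exists>f. ok f r" if "r \<le> s" for r
    using that
  proof (induction r)
    case 0
    then show ?case by (auto simp: ok_def)
  next
    case (Suc r)
    then obtain f where f: "ok f r" by auto
    note f' = f[unfolded ok_def]
    have f1: "f i j \<in> Lv (i + j) (odd i)" if "i < r" "j < s" for i j
      by (rule conjunct1[OF f', rule_format, OF that])
    have f2: "{f i j, f i (Suc j)} \<in> R (i + j)" if "i < r" "Suc j < s" for i j
      by (rule conjunct1[OF conjunct2[OF f'], rule_format, OF that])
    have f3: "{f i j, f (Suc i) j} \<in> R (i + j)" if "Suc i < r" "j < s" for i j
      by (rule conjunct1[OF conjunct2[OF conjunct2[OF f']], rule_format, OF that])
    have f4: "f i j \<noteq> f i' j'" if "i < r" "i' < i" "j < s" "j' < s" "i + j = i' + j'" for i i' j j'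
      by (rule conjunct1[OF conjunct2[OF conjunct2[OF conjunct2[OF f']]], rule_format, OF that])
    have f5: "card (nbrs G (f i j) (used f r (r + j) (\<not> odd i))) < 64 * m" if "r = Suc i" "j < s" for i j
      by (rule conjunct2[OF conjunct2[OF conjunct2[OF conjunct2[OF f']]], rule_format, OF that])
    let ?e = "odd r"
    have usedW: "used f r k e \<subseteq> X k e" if "k \<le> L" for k e
    proof
      fix x assume "x \<in> used f r k e"
      then obtain i j where "i < r" "j < s" "x = f i j" "i + j = k" "odd i = e" by (auto simp: used_def)
      then have "x \<in> Lv k e" using f1 by blast
      then show "x \<in> X k e" using lvX(1)[OF that] by blast
    qed
    have "\<exists>u. (\<forall>j<s. u j \<in> Lv (r + j) ?e \<and> (\<forall>i. r = Suc i \<longrightarrow> {f i j, u j} \<in> R (i + j)) \<and> u j \<notin> used f r (r + j) ?e \<and>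
         card (nbrs G (u j) (used f r (r + j + 1) (\<not> ?e))) < 64 * m) \<and>
       (\<forall>j. Suc j < s \<longrightarrow> {u j, u (Suc j)} \<in> R (r + j))"
    proof (cases r)
      case 0
      \<comment> \<open>The first row has no lists to obey; density alone joins any two sets of at
        least \<open>\<delta> * h\<close> vertices in consecutive live sets.\<close>
      define hh where "hh = nat \<lceil>\<delta> * real h\<rceil>"
      have hh1: "\<delta> * real h \<le> real hh" unfolding hh_def by (rule real_nat_ceiling_ge)
      have hh2: "real hh \<le> real h / 16 + 1" unfolding hh_def using h0 by linarith
      have hh3: "0 < hh" using hh1 h0 by (cases hh) auto
      have "\<exists>v. (\<forall>j<s. v j \<in> Lv j False) \<and> (\<forall>j. Suc j < s \<longrightarrow> {v j, v (Suc j)} \<in> R j)"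
      proof (rule layered_path[OF _ _ hh3])
        fix j assume j: "j < s"
        have jL: "j \<le> L" using j s by simp
        show "finite (Lv j False)" using finite_subset[OF lvX(1)[OF jL] finX[OF jL]] .
        have "real (2 * hh) \<le> real h / 2" using hh2 h0(1) by simp
        then have "real (2 * hh) \<le> real (card (Lv j False))" using lvX(2)[OF jL, of False] by linarith
        then show "2 * hh \<le> card (Lv j False)" by simp
      next
        fix j A B assume j: "Suc j < s" and AB: "A \<subseteq> Lv j False" "B \<subseteq> Lv (Suc j) False" "card A = hh" "card B = hh"
        have jL: "j < L" "j \<le> L" "Suc j \<le> L" using j s by simp_all
        have sub: "A \<subseteq> X j False" "B \<subseteq> X (j + 1) False"
          using order_trans[OF AB(1) lvX(1)[OF jL(2)]] order_trans[OF AB(2) lvX(1)[OF jL(3)]] by simp_all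
        have "1 / (8 * real q) * real (card A) * real (card B) \<le> real (edge_count (R j) A B)"
          using hh1 AB(3,4) by (intro dense_pairD[OF dense[OF jL(1)] sub]) simp_all
        moreover have "0 < 1 / (8 * real q) * real (card A) * real (card B)" using AB(3,4) hh3 q by simp
        ultimately have "0 < edge_count (R j) A B" by simp
        then have "{(a, b). a \<in> A \<and> b \<in> B \<and> {a, b} \<in> R j} \<noteq> {}" unfolding edge_count_def by (metis card.empty less_irrefl)
        then show "\<exists>a\<in>A. \<exists>b\<in>B. {a, b} \<in> R j" by blast
      qed
      then obtain v where v: "\<forall>j<s. v j \<in> Lv j False" "\<forall>j. Suc j < s \<longrightarrow> {v j, v (Suc j)} \<in> R j" by blast
      have "used f r k e = {}" for k e using 0 by (simp add: used_def)
      then show ?thesis using v 0 m(1) by (intro exI[of _ v]) (simp add: nbrs_def)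
    next
      case (Suc i)
      have oi: "odd i = (\<not> ?e)" unfolding Suc by simp
      have ir: "i < r" using Suc by simp
      define U where "U j = used f r (r + j + 1) (\<not> ?e)" for j
      define Fl where "Fl j = {u \<in> X (r + j) ?e. 64 * m \<le> card (nbrs G u (U j))}" for j
      \<comment> \<open>What remains of the list of the vertex above after removing occupied
        vertices and those that would violate the look-ahead clause.\<close>
      define S where "S j = N (i + j) (\<not> ?e) (f i j) - used f r (r + j) ?e - Fl j" for j
      have rL: "r + j < L" "r + j + 1 \<le> L" "r + j \<le> L" "i + j < L" if "j < s" for j using that Suc.prems s Suc by simp_all
      have fL: "f i j \<in> Lv (i + j) (\<not> ?e)" if "j < s" for j
        using f1[OF ir that] unfolding oi .
      have Nsub: "N (i + j) (\<not> ?e) (f i j) \<subseteq> nbrs (R (i + j)) (f i j) (Lv (r + j) ?e)" "card (N (i + j) (\<not> ?e) (f i j)) = 256 * m" if "j < s" for j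
      proof -
        have "i + j + 1 = r + j" using Suc by simp
        then show "N (i + j) (\<not> ?e) (f i j) \<subseteq> nbrs (R (i + j)) (f i j) (Lv (r + j) ?e)" "card (N (i + j) (\<not> ?e) (f i j)) = 256 * m"
          using lvN[OF fL[OF that] rL(4)[OF that]] by (simp_all only: not_not)
      qed
      have NX: "N (i + j) (\<not> ?e) (f i j) \<subseteq> X (r + j) ?e" if "j < s" for j
        using order_trans[OF Nsub(1)[OF that] nbrs_subset] lvX(1)[OF rL(3)[OF that]] by (rule order_trans)
      have cFl: "card (Fl j) < 32 * m" if j: "j < s" for j
      proof (rule card_less_if_no_subset)
        fix P assume P: "P \<subseteq> Fl j" "card P = 32 * m"
        have UX: "U j \<subseteq> X (r + j + 1) (\<not> ?e)" unfolding U_def using rL(2)[OF j] by (rule usedW)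
        then have UW: "U j \<subseteq> W" using XW[OF rL(2)[OF j]] by (rule order_trans)
        have FX: "Fl j \<subseteq> X (r + j) ?e" by (auto simp: Fl_def)
        have PX: "P \<subseteq> X (r + j) ?e" using P(1) FX by (rule order_trans)
        have "P \<subseteq> W - U j" using PX XW[OF rL(3)[OF j], of ?e] UX disj1[OF rL(1)[OF j], of ?e "\<not> ?e"] by blast
        moreover have "card (U j) \<le> K" using card_used[of f r "r + j + 1" "\<not> ?e"] Suc.prems s(1) unfolding U_def by linarith
        ultimately obtain v where v: "v \<in> P" "card (nbrs G v (U j)) < 64 * m"
          using host_flood[unfolded few_flooded_def, rule_format, OF UW _ _ P(2)] by blast
        then show False using P(1) by (auto simp: Fl_def)
      qed
      have cUsed: "card (N (i + j) (\<not> ?e) (f i j) \<inter> used f r (r + j) ?e) < 64 * m" if j: "j < s" for j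
      proof -
        have "N (i + j) (\<not> ?e) (f i j) \<inter> used f r (r + j) ?e \<subseteq> nbrs G (f i j) (used f r (r + j) (\<not> odd i))"
          using Nsub(1)[OF j] RG[of "i + j"] unfolding nbrs_def oi not_not by blast
        moreover have "finite (nbrs G (f i j) (used f r (r + j) (\<not> odd i)))"
          using finite_subset[OF order_trans[OF nbrs_subset usedW[OF rL(3)[OF j]]] finX[OF rL(3)[OF j]]] .
        ultimately have "card (N (i + j) (\<not> ?e) (f i j) \<inter> used f r (r + j) ?e) \<le> card (nbrs G (f i j) (used f r (r + j) (\<not> odd i)))"
          by (intro card_mono)
        then show ?thesis using f5[OF Suc j] by linarith
      qed
      have "\<exists>u. (\<forall>j<s. u j \<in> S j) \<and> (\<forall>j. Suc j < s \<longrightarrow> {u j, u (Suc j)} \<in> R (r + j))"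
      proof (rule layered_path)
        show "0 < 32 * m" using m(1) by simp
        fix j assume j: "j < s"
        have finN: "finite (N (i + j) (\<not> ?e) (f i j))" using finite_subset[OF NX[OF j] finX[OF rL(3)[OF j]]] .
        then show finS: "finite (S j)" by (simp add: S_def)
        have fFl: "finite (Fl j)" using finX[OF rL(3)[OF j]] by (simp add: Fl_def)
        have "N (i + j) (\<not> ?e) (f i j) \<subseteq> (N (i + j) (\<not> ?e) (f i j) \<inter> used f r (r + j) ?e) \<union> (Fl j \<union> S j)" by (auto simp: S_def)
        then have "256 * m \<le> card ((N (i + j) (\<not> ?e) (f i j) \<inter> used f r (r + j) ?e) \<union> (Fl j \<union> S j))"
          unfolding Nsub(2)[OF j, symmetric] using finN finS fFl by (intro card_mono) simp_all
        also have "\<dots> \<le> card (N (i + j) (\<not> ?e) (f i j) \<inter> used f r (r + j) ?e) + (card (Fl j) + card (S j))"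
          by (intro order_trans[OF card_Un_le] add_left_mono) simp
        finally show "2 * (32 * m) \<le> card (S j)" using cUsed[OF j] cFl[OF j] by linarith
      next
        fix j A B assume j: "Suc j < s" and AB: "A \<subseteq> S j" "B \<subseteq> S (Suc j)" "card A = 32 * m" "card B = 32 * m"
        have js: "j < s" using j by simp
        have A: "A \<subseteq> N (i + j) (\<not> ?e) (f i j)" using AB(1) by (auto simp: S_def)
        have B: "B \<subseteq> N (i + j + 1) (\<not> ?e) (f i (Suc j))" using AB(2) by (auto simp: S_def)
        have "f i (Suc j) \<in> Lv (i + j + 1) (\<not> ?e)" using fL[OF j] by simp
        then have "linked (i + j + 1) (N (i + j) (\<not> ?e) (f i j)) (N (i + j + 1) (\<not> ?e) (f i (Suc j)))"
          using rL(1)[OF js] Suc by (intro lvL[OF fL[OF js]]) simp_all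
        then have "\<exists>a\<in>A. nbrs (R (i + j + 1)) a B \<noteq> {}" using A B AB(3,4) unfolding linked_def by simp
        moreover have "i + j + 1 = r + j" using Suc by simp
        ultimately have "\<exists>a\<in>A. nbrs (R (r + j)) a B \<noteq> {}" by (simp only:)
        then show "\<exists>a\<in>A. \<exists>b\<in>B. {a, b} \<in> R (r + j)" unfolding nbrs_def by blast
      qed
      then obtain u where u: "\<forall>j<s. u j \<in> S j" "\<forall>j. Suc j < s \<longrightarrow> {u j, u (Suc j)} \<in> R (r + j)" by blast
      have "u j \<in> Lv (r + j) ?e \<and> (\<forall>i. r = Suc i \<longrightarrow> {f i j, u j} \<in> R (i + j)) \<and> u j \<notin> used f r (r + j) ?e \<and>
         card (nbrs G (u j) (used f r (r + j + 1) (\<not> ?e))) < 64 * m" if j: "j < s" for j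
      proof -
        have uS: "u j \<in> N (i + j) (\<not> ?e) (f i j)" "u j \<notin> used f r (r + j) ?e" "u j \<notin> Fl j" using u(1) j by (auto simp: S_def)
        have "u j \<in> nbrs (R (i + j)) (f i j) (Lv (r + j) ?e)" using uS(1) Nsub(1)[OF j] by blast
        then have a: "u j \<in> Lv (r + j) ?e" "{f i j, u j} \<in> R (i + j)" by (auto simp: nbrs_def)
        have "u j \<in> X (r + j) ?e" using uS(1) NX[OF j] by blast
        then have "card (nbrs G (u j) (U j)) < 64 * m" using uS(3) by (auto simp: Fl_def)
        moreover have "i' = i" if "r = Suc i'" for i' using that Suc by simp
        ultimately show ?thesis using a uS(2) unfolding U_def by blast
      qed
      then show ?thesis using u(2) by blast
    qed
    then obtain u where u1: "\<And>j. j < s \<Longrightarrow> u j \<in> Lv (r + j) ?e" and u2: "\<And>i j. j < s \<Longrightarrow> r = Suc i \<Longrightarrow> {f i j, u j} \<in> R (i + j)"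
      and u3: "\<And>j. j < s \<Longrightarrow> u j \<notin> used f r (r + j) ?e" and u4: "\<And>j. j < s \<Longrightarrow> card (nbrs G (u j) (used f r (r + j + 1) (\<not> ?e))) < 64 * m"
      and u5: "\<And>j. Suc j < s \<Longrightarrow> {u j, u (Suc j)} \<in> R (r + j)"
      by blast
    define f' where "f' = f(r := u)"
    have f'old: "f' i = f i" if "i < r" for i using that by (simp add: f'_def)
    have f'new: "f' r = u" by (simp add: f'_def)
    have used': "used f' (Suc r) k (\<not> ?e) = used f r k (\<not> ?e)" for k
    proof -
      have "x \<in> used f' (Suc r) k (\<not> ?e) \<longleftrightarrow> x \<in> used f r k (\<not> ?e)" for x
        unfolding used_def less_Suc_eq using f'old by auto
      then show ?thesis by blast
    qed
    have notin: "f' r j \<noteq> f' i' j'" if h: "i' < r" "j < s" "j' < s" "r + j = i' + j'" for i' j j'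
    proof (cases "odd i' = ?e")
      case True
      then have "f i' j' \<in> used f r (r + j) ?e" unfolding used_def using h by auto
      then show ?thesis using u3[OF h(2)] f'old[OF h(1)] f'new by auto
    next
      case False
      then have "f i' j' \<in> Lv (r + j) (\<not> ?e)" using f1[OF h(1,3)] h(4) by simp
      moreover have kL: "r + j \<le> L" using h(2) Suc.prems s by simp
      ultimately have "f i' j' \<in> X (r + j) (\<not> ?e)" "u j \<in> X (r + j) ?e"
        using lvX(1)[OF kL] u1[OF h(2)] by blast+
      then show ?thesis using disj0[OF kL, of ?e] f'old[OF h(1)] f'new by auto
    qed
    have "ok f' (Suc r)"
      unfolding ok_def
    proof (intro conjI allI impI)
      show "f' i j \<in> Lv (i + j) (odd i)" if "i < Suc r" "j < s" for i j
        using that f1[of i j] u1[of j] f'old[of i] f'new by (cases "i = r") simp_all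
      show "{f' i j, f' i (Suc j)} \<in> R (i + j)" if "i < Suc r" "Suc j < s" for i j
        using that f2[of i j] u5[of j] f'old[of i] f'new by (cases "i = r") simp_all
      show "{f' i j, f' (Suc i) j} \<in> R (i + j)" if "Suc i < Suc r" "j < s" for i j
        using that f3[of i j] u2[of j i] f'old[of i] f'old[of "Suc i"] f'new by (cases "Suc i = r") simp_all
      show "f' i j \<noteq> f' i' j'" if "i < Suc r" "i' < i" "j < s" "j' < s" "i + j = i' + j'" for i i' j j'
        using that f4[of i i' j j'] notin[of i' j j'] f'old[of i] f'old[of i'] by (cases "i = r") simp_all
      show "card (nbrs G (f' i j) (used f' (Suc r) (Suc r + j) (\<not> odd i))) < 64 * m" if "Suc r = Suc i" "j < s" for i j
        using that u4[of j] used'[of "r + j + 1"] f'new by simp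
    qed
    then show ?case by blast
  qed
  then obtain f where f: "ok f s" by blast
  have "f i j \<in> X (i + j) (odd i)" if "i < s" "j < s" for i j
  proof -
    have "f i j \<in> Lv (i + j) (odd i)" by (rule conjunct1[OF f[unfolded ok_def], rule_format, OF that])
    moreover have "i + j \<le> L" using that s by simp
    ultimately show ?thesis using lvX(1) by blast
  qed
  then show ?thesis using f unfolding ok_def by (intro exI[of _ f]) simp
qed

end

subsection \<open>The blow-up\<close>

locale host_graph =
  fixes V :: "nat set" and E :: "nat \<Rightarrow> nat \<Rightarrow> bool" and c :: "nat \<Rightarrow> nat" and G :: "nat set set" and \<kappa> N0 :: nat
  assumes finV: "finite V" and symE: "\<And>x y. E x y \<Longrightarrow> E y x" and EV: "\<And>x y. E x y \<Longrightarrow> x \<in> V"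
    and c0: "\<And>x. x \<in> V \<Longrightarrow> c x < \<kappa>"
    and c1: "\<And>x y. E x y \<Longrightarrow> c x \<noteq> c y" and c2: "\<And>x y z. E x y \<Longrightarrow> E x z \<Longrightarrow> y \<noteq> z \<Longrightarrow> c y \<noteq> c z"
    and G: "G \<subseteq> pairs {..<\<kappa> * N0}"
begin

definition W where "W = {..<\<kappa> * N0}"
text \<open>Blobs depend only on the colour, so all vertices of one colour share a block of
  \<open>N0\<close> indices. One random graph on \<open>\<kappa> * N0\<close> indices thus serves
  the whole host, however large \<open>V\<close> is; disjointness is needed only up to distance
  two.\<close>

definition B where "B x = {c x * N0..<(c x + 1) * N0}"
definition vertex :: "nat \<Rightarrow> nat \<Rightarrow> nat" where "vertex x a = prod_encode (x, a)"
definition host_verts where "host_verts = {vertex x a | x a. x \<in> V \<and> a \<in> B x}"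
definition host_edges where "host_edges = {{vertex x a, vertex y b} | x y a b. E x y \<and> a \<in> B x \<and> b \<in> B y \<and> {a, b} \<in> G}"

lemma vertex_eq: "vertex x a = vertex y b \<longleftrightarrow> x = y \<and> a = b"
  by (simp add: vertex_def)

lemma EV2: "E x y \<Longrightarrow> y \<in> V" using EV symE by blast

lemma B_disjoint: "c x \<noteq> c y \<Longrightarrow> B x \<inter> B y = {}"
proof -
  assume ne: "c x \<noteq> c y"
  have "False" if a: "a \<in> B x" "a \<in> B y" for a
  proof -
    have "a < (c x + 1) * N0" using a by (simp add: B_def)
    then have "0 < N0" by (cases N0) simp_all
    then have "a div N0 = c x" "a div N0 = c y" using a by (auto simp: B_def mult.commute intro!: div_nat_eqI)
    then show False using ne by simp
  qed
  then show ?thesis by blast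
qed

lemma BW: "x \<in> V \<Longrightarrow> B x \<subseteq> W"
proof -
  assume "x \<in> V"
  then have "c x + 1 \<le> \<kappa>" using c0[of x] by simp
  then have "(c x + 1) * N0 \<le> \<kappa> * N0" by (rule mult_le_mono1)
  then show ?thesis unfolding B_def W_def by (meson atLeastLessThan_iff lessThan_iff less_le_trans subsetI)
qed

lemma finite_B: "finite (B x)" by (simp add: B_def)

lemma card_B: "card (B x) = N0" by (simp add: B_def)

lemma finite_G: "finite G"
  by (rule finite_subset[OF G finite_pairs]) simp

lemma host_simple: "finite_simple_graph (host_verts, host_edges)"
  unfolding finite_simple_graph_def
proof (intro conjI ballI)
  have "host_verts = (\<lambda>(x, a). vertex x a) ` (SIGMA x:V. B x)" by (auto simp: host_verts_def)
  then show "finite (verts_of (host_verts, host_edges))" using finV finite_B by simp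
next
  fix e assume "e \<in> edges_of (host_verts, host_edges)"
  then obtain x y a b where e: "e = {vertex x a, vertex y b}" "E x y" "a \<in> B x" "b \<in> B y" by (auto simp: host_edges_def)
  have "x \<noteq> y" using c1 e(2) by blast
  then have "vertex x a \<noteq> vertex y b" by (simp add: vertex_eq)
  then show "card e = 2" using e(1) by simp
  show "e \<subseteq> verts_of (host_verts, host_edges)" 
    using e EV[OF e(2)] EV2[OF e(2)] unfolding host_verts_def by auto
qed

text \<open>Neighbours of a vertex have distinct colours, so degrees are at most
  \<open>\<kappa>\<close>, and each ordered edge of the reduced graph carries at most one host edge
  per edge of \<open>G\<close>.\<close>

lemma card_host_edges: "card host_edges \<le> card V * \<kappa> * card G"
proof -
  define EE where "EE = (SIGMA x:V. {y. E x y})"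
  have deg: "finite {y. E x y}" "card {y. E x y} \<le> \<kappa>" for x
  proof -
    have sub: "{y. E x y} \<subseteq> V" using EV2 by blast
    then show "finite {y. E x y}" using finV by (rule finite_subset)
    have "inj_on c {y. E x y}" using c2 by (intro inj_onI) blast
    moreover have "c ` {y. E x y} \<subseteq> {..<\<kappa>}" using c0 sub by auto
    ultimately show "card {y. E x y} \<le> \<kappa>" using card_inj_on_le[of c "{y. E x y}" "{..<\<kappa>}"] by simp
  qed
  have finEE: "finite EE" unfolding EE_def using finV deg(1) by (intro finite_SigmaI)
  have cEE: "card EE \<le> card V * \<kappa>"
  proof -
    have "card EE = (\<Sum>x\<in>V. card {y. E x y})" unfolding EE_def using finV deg(1) by (intro card_SigmaI) auto
    also have "\<dots> \<le> (\<Sum>x\<in>V. \<kappa>)" using deg(2) by (intro sum_mono)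
    finally show ?thesis by simp
  qed
  \<comment> \<open>As \<open>B x\<close> and \<open>B y\<close> are disjoint, the unordered edge of
    \<open>G\<close> determines which end belongs to \<open>x\<close> and which to
    \<open>y\<close>.\<close>
  define F where "F = (\<lambda>((x, y), e). vertex x ` (e \<inter> B x) \<union> vertex y ` (e \<inter> B y))"
  have "host_edges \<subseteq> F ` (EE \<times> G)"
  proof
    fix e assume "e \<in> host_edges"
    then obtain x y a b where e: "e = {vertex x a, vertex y b}" "E x y" "a \<in> B x" "b \<in> B y" "{a, b} \<in> G" by (auto simp: host_edges_def)
    have "B x \<inter> B y = {}" using c1[OF e(2)] by (rule B_disjoint)
    then have "{a, b} \<inter> B x = {a}" "{a, b} \<inter> B y = {b}" using e(3,4) by auto
    then have "e = F ((x, y), {a, b})" using e(1) by (simp add: F_def insert_commute)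
    moreover have "((x, y), {a, b}) \<in> EE \<times> G" using e EV by (simp add: EE_def)
    ultimately show "e \<in> F ` (EE \<times> G)" by blast
  qed
  then have "card host_edges \<le> card (EE \<times> G)"
    using finEE finite_G by (meson card_image_le card_mono finite_SigmaI finite_imageI le_trans)
  also have "\<dots> \<le> card V * \<kappa> * card G" using cEE by (simp add: card_cartesian_product mult_le_mono1)
  finally show ?thesis .
qed

text \<open>Colours are pulled back to pairs of indices, so that all these sets are subgraphs of the single
  random graph \<open>G\<close> and its host properties apply to them.\<close>

definition J :: "(nat set \<Rightarrow> bool) \<Rightarrow> nat \<Rightarrow> nat \<Rightarrow> bool \<Rightarrow> nat set set" where
  "J col x y b = {{a, a'} | a a'. a \<in> B x \<and> a' \<in> B y \<and> {a, a'} \<in> G \<and> col {vertex x a, vertex y a'} = b}"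

lemma J_sym: "J col x y b = J col y x b"
proof -
  have "J col x y b \<subseteq> J col y x b" for x y
  proof
    fix e assume "e \<in> J col x y b"
    then obtain a a' where "e = {a, a'}" "a \<in> B x" "a' \<in> B y" "{a, a'} \<in> G" "col {vertex x a, vertex y a'} = b" by (auto simp: J_def)
    then show "e \<in> J col y x b" unfolding J_def by (intro CollectI exI[of _ a'] exI[of _ a]) (simp add: insert_commute)
  qed
  then show ?thesis by blast
qed

lemma J_D:
  assumes "{a, a'} \<in> J col x y b" "a \<in> B x" "a' \<in> B y" "E x y"
  shows "{vertex x a, vertex y a'} \<in> {e \<in> host_edges. col e = b}"
proof -
  obtain u u' where u: "{a, a'} = {u, u'}" "u \<in> B x" "u' \<in> B y" "{u, u'} \<in> G" "col {vertex x u, vertex y u'} = b"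
    using assms(1) by (auto simp: J_def)
  have "B x \<inter> B y = {}" using c1[OF assms(4)] by (rule B_disjoint)
  then have "a = u" "a' = u'" using u(1-3) assms(2,3) by (auto simp: doubleton_eq_iff)
  then show ?thesis using u assms unfolding host_edges_def by blast
qed

lemma blobs_J: "0 \<le> p \<Longrightarrow> blobs V E c G W p (J col) B"
proof (unfold_locales, goal_cases)
  case (10 x y a b)
  then show ?case unfolding J_def by blast
qed (use finV symE EV c1 c2 BW B_disjoint in \<open>auto simp: W_def\<close>)

text \<open>Edges of the reduced graph are coloured by whether red is dense on them; outside
  \<open>D\<close> an edge coloured \<open>False\<close> is then dense in blue. Losing a tenth of at
  least \<open>90 * (2 * s + 1)\<close> vertices leaves the \<open>80 * (2 * s + 1)\<close> that
  guarantee a monochromatic path on \<open>2 * s + 1\<close> vertices. The blobs along it are halved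
  by row parity.\<close>

lemma arrows_grid:
  assumes V: "90 * (2 * s + 1) \<le> card V"
    and expand: "\<And>A B. A \<subseteq> V \<Longrightarrow> B \<subseteq> V \<Longrightarrow> A \<inter> B = {} \<Longrightarrow> 10 * (2 * s + 1) \<le> card A \<Longrightarrow> 10 * (2 * s + 1) \<le> card B \<Longrightarrow>
      \<exists>a\<in>A. \<exists>b\<in>B. E a b"
    and reg: "\<And>col. \<exists>X' t' D. (\<forall>x\<in>V. X' x \<subseteq> B x \<and> card (X' x) = t') \<and> \<nu> * real N0 \<le> real t' \<and>
      D \<subseteq> V \<and> real (card D) \<le> 1 / 10 * real (card V) \<and>
      (\<forall>x\<in>V - D. \<forall>y\<in>V - D. E x y \<longrightarrow>
        (\<exists>b. dense_pair (J col x y b) (\<delta> / 3 * real t') (1 / real q / 8) (X' x) (X' y)))"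
    and q: "0 < q" and big: "3 * 4096 * real q \<le> \<nu> * real N0"
    and host: "\<And>h. \<nu> / 3 * real N0 \<le> real h \<Longrightarrow> h \<le> \<kappa> * N0 \<Longrightarrow> host_at G W s q h"
  shows "arrows (host_verts, host_edges) (grid_graph s)"
  unfolding arrows_def
proof (intro allI)
  fix col :: "nat set \<Rightarrow> bool"
  obtain X t D where X: "\<And>x. x \<in> V \<Longrightarrow> X x \<subseteq> B x" "\<And>x. x \<in> V \<Longrightarrow> card (X x) = t" and t: "\<nu> * real N0 \<le> real t"
    and D: "D \<subseteq> V" "real (card D) \<le> 1 / 10 * real (card V)"
    and good: "\<And>x y. x \<in> V - D \<Longrightarrow> y \<in> V - D \<Longrightarrow> E x y \<Longrightarrow>
        \<exists>b. dense_pair (J col x y b) (\<delta> / 3 * real t) (1 / real q / 8) (X x) (X y)"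
    using reg[of col] by blast
  define cc where "cc x y \<longleftrightarrow> dense_pair (J col x y True) (\<delta> / 3 * real t) (1 / real q / 8) (X x) (X y)" for x y
  have cc_sym: "cc x y = cc y x" for x y unfolding cc_def using dense_pair_commute J_sym by metis
  have finD: "finite D" using D(1) finV by (rule finite_subset)
  have "\<exists>b xs. distinct xs \<and> set xs \<subseteq> V - D \<and> length xs = 2 * s + 1 \<and> successively (\<lambda>x y. E x y \<and> cc x y = b) xs"
  proof (rule two_colour_path)
    show "finite (V - D)" using finV by simp
    show "80 * (2 * s + 1) \<le> card (V - D)"
      using D V card_Diff_subset[OF finD D(1)] by linarith
    show "\<exists>a\<in>A. \<exists>b\<in>B. E a b" if "A \<subseteq> V - D" "B \<subseteq> V - D" "A \<inter> B = {}" "10 * (2 * s + 1) \<le> card A" "10 * (2 * s + 1) \<le> card B" for A B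
      using that by (intro expand) auto
  qed (use symE cc_sym in auto)
  then obtain b xs where xs: "distinct xs" "set xs \<subseteq> V - D" "length xs = 2 * s + 1"
    "successively (\<lambda>x y. E x y \<and> cc x y = b) xs" by blast
  \<comment> \<open>Rounding is absorbed by \<open>t / 3 \<le> h\<close>; this is why the density
    scale is \<open>\<delta> / 3\<close> and the range of \<open>h\<close> starts at
    \<open>\<nu> / 3 * N0\<close>.\<close>
  define h where "h = t div 2"
  define L where "L = 2 * s"
  have xk: "xs ! k \<in> V" "xs ! k \<in> V - D" if "k \<le> L" for k
  proof -
    have "xs ! k \<in> set xs" using that xs(3) by (intro nth_mem) (simp add: L_def)
    then show "xs ! k \<in> V" "xs ! k \<in> V - D" using xs(2) by auto
  qed
  have step: "E (xs ! k) (xs ! (k + 1))" "cc (xs ! k) (xs ! (k + 1)) = b" if "k < L" for k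
    using successively_nth[OF xs(4), of k] that xs(3) by (simp_all add: L_def)
  have dJ: "dense_pair (J col (xs ! k) (xs ! (k + 1)) b) (\<delta> / 3 * real t) (1 / real q / 8) (X (xs ! k)) (X (xs ! (k + 1)))"
    if k: "k < L" for k
  proof (cases b)
    case True
    then show ?thesis using step(2)[OF k] by (simp add: cc_def)
  next
    case False
    obtain b' where "dense_pair (J col (xs ! k) (xs ! (k + 1)) b') (\<delta> / 3 * real t) (1 / real q / 8) (X (xs ! k)) (X (xs ! (k + 1)))"
      using good[OF xk(2) xk(2) step(1)[OF k]] k by auto
    moreover have "b' \<noteq> True" using calculation False step(2)[OF k] by (auto simp: cc_def)
    ultimately show ?thesis using False by simp
  qed
  have t3: "3 * 4096 * real q \<le> real t" using big t by linarith
  have q1: "1 \<le> real q" using q by simp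
  have h: "real t / 3 \<le> real h" "real h \<le> real t"
  proof -
    have "t \<le> 2 * h + 1" "2 * h \<le> t" unfolding h_def by simp_all
    then have "real t \<le> 2 * real h + 1" "real h \<le> real t" by linarith+
    then show "real t / 3 \<le> real h" "real h \<le> real t" using t3 q1 by linarith+
  qed
  have "\<exists>P. P \<subseteq> X x \<and> card P = h" if "x \<in> V" for x
    by (rule obtain_subset_with_card_n[of h "X x"]) (use X(2)[OF that] in \<open>auto simp: h_def\<close>)
  then have "\<forall>x\<in>V. \<exists>P. P \<subseteq> X x \<and> card P = h" by blast
  from bchoice[OF this] obtain P where P0: "\<forall>x\<in>V. P x \<subseteq> X x \<and> card (P x) = h" ..
  have P: "P x \<subseteq> X x" "card (P x) = h" if "x \<in> V" for x using bspec[OF P0 that] by simp_all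
  have finXx: "finite (X x)" if "x \<in> V" for x using X(1)[OF that] finite_B by (rule finite_subset)
  have "\<exists>P'. P' \<subseteq> X x - P x \<and> card P' = h" if x: "x \<in> V" for x
  proof -
    have "card (X x - P x) = t - h" using P[OF x] X(2)[OF x] finXx[OF x] by (simp add: card_Diff_subset finite_subset)
    then have "h \<le> card (X x - P x)" by (simp add: h_def)
    then show ?thesis by (rule obtain_subset_with_card_n) blast
  qed
  then have "\<forall>x\<in>V. \<exists>P'. P' \<subseteq> X x - P x \<and> card P' = h" by blast
  from bchoice[OF this] obtain P' where P'0: "\<forall>x\<in>V. P' x \<subseteq> X x - P x \<and> card (P' x) = h" ..
  have P': "P' x \<subseteq> X x - P x" "card (P' x) = h" if "x \<in> V" for x using bspec[OF P'0 that] by simp_all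
  define Y where "Y k e = (if e then P (xs ! k) else P' (xs ! k))" for k and e :: bool
  define R where "R k = J col (xs ! k) (xs ! (k + 1)) b" for k
  have YX: "Y k e \<subseteq> X (xs ! k)" if "k \<le> L" for k e using P(1) P'(1) xk(1)[OF that] unfolding Y_def by auto
  have YB: "Y k e \<subseteq> B (xs ! k)" if "k \<le> L" for k e using YX[OF that] X(1)[OF xk(1)[OF that]] by (rule order_trans)
  have tB: "t \<le> \<kappa> * N0"
  proof -
    have x0: "xs ! 0 \<in> V" using xk(1)[of 0] by simp
    have "t \<le> N0" using card_mono[OF finite_B X(1)[OF x0]] X(2)[OF x0] card_B by simp
    moreover have "0 < \<kappa>" using c0[OF x0] by simp
    ultimately show ?thesis by (metis One_nat_def Suc_leI le_trans mult_le_mono1 nat_mult_1)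
  qed
  interpret coloured_path G W s q h L Y R
  proof (unfold_locales, goal_cases)
    case 1
    then show ?case by (simp add: W_def)
  next
    case 2
    show ?case
    proof (rule host)
      show "\<nu> / 3 * real N0 \<le> real h" using t h by simp
      show "h \<le> \<kappa> * N0" using h(2) tB by simp
    qed
  next
    case 3
    then show ?case by (rule q)
  next
    case 4
    have "real (4096 * q) \<le> real h" using t3 h(1) by simp
    then show ?case by (simp only: of_nat_le_iff)
  next
    case (5 k e)
    then show ?case using YB[of k e] BW[OF xk(1)[of k]] by auto
  next
    case (6 k e)
    then show ?case using P(2) P'(2) xk(1)[of k] by (simp add: Y_def)
  next
    case (7 e k)
    then show ?case using P'(1)[OF xk(1)[of k]] unfolding Y_def by auto
  next
    case (8 k e e')
    then have "B (xs ! k) \<inter> B (xs ! (k + 1)) = {}" using c1[OF step(1)[of k]] by (intro B_disjoint)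
    then show ?case using YB[of k e] YB[of "k + 1" e'] 8 by auto
  next
    case (9 k e e')
    have "E (xs ! (k + 1)) (xs ! k)" using symE[OF step(1)[of k]] 9 by simp
    moreover have "E (xs ! (k + 1)) (xs ! (k + 2))" using step(1)[of "k + 1"] 9 by simp
    moreover have "xs ! k \<noteq> xs ! (k + 2)" using xs(1,3) 9 by (simp add: nth_eq_iff_index_eq L_def)
    ultimately have "B (xs ! k) \<inter> B (xs ! (k + 2)) = {}" using c2 by (intro B_disjoint)
    then show ?case using YB[of k e] YB[of "k + 2" e'] 9 by auto
  next
    case (10 k)
    then show ?case by (auto simp: R_def J_def)
  next
    case (11 k e e')
    have "\<delta> / 3 * real t \<le> \<delta> * real h" using mult_left_mono[OF h(1), of \<delta>] theta_delta by simp
    then have "dense_pair (R k) (\<delta> * real h) (1 / real q / 8) (Y k e) (Y (k + 1) e')"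
      unfolding R_def using 11 by (intro dense_pair_subset[OF dJ YX YX]) simp_all
    then show ?case by (simp add: mult.commute)
  qed
  have "2 * s \<le> L" by (simp add: L_def)
  from embed_grid[OF le_refl this] obtain f where
    F1: "\<forall>i<s. \<forall>j<s. f i j \<in> Y (i + j) (odd i)"
    and F2: "\<forall>i<s. \<forall>j. Suc j < s \<longrightarrow> {f i j, f i (Suc j)} \<in> R (i + j)"
    and F3: "\<forall>i j. Suc i < s \<longrightarrow> j < s \<longrightarrow> {f i j, f (Suc i) j} \<in> R (i + j)"
    and F4: "\<forall>i<s. \<forall>i'<i. \<forall>j<s. \<forall>j'<s. i + j = i' + j' \<longrightarrow> f i j \<noteq> f i' j'"
    by (elim exE conjE) (rule that)
  note f1 = F1[rule_format] and f2 = F2[rule_format] and f3 = F3[rule_format] and f4 = F4[rule_format]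
  have fB: "f i j \<in> B (xs ! (i + j))" if "i < s" "j < s" for i j
    using f1[OF that] YB[of "i + j"] that by (auto simp: L_def)
  define g where "g i j = vertex (xs ! (i + j)) (f i j)" for i j
  have gright: "{g i j, g i (Suc j)} \<in> {e \<in> host_edges. col e = b}" if "i < s" "Suc j < s" for i j
  proof -
    have "i + j < L" using that by (simp add: L_def)
    then show ?thesis using J_D[OF f2[OF that, unfolded R_def] fB _ step(1)] fB[of i "Suc j"] that by (simp add: g_def)
  qed
  have gdown: "{g i j, g (Suc i) j} \<in> {e \<in> host_edges. col e = b}" if "Suc i < s" "j < s" for i j
  proof -
    have "i + j < L" using that by (simp add: L_def)
    then show ?thesis using J_D[OF f3[OF that, unfolded R_def] fB _ step(1)] fB[of "Suc i" j] that by (simp add: g_def)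
  qed
  have ginj: "i = i' \<and> j = j'" if ij: "i < s" "j < s" "i' < s" "j' < s" and eq: "g i j = g i' j'" for i j i' j'
  proof -
    have "xs ! (i + j) = xs ! (i' + j')" and fe: "f i j = f i' j'" using eq by (simp_all add: g_def vertex_eq)
    then have sum: "i + j = i' + j'" using xs(1,3) ij by (simp add: nth_eq_iff_index_eq)
    have "\<not> i' < i" using f4[of i i' j j'] ij sum fe by auto
    moreover have "\<not> i < i'" using f4[of i' i j' j] ij sum fe by auto
    ultimately show ?thesis using sum by simp
  qed
  have gverts: "g i j \<in> host_verts" if "i < s" "j < s" for i j
  proof -
    have "i + j \<le> L" using that by (simp add: L_def)
    then show ?thesis using fB[OF that] xk(1) unfolding host_verts_def g_def by blast
  qed
  define \<phi> where "\<phi> = (\<lambda>(i, j). g (i - 1) (j - 1))"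
  have "contains_copy (verts_of (host_verts, host_edges), {e \<in> edges_of (host_verts, host_edges). col e = b}) (grid_graph s)"
    unfolding contains_copy_def
  proof (intro exI[of _ \<phi>] conjI ballI)
    show "inj_on \<phi> (verts_of (grid_graph s))"
    proof (rule inj_onI)
      fix u v assume uv: "u \<in> verts_of (grid_graph s)" "v \<in> verts_of (grid_graph s)" "\<phi> u = \<phi> v"
      obtain i j i' j' where ij: "u = (i, j)" "v = (i', j')" by (cases u, cases v)
      have r: "1 \<le> i" "i \<le> s" "1 \<le> j" "j \<le> s" "1 \<le> i'" "i' \<le> s" "1 \<le> j'" "j' \<le> s"
        using uv(1,2) by (auto simp: grid_graph_def ij)
      have "i - 1 = i' - 1 \<and> j - 1 = j' - 1" using uv(3) r by (intro ginj) (auto simp: \<phi>_def ij)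
      then show "u = v" using r ij by auto
    qed
    show "\<phi> ` verts_of (grid_graph s) \<subseteq> verts_of (verts_of (host_verts, host_edges), {e \<in> edges_of (host_verts, host_edges). col e = b})"
    proof (rule image_subsetI)
      fix u assume u: "u \<in> verts_of (grid_graph s)"
      obtain i j where ij: "u = (i, j)" by (cases u)
      have "i - 1 < s" "j - 1 < s" using u by (auto simp: grid_graph_def ij)
      then show "\<phi> u \<in> verts_of (verts_of (host_verts, host_edges), {e \<in> edges_of (host_verts, host_edges). col e = b})"
        using gverts by (simp add: \<phi>_def ij)
    qed
    fix e assume "e \<in> edges_of (grid_graph s)"
    then obtain u v where uv: "e = {u, v}" "u \<in> {1..s} \<times> {1..s}" "v \<in> {1..s} \<times> {1..s}" "grid_adj u v"
      by (auto simp: grid_graph_def)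
    have key: "{\<phi> u, \<phi> v} \<in> {e \<in> host_edges. col e = b}"
      if r: "u \<in> {1..s} \<times> {1..s}" "v \<in> {1..s} \<times> {1..s}"
        and a: "(fst v = fst u + 1 \<and> snd v = snd u) \<or> (fst v = fst u \<and> snd v = snd u + 1)" for u v
    proof -
      obtain i j where u: "u = (Suc i, Suc j)" "Suc i \<le> s" "Suc j \<le> s"
        using r(1) by (cases u) (metis SigmaE2 atLeastAtMost_iff One_nat_def Suc_le_D)
      from a show ?thesis
      proof
        assume "fst v = fst u + 1 \<and> snd v = snd u"
        then have v: "v = (Suc (Suc i), Suc j)" by (simp add: prod_eq_iff u)
        then show ?thesis using gdown[of i j] r(2) u by (simp add: \<phi>_def)
      next
        assume "fst v = fst u \<and> snd v = snd u + 1"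
        then have v: "v = (Suc i, Suc (Suc j))" by (simp add: prod_eq_iff u)
        then show ?thesis using gright[of i j] r(2) u by (simp add: \<phi>_def)
      qed
    qed
    have "((fst v = fst u + 1 \<and> snd v = snd u) \<or> (fst v = fst u \<and> snd v = snd u + 1)) \<or>
      ((fst u = fst v + 1 \<and> snd u = snd v) \<or> (fst u = fst v \<and> snd u = snd v + 1))"
      using uv(4) unfolding grid_adj_def by linarith
    then have "{\<phi> u, \<phi> v} \<in> {e \<in> host_edges. col e = b}"
      using key[OF uv(2,3)] key[OF uv(3,2)] by (metis insert_commute)
    then show "\<phi> ` e \<in> edges_of (verts_of (host_verts, host_edges), {e \<in> edges_of (host_verts, host_edges). col e = b})"
      using uv(1) by simp
  qed
  then show "\<exists>b. contains_copy (verts_of (host_verts, host_edges), {e \<in> edges_of (host_verts, host_edges). col e = b}) (grid_graph s)"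
    by blast
qed

end

section \<open>Choice of parameters and the edge count\<close>

text \<open>The order of choices matters: \<open>\<kappa>\<close>, then \<open>\<nu>\<close>, then
  \<open>\<sigma>\<close> and \<open>\<zeta>\<close>, then \<open>C'\<close> and \<open>q0\<close>,
  all before \<open>s\<close>; only \<open>q\<close>, \<open>N0\<close> and \<open>w\<close> depend
  on \<open>s\<close>. The shrinking factor \<open>\<nu>\<close> depends on no host, so the host can
  be chosen to withstand it.\<close>

lemma arrows_grid_sparse:
  "\<exists>A :: real. 0 < A \<and> (\<forall>s. 0 < s \<longrightarrow> (\<exists>\<Gamma> :: nat ugraph. finite_simple_graph \<Gamma> \<and>
     real (card (edges_of \<Gamma>)) \<le> A * sqrt (real s) ^ 5 \<and> arrows \<Gamma> (grid_graph s)))"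
proof -
  obtain \<kappa> :: nat where \<kappa>: "16004001 \<le> \<kappa>" by blast
  have \<kappa>0: "1 \<le> real \<kappa>" using \<kappa> by linarith
  define cs where "cs = List.product [0..<\<kappa>] [0..<\<kappa>]"
  have "0 < \<delta> / 3" "\<delta> / 3 \<le> 1" "0 < (1 / 10 :: real)" using theta_delta by auto
  from regularise[OF this, of cs, where 'a = nat] obtain \<nu> :: real where \<nu>: "0 < \<nu>" "\<nu> \<le> 1" and
    reg: "\<forall>V E c (G :: nat set set) W p J B X t z. blobs V E c G W p J B \<longrightarrow>
    (\<forall>x\<in>V. X x \<subseteq> B x \<and> card (X x) = t) \<longrightarrow> 1 \<le> \<nu> * real t \<longrightarrow> host_dense G W z p \<longrightarrow> z \<le> \<delta> / 3 * \<nu> * real t \<longrightarrow>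
    (\<exists>X' t' D. (\<forall>x\<in>V. X' x \<subseteq> X x \<and> card (X' x) = t') \<and> \<nu> * real t \<le> real t' \<and>
      D \<subseteq> V \<and> real (card D) \<le> 1 / 10 * real (card V) \<and>
      (\<forall>x\<in>V - D. \<forall>y\<in>V - D. E x y \<longrightarrow> (c x, c y) \<in> set cs \<longrightarrow>
        (\<exists>b. dense_pair (J x y b) (\<delta> / 3 * real t') (p / 8) (X' x) (X' y))))"
    by (elim exE conjE) (rule that)
  \<comment> \<open>With \<open>w = \<kappa> * N0\<close>, the least value
    \<open>\<nu> / 3 * N0\<close> of \<open>h\<close> is \<open>\<sigma> * w\<close>, and the
    threshold \<open>\<delta> / 3 * \<nu> * N0\<close> for host density is
    \<open>\<zeta> * w\<close>.\<close>
  define \<sigma> where "\<sigma> = \<nu> / (3 * real \<kappa>)"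
  define \<zeta> where "\<zeta> = \<delta> / 3 * \<nu> / real \<kappa>"
  have \<sigma>: "0 < \<sigma>" "\<sigma> \<le> 1" using \<nu> \<kappa>0 by (auto simp: \<sigma>_def field_simps)
  have \<zeta>: "0 < \<zeta>" using \<nu> \<kappa>0 theta_delta by (simp add: \<zeta>_def)
  obtain C' :: nat where C': "131072 / (\<sigma>\<^sup>2 * \<theta>) \<le> real C'" using real_arch_simple by blast
  \<comment> \<open>A multiple of \<open>\<kappa>\<close>, so that the \<open>w\<close> indices
    divide evenly into \<open>\<kappa>\<close> blocks.\<close>
  define C where "C = \<kappa> * C'"
  have "131072 / (\<sigma>\<^sup>2 * \<theta>) \<le> real C"
  proof -
    have "1 * real C' \<le> real \<kappa> * real C'" using \<kappa>0 by (intro mult_right_mono) auto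
    then show ?thesis using C' by (simp add: C_def)
  qed
  then have C: "131072 \<le> \<sigma>\<^sup>2 * \<theta> * real C" using \<sigma> theta_delta by (simp add: field_simps)
  have \<sigma>C: "131072 \<le> \<sigma> * real C"
  proof -
    have "\<sigma> * \<theta> \<le> 1" using \<sigma> theta_delta by (intro mult_le_one) auto
    then have "(\<sigma> * \<theta>) * (\<sigma> * real C) \<le> 1 * (\<sigma> * real C)" using \<sigma> by (intro mult_right_mono) auto
    then show ?thesis using C by (simp add: power2_eq_square mult_ac)
  qed
  obtain q0 :: nat where q0: "24 + 24 / \<zeta>\<^sup>2 \<le> real q0" using real_arch_simple by blast
  have z2: "0 < \<zeta>\<^sup>2" "0 \<le> 24 / \<zeta>\<^sup>2" using \<zeta> by auto
  \<comment> \<open>\<open>1200 = 300 * 4\<close>: at most \<open>300 * s\<close> vertices in the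
    reduced graph and at most \<open>4 * w\<^sup>2 / q\<close> edges in \<open>G\<close>; the cube
    pays for \<open>q \<le> (q0 + 2) * sqrt s\<close>.\<close>
  define A where "A = 1200 * real \<kappa> * (real C)\<^sup>2 * (real q0 + 2) ^ 3"
  have "0 < real C" using \<sigma>C \<sigma> by (cases C) auto
  then have "0 < A" using \<kappa>0 by (simp add: A_def)
  moreover have "\<exists>\<Gamma> :: nat ugraph. finite_simple_graph \<Gamma> \<and>
     real (card (edges_of \<Gamma>)) \<le> A * sqrt (real s) ^ 5 \<and> arrows \<Gamma> (grid_graph s)" if s: "0 < s" for s
  proof -
    define r where "r = nat \<lceil>sqrt (real s)\<rceil>"
    \<comment> \<open>The ceiling gives \<open>s \<le> q\<^sup>2\<close>, so \<open>s\<close>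
      occupied vertices are few within a blob; adding \<open>q0\<close> makes the lower bounds on
      \<open>q\<close> hold for small \<open>s\<close> too.\<close>
    define q where "q = q0 + r"
    define N0 where "N0 = C' * q\<^sup>2"
    define w where "w = C * q\<^sup>2"
    have s1: "1 \<le> sqrt (real s)" using s by simp
    have r: "sqrt (real s) \<le> real r" "real r \<le> sqrt (real s) + 1"
      unfolding r_def using s1 by (rule_tac real_nat_ceiling_ge, linarith)
    have qs: "sqrt (real s) \<le> real q" "real q0 \<le> real q" using r(1) by (simp_all add: q_def)
    have q24: "24 \<le> q" using q0 z2(2) qs(2) by linarith
    have q\<zeta>: "24 \<le> \<zeta>\<^sup>2 * real q"
    proof -
      have "24 / \<zeta>\<^sup>2 \<le> real q" using q0 qs(2) by linarith
      then show ?thesis using z2(1) by (simp add: field_simps)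
    qed
    have q_le: "real q \<le> (real q0 + 2) * sqrt (real s)"
    proof -
      have "real q \<le> real q0 + (sqrt (real s) + 1)" using r(2) by (simp add: q_def)
      also have "\<dots> \<le> real q0 * sqrt (real s) + (sqrt (real s) + sqrt (real s))"
        using s1 mult_left_mono[OF s1 of_nat_0_le_iff, of q0] by linarith
      finally show ?thesis by (simp add: algebra_simps)
    qed
    have wN: "w = \<kappa> * N0" by (simp add: w_def N0_def C_def)
    have w_real: "real w = real C * real q * real q" by (simp add: w_def power2_eq_square)
    have \<sigma>w: "131072 * (real q * real q) \<le> \<sigma> * real w"
      using mult_right_mono[OF \<sigma>C, of "real q * real q"] by (simp add: w_real mult_ac)
    have qq: "real q \<le> real q * real q" using q24 by simp
    have s_qq: "real s \<le> real q * real q"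
      using mult_mono[OF qs(1) qs(1)] s by simp
    have k: "real s \<le> \<sigma> * real w / 10000" using \<sigma>w s_qq by linarith
    obtain G where host: "G \<subseteq> pairs {..<w}" "real (card G) \<le> 4 * (real w)\<^sup>2 / real q"
      "host_dense G {..<w} (\<zeta> * real w) (1 / real q)"
      "\<forall>h. \<sigma> * real w \<le> real h \<longrightarrow> h \<le> w \<longrightarrow> host_at G {..<w} s q h"
      using host_exists[OF \<sigma> C q24 q\<zeta> \<zeta> w_def k] by blast
    have m0: "0 < 2 * s + 1" by simp
    obtain V :: "nat set" and E :: "nat \<Rightarrow> nat \<Rightarrow> bool" and c :: "nat \<Rightarrow> nat" where red: "finite V" "card V \<le> 100 * (2 * s + 1)" "90 * (2 * s + 1) \<le> card V"
      and adj: "\<And>x y. E x y \<Longrightarrow> E y x" "\<And>x y. E x y \<Longrightarrow> x \<in> V"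
      and col: "\<And>x. x \<in> V \<Longrightarrow> c x < \<kappa>" "\<And>x y. E x y \<Longrightarrow> c x \<noteq> c y"
        "\<And>x y z. E x y \<Longrightarrow> E x z \<Longrightarrow> y \<noteq> z \<Longrightarrow> c y \<noteq> c z"
      and expand: "\<And>A B. A \<subseteq> V \<Longrightarrow> B \<subseteq> V \<Longrightarrow> A \<inter> B = {} \<Longrightarrow> 10 * (2 * s + 1) \<le> card A \<Longrightarrow> 10 * (2 * s + 1) \<le> card B \<Longrightarrow>
      \<exists>a\<in>A. \<exists>b\<in>B. E a b"
      by (rule reduced_graph[OF m0 \<kappa>]) (rule that)
    interpret host_graph V E c G \<kappa> N0
      using red(1) adj col host(1) by unfold_locales (auto simp: wN)
    have WW: "W = {..<w}" by (simp add: W_def wN)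
    have \<nu>N: "\<nu> * real N0 = 3 * (\<sigma> * real w)" using \<kappa>0 by (simp add: \<sigma>_def wN)
    have "arrows (host_verts, host_edges) (grid_graph s)"
    proof (rule arrows_grid[where q = q and \<nu> = \<nu>])
      fix f
      have "blobs V E c G W (1 / real q) (J f) B" by (rule blobs_J) simp
      moreover have "\<forall>x\<in>V. B x \<subseteq> B x \<and> card (B x) = N0" using card_B by simp
      moreover have "1 \<le> \<nu> * real N0" using \<nu>N \<sigma>w qq q24 by linarith
      moreover have "host_dense G W (\<zeta> * real w) (1 / real q)" using host(3) WW by simp
      moreover have "\<zeta> * real w \<le> \<delta> / 3 * \<nu> * real N0" using \<kappa>0 by (simp add: \<zeta>_def wN)
      ultimately have "\<exists>X' t' D. (\<forall>x\<in>V. X' x \<subseteq> B x \<and> card (X' x) = t') \<and> \<nu> * real N0 \<le> real t' \<and>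
        D \<subseteq> V \<and> real (card D) \<le> 1 / 10 * real (card V) \<and>
        (\<forall>x\<in>V - D. \<forall>y\<in>V - D. E x y \<longrightarrow> (c x, c y) \<in> set cs \<longrightarrow>
          (\<exists>b. dense_pair (J f x y b) (\<delta> / 3 * real t') (1 / real q / 8) (X' x) (X' y)))"
        by (rule reg[THEN spec, THEN spec, THEN spec, THEN spec, THEN spec, THEN spec, THEN spec, THEN spec, THEN spec, THEN spec, THEN spec, THEN mp, THEN mp, THEN mp, THEN mp, THEN mp])
      then obtain X' t' D where reg': "\<forall>x\<in>V. X' x \<subseteq> B x \<and> card (X' x) = t'" "\<nu> * real N0 \<le> real t'"
        "D \<subseteq> V" "real (card D) \<le> 1 / 10 * real (card V)"
        "\<forall>x\<in>V - D. \<forall>y\<in>V - D. E x y \<longrightarrow> (c x, c y) \<in> set cs \<longrightarrow>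
          (\<exists>b. dense_pair (J f x y b) (\<delta> / 3 * real t') (1 / real q / 8) (X' x) (X' y))"
        by (elim exE conjE) (rule that)
      have "(c x, c y) \<in> set cs" if "x \<in> V" "y \<in> V" for x y using col(1)[OF that(1)] col(1)[OF that(2)] by (simp add: cs_def)
      then have "\<forall>x\<in>V - D. \<forall>y\<in>V - D. E x y \<longrightarrow>
          (\<exists>b. dense_pair (J f x y b) (\<delta> / 3 * real t') (1 / real q / 8) (X' x) (X' y))"
        using reg'(5) by simp
      then show "\<exists>X' t' D. (\<forall>x\<in>V. X' x \<subseteq> B x \<and> card (X' x) = t') \<and> \<nu> * real N0 \<le> real t' \<and>
        D \<subseteq> V \<and> real (card D) \<le> 1 / 10 * real (card V) \<and>
        (\<forall>x\<in>V - D. \<forall>y\<in>V - D. E x y \<longrightarrow>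
          (\<exists>b. dense_pair (J f x y b) (\<delta> / 3 * real t') (1 / real q / 8) (X' x) (X' y)))"
        using reg'(1-4) by (intro exI[of _ X'] exI[of _ t'] exI[of _ D] conjI)
    next
      show "3 * 4096 * real q \<le> \<nu> * real N0" using \<nu>N \<sigma>w qq by linarith
      show "host_at G W s q h" if "\<nu> / 3 * real N0 \<le> real h" "h \<le> \<kappa> * N0" for h
        using host(4) that \<nu>N unfolding WW wN by simp
    qed (use red(3) expand q24 in auto)
    moreover have "real (card host_edges) \<le> A * sqrt (real s) ^ 5"
    proof -
      have ss: "real s = sqrt (real s) * sqrt (real s)" by simp
      have "real (card V) \<le> 300 * real s"
      proof -
        have "card V \<le> 300 * s" using red(2) s by (simp add: distrib_left del: One_nat_def)
        then have "real (card V) \<le> real (300 * s)" by (rule of_nat_mono)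
        then show ?thesis by simp
      qed
      have "real (card host_edges) \<le> real (card V * \<kappa> * card G)" using card_host_edges by (rule of_nat_mono)
      also have "\<dots> = real (card V) * real \<kappa> * real (card G)" by simp
      also have "\<dots> \<le> (300 * real s) * real \<kappa> * (4 * (real w)\<^sup>2 / real q)"
        using \<open>real (card V) \<le> 300 * real s\<close> host(2) by (intro mult_mono) auto
      also have "(real w)\<^sup>2 = (real C)\<^sup>2 * real q ^ 4" by (simp add: w_real power2_eq_square power4_eq_xxxx)
      also have "(300 * real s) * real \<kappa> * (4 * ((real C)\<^sup>2 * real q ^ 4) / real q) = 1200 * real \<kappa> * (real C)\<^sup>2 * (real s * real q ^ 3)"
        using q24 by (simp add: power4_eq_xxxx power3_eq_cube)
      also have "\<dots> \<le> 1200 * real \<kappa> * (real C)\<^sup>2 * (real s * ((real q0 + 2) * sqrt (real s)) ^ 3)"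
        using q_le by (intro mult_left_mono power_mono) auto
      also have "\<dots> = A * sqrt (real s) ^ 5"
      proof -
        have "x ^ 5 = (x * x) * x ^ 3" for x :: real by (simp add: eval_nat_numeral)
        from this[of "sqrt (real s)"] have "sqrt (real s) ^ 5 = real s * sqrt (real s) ^ 3" using ss by metis
        then show ?thesis by (simp add: A_def power_mult_distrib)
      qed
      finally show ?thesis .
    qed
    ultimately show ?thesis using host_simple by (intro exI[of _ "(host_verts, host_edges)"]) simp
  qed
  ultimately show ?thesis by blast
qed

theorem theorem1p1:
  shows "\<exists>C :: real. C > 0 \<and>
    (\<forall>n s :: nat. n > 0 \<longrightarrow> n = s ^ 2 \<longrightarrow>
       real (size_ramsey (grid_graph s)) \<le> C * real n powr (5 / 4))"
proof -
  obtain A :: real where A: "0 < A" "\<And>s. 0 < s \<Longrightarrow> \<exists>\<Gamma> :: nat ugraph. finite_simple_graph \<Gamma> \<and>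
     real (card (edges_of \<Gamma>)) \<le> A * sqrt (real s) ^ 5 \<and> arrows \<Gamma> (grid_graph s)"
    using arrows_grid_sparse by blast
  have "real (size_ramsey (grid_graph s)) \<le> A * real n powr (5 / 4)" if n: "n > 0" "n = s ^ 2" for n s :: nat
  proof -
    have s: "0 < s" using n by (cases s) auto
    obtain \<Gamma> :: "nat ugraph" where \<Gamma>: "finite_simple_graph \<Gamma>" "real (card (edges_of \<Gamma>)) \<le> A * sqrt (real s) ^ 5"
      "arrows \<Gamma> (grid_graph s)" using A(2)[OF s] by blast
    have "size_ramsey (grid_graph s) \<le> card (edges_of \<Gamma>)"
      unfolding size_ramsey_def using \<Gamma>(1,3) by (intro Least_le exI[of _ \<Gamma>]) simp
    then have "real (size_ramsey (grid_graph s)) \<le> A * sqrt (real s) ^ 5" using \<Gamma>(2) by linarith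
    also have "sqrt (real s) ^ 5 = real n powr (5 / 4)"
    proof -
      have "sqrt (real s) ^ 5 = (real s powr (1 / 2)) powr real 5"
        using s by (simp only: powr_half_sqrt[symmetric] of_nat_0_le_iff) (subst powr_realpow, simp_all)
      also have "\<dots> = real s powr (5 / 2)" by (simp add: powr_powr)
      also have "\<dots> = (real s powr 2) powr (5 / 4)" by (simp only: powr_powr) simp
      also have "real s powr 2 = real n" using s n by (simp add: powr_numeral)
      finally show ?thesis .
    qed
    finally show ?thesis .
  qed
  then show ?thesis using A(1) by blast
qed

end
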